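(* For each positive integer $k$ let $\psi_k$ be the irreducible character of $2$-defect $0$ of $S_{k(k+1)/2}$. For every partition $\lambda$ of a positive integer $m$ there exists a rational function $R_\lambda(x)\in\mathbb{Q}(x)$ such that $$R_\lambda\!\left(\tfrac{k(k+1)}{2}\right)=\frac{\psi_k(\lambda)}{\psi_k(1)}$$ for every positive integer $k$ with $k(k+1)/2\ge m$. Moreover, there is a recursive algorithm which, given $\lambda$, computes the rational function $R_\lambda(x)$.
   Context: The character $\psi_k$ is the complex irreducible character of $S_{k(k+1)/2}$ corresponding to the staircase partition $(k,k-1,\dots,2,1)$; it is the unique irreducible character of $2$-defect zero of $S_{k(k+1)/2}$ (i.e. the $2$-part of its degree equals the $2$-part of $|S_{k(k+1)/2}|$). For a partition $\lambda$ of $m$ and $n\ge m$, $\chi(\lambda)$ denotes the value of a character $\chi$ of $S_n$ at a permutation whose cycle type is $\lambda$ with $n-m$ parts equal to $1$ added. *)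

theory Defs
  imports
    "HOL-Algebra.Sym_Groups"
    "HOL-Combinatorics.Orbits"
    "HOL-Computational_Algebra.Computational_Algebra"
    "HOL-Computational_Algebra.Field_as_Ring"
    "HOL-Library.Multiset"
    "HOL-Library.Nat_Bijection"
    "Jordan_Normal_Form.VS_Connect"
begin

section \<open>Complex characters of finite groups\<close>

definition representation ::
    "('a, 'b) monoid_scheme \<Rightarrow> nat \<Rightarrow> ('a \<Rightarrow> complex mat) \<Rightarrow> bool" where
  "representation G d \<rho> \<longleftrightarrow> \<rho> \<in> hom G (units_of (ring_mat TYPE(complex) d ()))"

definition irreducible_representation ::
    "('a, 'b) monoid_scheme \<Rightarrow> nat \<Rightarrow> ('a \<Rightarrow> complex mat) \<Rightarrow> bool" where
  "irreducible_representation G d \<rho> \<longleftrightarrow>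
     representation G d \<rho> \<and> 0 < d \<and>
     (\<forall>W. VectorSpace.subspace class_ring W (module_vec TYPE(complex) d) \<and>
          (\<forall>g \<in> carrier G. \<forall>w \<in> W. \<rho> g *\<^sub>v w \<in> W)
        \<longrightarrow> W = {0\<^sub>v d} \<or> W = carrier_vec d)"

definition mat_trace :: "'a::comm_monoid_add mat \<Rightarrow> 'a" where
  "mat_trace A = (\<Sum>i<dim_row A. A $$ (i, i))"

text \<open>Only the values of a character on the carrier matter.\<close>

definition irreducible_character ::
    "('a, 'b) monoid_scheme \<Rightarrow> ('a \<Rightarrow> complex) \<Rightarrow> bool" where
  "irreducible_character G \<chi> \<longleftrightarrow>
     (\<exists>d \<rho>. irreducible_representation G d \<rho> \<and>
        (\<forall>g \<in> carrier G. \<chi> g = mat_trace (\<rho> g)))"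

text \<open>The \<open>p\<close>-part of the degree equals the \<open>p\<close>-part of the group order.\<close>

definition defect_zero ::
    "nat \<Rightarrow> ('a, 'b) monoid_scheme \<Rightarrow> ('a \<Rightarrow> complex) \<Rightarrow> bool" where
  "defect_zero p G \<chi> \<longleftrightarrow>
     (\<exists>d::nat. \<chi> \<one>\<^bsub>G\<^esub> = of_nat d \<and> multiplicity p d = multiplicity p (Coset.order G))"


section \<open>Partitions and cycle types\<close>

definition partition_of :: "nat \<Rightarrow> nat multiset \<Rightarrow> bool" where
  "partition_of m \<alpha> \<longleftrightarrow> 0 \<notin># \<alpha> \<and> sum_mset \<alpha> = m"

text \<open>The lengths of all cycles of a permutation of \<open>{1..n}\<close>, fixed points included.\<close>

definition cycle_type :: "nat \<Rightarrow> (nat \<Rightarrow> nat) \<Rightarrow> nat multiset" where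
  "cycle_type n g = image_mset card (mset_set (orbit g ` {1..n}))"


section \<open>Rational functions over the rationals\<close>

text \<open>Numerator and denominator are those of the reduced fraction, so a rational function is
  defined at \<open>x\<close> exactly if \<open>x\<close> is not one of its poles.\<close>

definition ratfun_defined_at :: "rat poly fract \<Rightarrow> rat \<Rightarrow> bool" where
  "ratfun_defined_at R x \<longleftrightarrow> poly (snd (quot_of_fract R)) x \<noteq> 0"

definition ratfun_eval :: "rat poly fract \<Rightarrow> rat \<Rightarrow> rat" where
  "ratfun_eval R x = poly (fst (quot_of_fract R)) x / poly (snd (quot_of_fract R)) x"


section \<open>Computability\<close>

text \<open>The total recursive functions of \<open>n\<close> arguments (Kleene), with minimisation restricted to
  functions that have a zero for all values of the parameters. Arguments are passed as a list;
  values on lists of a length other than \<open>n\<close> carry no meaning. In the rule for primitive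
  recursion the first argument is the recursion variable.\<close>

inductive recursive :: "nat \<Rightarrow> (nat list \<Rightarrow> nat) \<Rightarrow> bool" where
  zero: "recursive n (\<lambda>xs. 0)"
| succ: "recursive 1 (\<lambda>xs. Suc (xs ! 0))"
| proj: "i < n \<Longrightarrow> recursive n (\<lambda>xs. xs ! i)"
| comp: "recursive (length gs) f \<Longrightarrow> (\<forall>g \<in> set gs. recursive n g) \<Longrightarrow>
     recursive n (\<lambda>xs. f (map (\<lambda>g. g xs) gs))"
| prim_rec: "recursive n f \<Longrightarrow> recursive (Suc (Suc n)) g \<Longrightarrow>
     recursive (Suc n) (\<lambda>xs. rec_nat (f (tl xs)) (\<lambda>y r. g (y # r # tl xs)) (hd xs))"
| minimise: "recursive (Suc n) f \<Longrightarrow> (\<forall>xs. length xs = n \<longrightarrow> (\<exists>y. f (y # xs) = 0)) \<Longrightarrow>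
     recursive n (\<lambda>xs. LEAST y. f (y # xs) = 0)"

definition computable :: "(nat \<Rightarrow> nat) \<Rightarrow> bool" where
  "computable h \<longleftrightarrow> (\<exists>f. recursive 1 f \<and> (\<forall>x. f [x] = h x))"

definition partition_code :: "nat multiset \<Rightarrow> nat" where
  "partition_code \<alpha> = list_encode (sorted_list_of_multiset \<alpha>)"

text \<open>Every element of the field of rational functions over the rationals is a quotient of two
  polynomials with integer coefficients. A code consists of the two coefficient lists, constant
  term first. It need not describe the reduced fraction, and trailing zeros are allowed.\<close>

definition ratfun_code :: "int list \<Rightarrow> int list \<Rightarrow> nat" where
  "ratfun_code ps qs =
     prod_encode (list_encode (map int_encode ps), list_encode (map int_encode qs))"

definition encodes_ratfun :: "nat \<Rightarrow> rat poly fract \<Rightarrow> bool" where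
  "encodes_ratfun c R \<longleftrightarrow>
     (\<exists>ps qs. c = ratfun_code ps qs \<and> Poly (map rat_of_int qs) \<noteq> 0 \<and>
        R = Fract (Poly (map rat_of_int ps)) (Poly (map rat_of_int qs)))"

end

theory Submission
  imports
    Defs
    "HOL-Algebra.Multiplicative_Group"
    "HOL-Number_Theory.Totient"
    "Jordan_Normal_Form.Spectral_Radius"
begin

text \<open>Fix an irreducible character \<open>\<psi>\<close> of \<open>2\<close>-defect zero of the symmetric group on \<open>n\<close> points and
  put \<open>\<phi> = \<psi> / \<psi> 1\<close>. Two properties of \<open>\<psi>\<close> determine \<open>\<phi>\<close> completely, by a recursion in
  which \<open>n\<close> enters only through a linear factor.

  \<^bold>\<open>Vanishing\<close> (\<open>defect_zero_two_vanishes\<close>). \<open>\<psi>\<close> is zero on every permutation that has a cycle of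
  even length. This is an instance of the theorem that characters of \<open>p\<close>-defect zero vanish on
  \<open>p\<close>-singular elements. Up to the scalar \<open>n! / \<psi> 1\<close>, a unit at \<open>2\<close>, the character is idempotent
  under convolution, so for every \<open>N\<close> the sum of \<open>\<psi> x\<^sub>1 \<dots> \<psi> x\<^sub>N\<close> over all words
  \<open>x\<^sub>1, \<dots>, x\<^sub>N\<close> with product in a conjugacy class \<open>K\<close> is, up to such units, the sum of \<open>\<psi>\<close> over \<open>K\<close>.
  Take \<open>N\<close> to be a power of \<open>2\<close>. Cyclic rotation permutes these words and preserves the summands. A
  word with a large stabiliser is a proper power, so its product is the \<open>2\<^sup>a\<close>-th power of a
  permutation for a large \<open>a\<close> and has cycles of odd length only. If \<open>K\<close> consists of permutations
  with an even cycle, all orbits are therefore long, and the integer \<open>card K * \<psi> K\<close> is divisible by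
  arbitrarily high powers of \<open>2\<close> (\<open>vanishes_off_prime_powers\<close>). That the values of \<open>\<psi>\<close> are
  integers is shown in \<open>sym_group_character_int\<close>.

  \<^bold>\<open>Transpositions\<close> (\<open>defect_zero_recursion\<close>). The sum of all transpositions is central and
  acts as a scalar in a representation affording \<open>\<psi>\<close>. Its trace is a multiple of \<open>\<psi>\<close> at a transposition,
  which is zero. So the scalar is zero, and the sum of \<open>\<psi> (g t)\<close> over all transpositions \<open>t\<close>
  vanishes for every \<open>g\<close>. Multiplication by a transposition cuts one cycle of \<open>g\<close> into two or joins two
  cycles. Let \<open>g\<close> have a cycle of even length \<open>m\<close>. Terms in which this cycle survives vanish, and
  writing \<open>\<gamma>\<close> for the other cycle lengths there remains
  \<open>(\<Sum>d\<in>{1..<m}. \<phi> (\<gamma> + {#d, m - d#})) + 2 * (\<Sum>r\<in>#\<gamma>. r * \<phi> (\<gamma> - {#r#} + {#m + r#})) = 0\<close>.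
  The parts \<open>r = 1\<close> in the second sum all contribute \<open>\<phi>\<close> at the type in which \<open>m\<close> is replaced by
  \<open>m + 1\<close> and one fixed point is used up. Solving for this value expresses \<open>\<phi>\<close> at a type with an odd
  part \<open>h = m + 1\<close> by values at types whose non-trivial cycles cover fewer points, with divisor \<open>2 * (n - s)\<close>
  where \<open>s\<close> is \<open>m\<close> plus the lengths of the other non-trivial cycles. Types with an even part have value \<open>0\<close>.

  Clearing denominators turns this into a recursion for integer polynomials
  (\<open>character_poly\<close>). For a partition \<open>\<alpha>\<close> of \<open>m\<close> the common denominator is
  \<open>\<Prod>j<m. 2 * (x - j)\<close>, which is non-zero at every \<open>n \<ge> m\<close> and is itself the polynomial attached to
  \<open>m\<close> parts equal to \<open>1\<close>; the quotient is \<open>ratfun \<alpha>\<close>. The recursion is the algorithm. To see that it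
  is computable in the sense of Kleene, the coefficients are written as differences of two
  weighted counts of the leaves of the recursion tree, and such a tree is traversed with a stack
  (\<open>computable_tree_recursion\<close>).\<close>

section \<open>Schur's lemma\<close>

text \<open>Representations are homomorphisms into the unit group of the matrix ring; these are the
  consequences in terms of matrices.\<close>

lemma representationD:
  assumes "representation G d \<rho>" "group G"
  shows "g \<in> carrier G \<Longrightarrow> \<rho> g \<in> carrier_mat d d"
    and "g \<in> carrier G \<Longrightarrow> h \<in> carrier G \<Longrightarrow> \<rho> (g \<otimes>\<^bsub>G\<^esub> h) = \<rho> g * \<rho> h"
    and "\<rho> \<one>\<^bsub>G\<^esub> = 1\<^sub>m d"
proof -
  interpret G: group G by (rule assms(2))
  let ?R = "ring_mat TYPE(complex) d ()"
  interpret R: ring ?R by (rule ring_mat)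
  have hom: "\<rho> \<in> hom G (units_of ?R)" using assms by (simp add: representation_def)
  have U: "g \<in> carrier G \<Longrightarrow> \<rho> g \<in> Units ?R" for g
    using hom by (auto simp: hom_def units_of_def)
  show car: "g \<in> carrier G \<Longrightarrow> \<rho> g \<in> carrier_mat d d" for g
    using U[of g] by (auto simp: Units_def ring_mat_simps)
  show mul: "g \<in> carrier G \<Longrightarrow> h \<in> carrier G \<Longrightarrow> \<rho> (g \<otimes>\<^bsub>G\<^esub> h) = \<rho> g * \<rho> h" for g h
    using hom by (auto simp: hom_def units_of_def ring_mat_simps)
  interpret group_hom G "units_of ?R" \<rho>
    by (intro group_hom.intro group_hom_axioms.intro G.group_axioms R.units_group hom)
  show "\<rho> \<one>\<^bsub>G\<^esub> = 1\<^sub>m d" using hom_one by (simp add: units_of_def ring_mat_simps)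
qed

text \<open>An eigenspace of a matrix that commutes with the representation is invariant, hence
  everything. The scalar is then read off from the trace.\<close>

lemma Schur_scalar:
  assumes irr: "irreducible_representation G d \<rho>" and G: "group G"
    and M: "M \<in> carrier_mat d d"
    and comm: "\<And>g. g \<in> carrier G \<Longrightarrow> M * \<rho> g = \<rho> g * M"
  shows "M = (mat_trace M / of_nat d) \<cdot>\<^sub>m 1\<^sub>m d"
proof -
  have rep: "representation G d \<rho>" and d: "0 < d" using irr unfolding irreducible_representation_def by simp_all
  obtain c where "c \<in> spectrum M" using spectrum_non_empty[OF M d] by auto
  then have "eigenvalue M c" by (simp add: spectrum_def)
  then obtain v where v: "v \<in> carrier_vec d" "v \<noteq> 0\<^sub>v d" "M *\<^sub>v v = c \<cdot>\<^sub>v v"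
    using M by (auto simp: eigenvalue_def eigenvector_def)
  define W where "W = {w \<in> carrier_vec d. M *\<^sub>v w = c \<cdot>\<^sub>v w}"
  have "VectorSpace.subspace class_ring W (module_vec TYPE(complex) d)"
    unfolding subspace_def submodule_def
  proof (intro conjI)
    show "vectorspace class_ring (module_vec TYPE(complex) d)" by (rule vec_vs)
    show "module class_ring (module_vec TYPE(complex) d)" by (rule vec_module)
  qed (use M in \<open>auto simp: W_def module_vec_simps class_ring_simps mult_add_distrib_mat_vec
          smult_add_distrib_vec mult_mat_vec smult_smult_assoc mult.commute\<close>)
  moreover have "\<rho> g *\<^sub>v w \<in> W" if g: "g \<in> carrier G" and w: "w \<in> W" for g w
  proof -
    have w': "w \<in> carrier_vec d" "M *\<^sub>v w = c \<cdot>\<^sub>v w" using w by (auto simp: W_def)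
    note rg = representationD(1)[OF rep G g]
    have "M *\<^sub>v (\<rho> g *\<^sub>v w) = (M * \<rho> g) *\<^sub>v w" using assoc_mult_mat_vec[OF M rg w'(1)] by simp
    also have "\<dots> = (\<rho> g * M) *\<^sub>v w" using comm[OF g] by simp
    also have "\<dots> = \<rho> g *\<^sub>v (M *\<^sub>v w)" using assoc_mult_mat_vec[OF rg M w'(1)] by simp
    also have "\<dots> = c \<cdot>\<^sub>v (\<rho> g *\<^sub>v w)" using w' mult_mat_vec[OF rg w'(1)] by simp
    finally show ?thesis using g w' M representationD(1)[OF rep G g] by (auto simp: W_def)
  qed
  ultimately have "W = {0\<^sub>v d} \<or> W = carrier_vec d"
    using irr unfolding irreducible_representation_def by blast
  moreover have "v \<in> W" using v by (simp add: W_def)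
  ultimately have W: "W = carrier_vec d" using v by auto
  have Mc: "M = c \<cdot>\<^sub>m 1\<^sub>m d"
  proof (rule eq_matI)
    fix i j assume "i < dim_row (c \<cdot>\<^sub>m 1\<^sub>m d :: complex mat)" "j < dim_col (c \<cdot>\<^sub>m 1\<^sub>m d :: complex mat)"
    then have ij: "i < d" "j < d" by auto
    have "unit_vec d j \<in> W" by (simp add: W)
    then have "M *\<^sub>v unit_vec d j = c \<cdot>\<^sub>v unit_vec d j" by (simp add: W_def)
    then have "(M *\<^sub>v unit_vec d j) $ i = (c \<cdot>\<^sub>v unit_vec d j) $ i" by simp
    then show "M $$ (i, j) = (c \<cdot>\<^sub>m 1\<^sub>m d) $$ (i, j)"
      using M ij by (auto simp: one_mat_def)
  qed (use M in auto)
  have "mat_trace M = (\<Sum>i<d. c)"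
    unfolding mat_trace_def using M by (intro sum.cong) (auto simp: Mc)
  then show ?thesis using Mc d by simp
qed

text \<open>The form in which the lemma is applied to sums over the group, which are taken entry by entry.\<close>

lemma Schur_entries:
  assumes irr: "irreducible_representation G d \<rho>" and G: "group G"
    and comm: "\<And>g i j. g \<in> carrier G \<Longrightarrow> i < d \<Longrightarrow> j < d \<Longrightarrow>
       (\<Sum>k<d. m i k * \<rho> g $$ (k, j)) = (\<Sum>k<d. \<rho> g $$ (i, k) * m k j)"
    and ij: "i < d" "j < d"
  shows "m i j = (if i = j then (\<Sum>k<d. m k k) / of_nat d else 0)"
proof -
  have rep: "representation G d \<rho>" using irr unfolding irreducible_representation_def by (elim conjE)
  define M where "M = mat d d (\<lambda>(i, j). m i j)"
  have M: "M \<in> carrier_mat d d" by (simp add: M_def)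
  have "M * \<rho> g = \<rho> g * M" if g: "g \<in> carrier G" for g
  proof (rule eq_matI)
    fix i j assume "i < dim_row (\<rho> g * M)" "j < dim_col (\<rho> g * M)"
    then have "i < d" "j < d" using representationD(1)[OF rep G g] M by auto
    then show "(M * \<rho> g) $$ (i, j) = (\<rho> g * M) $$ (i, j)"
      using representationD(1)[OF rep G g] comm[OF g, of i j]
      by (simp add: M_def scalar_prod_def atLeast0LessThan)
  qed (use representationD(1)[OF rep G g] M in auto)
  from Schur_scalar[OF irr G M this]
  have "M $$ (i, j) = ((mat_trace M / of_nat d) \<cdot>\<^sub>m 1\<^sub>m d) $$ (i, j)" by simp
  then show ?thesis using ij by (simp add: M_def mat_trace_def)
qed

lemma representation_entries:
  assumes "representation G d \<rho>" "group G" "g \<in> carrier G" "h \<in> carrier G" "i < d" "j < d"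
  shows "\<rho> (g \<otimes>\<^bsub>G\<^esub> h) $$ (i, j) = (\<Sum>k<d. \<rho> g $$ (i, k) * \<rho> h $$ (k, j))"
proof -
  note car = representationD(1)[OF assms(1,2)]
  show ?thesis
    unfolding representationD(2)[OF assms(1-4)]
    using car[OF assms(3)] car[OF assms(4)] assms(5,6)
    by (simp add: scalar_prod_def atLeast0LessThan)
qed

text \<open>For fixed \<open>a\<close> and \<open>b\<close> the left-hand side is the \<open>(i, j)\<close> entry of the average of
  \<open>\<rho> h E \<rho> h\<inverse>\<close> for the matrix unit \<open>E\<close> at \<open>(a, b)\<close>, which commutes with the representation.\<close>

lemma Schur_orthogonality:
  assumes irr: "irreducible_representation G d \<rho>" and G: "group G" and fin: "finite (carrier G)"
    and ij: "i < d" "j < d" "a < d" "b < d"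
  shows "(\<Sum>h\<in>carrier G. \<rho> h $$ (i, a) * \<rho> (inv\<^bsub>G\<^esub> h) $$ (b, j))
           = (if i = j \<and> a = b then of_nat (Coset.order G) / of_nat d else 0)"
proof -
  interpret G: group G by (rule G)
  have rep: "representation G d \<rho>" using irr unfolding irreducible_representation_def by (elim conjE)
  note ent = representation_entries[OF rep G]
  define m where "m i j = (\<Sum>h\<in>carrier G. \<rho> h $$ (i, a) * \<rho> (inv\<^bsub>G\<^esub> h) $$ (b, j))" for i j
  have comm: "(\<Sum>k<d. m i k * \<rho> g $$ (k, j)) = (\<Sum>k<d. \<rho> g $$ (i, k) * m k j)"
    if g: "g \<in> carrier G" and ij: "i < d" "j < d" for g i j
  proof -
    have c1: "inv\<^bsub>G\<^esub> g \<otimes>\<^bsub>G\<^esub> (g \<otimes>\<^bsub>G\<^esub> x) = x" "g \<otimes>\<^bsub>G\<^esub> (inv\<^bsub>G\<^esub> g \<otimes>\<^bsub>G\<^esub> x) = x"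
      if "x \<in> carrier G" for x
      using g that by (simp_all add: G.m_assoc[symmetric])
    have "(\<Sum>k<d. m i k * \<rho> g $$ (k, j))
        = (\<Sum>h\<in>carrier G. \<rho> h $$ (i, a) * (\<Sum>k<d. \<rho> (inv\<^bsub>G\<^esub> h) $$ (b, k) * \<rho> g $$ (k, j)))"
      unfolding m_def sum_distrib_right sum_distrib_left
      by (subst sum.swap) (simp add: mult.assoc)
    also have "\<dots> = (\<Sum>h\<in>carrier G. \<rho> h $$ (i, a) * \<rho> (inv\<^bsub>G\<^esub> h \<otimes>\<^bsub>G\<^esub> g) $$ (b, j))"
      using g ij \<open>b < d\<close> by (intro sum.cong refl) (simp add: ent)
    also have "\<dots> = (\<Sum>h\<in>carrier G. \<rho> (g \<otimes>\<^bsub>G\<^esub> h) $$ (i, a) * \<rho> (inv\<^bsub>G\<^esub> h) $$ (b, j))"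
      by (rule sum.reindex_bij_witness[of _ "\<lambda>h. g \<otimes>\<^bsub>G\<^esub> h" "\<lambda>h. inv\<^bsub>G\<^esub> g \<otimes>\<^bsub>G\<^esub> h"])
        (use g in \<open>simp_all add: G.inv_mult_group c1\<close>)
    also have "\<dots> = (\<Sum>h\<in>carrier G. (\<Sum>k<d. \<rho> g $$ (i, k) * \<rho> h $$ (k, a)) * \<rho> (inv\<^bsub>G\<^esub> h) $$ (b, j))"
      using g ij \<open>a < d\<close> by (intro sum.cong refl) (simp add: ent)
    also have "\<dots> = (\<Sum>k<d. \<rho> g $$ (i, k) * m k j)"
      unfolding m_def sum_distrib_right sum_distrib_left
      by (subst sum.swap) (simp add: mult.assoc)
    finally show ?thesis .
  qed
  have tr: "(\<Sum>k<d. m k k) = (if a = b then of_nat (Coset.order G) else 0)"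
  proof -
    have "(\<Sum>k<d. m k k) = (\<Sum>h\<in>carrier G. \<Sum>k<d. \<rho> (inv\<^bsub>G\<^esub> h) $$ (b, k) * \<rho> h $$ (k, a))"
      unfolding m_def by (subst sum.swap) (simp add: mult.commute)
    also have "\<dots> = (\<Sum>h\<in>carrier G. \<rho> (inv\<^bsub>G\<^esub> h \<otimes>\<^bsub>G\<^esub> h) $$ (b, a))"
      using ij by (intro sum.cong refl, subst ent) auto
    also have "\<dots> = (\<Sum>h\<in>carrier G. if a = b then 1 else 0)"
      using ij representationD(3)[OF rep G] by (intro sum.cong refl) (auto simp: )
    finally show ?thesis by (simp add: Coset.order_def)
  qed
  show ?thesis
    using Schur_entries[OF irr G comm ij(1,2)] tr by (auto simp: m_def)
qed

text \<open>Up to the scalar \<open>order G / d\<close> the character is idempotent under convolution.\<close>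

lemma character_convolution:
  assumes irr: "irreducible_representation G d \<rho>" and G: "group G" and fin: "finite (carrier G)"
    and g: "g \<in> carrier G"
  shows "(\<Sum>h\<in>carrier G. mat_trace (\<rho> h) * mat_trace (\<rho> (inv\<^bsub>G\<^esub> h \<otimes>\<^bsub>G\<^esub> g)))
           = of_nat (Coset.order G) / of_nat d * mat_trace (\<rho> g)"
proof -
  interpret G: group G by (rule G)
  have rep: "representation G d \<rho>" using irr unfolding irreducible_representation_def by (elim conjE)
  note ent = representation_entries[OF rep G]
  have tr: "mat_trace (\<rho> h) = (\<Sum>i<d. \<rho> h $$ (i, i))" if "h \<in> carrier G" for h
    using representationD(1)[OF rep G that] by (simp add: mat_trace_def)
  have "(\<Sum>h\<in>carrier G. mat_trace (\<rho> h) * mat_trace (\<rho> (inv\<^bsub>G\<^esub> h \<otimes>\<^bsub>G\<^esub> g)))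
    = (\<Sum>h\<in>carrier G. \<Sum>b<d. \<Sum>j<d. \<Sum>i<d. \<rho> g $$ (j, b) * (\<rho> h $$ (i, i) * \<rho> (inv\<^bsub>G\<^esub> h) $$ (b, j)))"
    using g by (intro sum.cong refl) (simp add: tr ent sum_distrib_left sum_distrib_right mult_ac)
  also have "\<dots> = (\<Sum>b<d. \<Sum>j<d. \<Sum>i<d. \<Sum>h\<in>carrier G.
      \<rho> g $$ (j, b) * (\<rho> h $$ (i, i) * \<rho> (inv\<^bsub>G\<^esub> h) $$ (b, j)))"
    by (subst sum.swap, intro sum.cong refl, subst sum.swap, intro sum.cong refl, rule sum.swap)
  also have "\<dots> = (\<Sum>b<d. \<Sum>j<d. \<Sum>i<d. 
      \<rho> g $$ (j, b) * (if i = j \<and> i = b then of_nat (Coset.order G) / of_nat d else 0))"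
    unfolding sum_distrib_left[symmetric]
    using Schur_orthogonality[OF irr G fin] by (intro sum.cong refl) simp
  also have "\<dots> = (\<Sum>b<d. \<Sum>j<d. \<Sum>i<d. 
      (if i = j then if b = j then \<rho> g $$ (b, b) * (of_nat (Coset.order G) / of_nat d) else 0 else 0))"
    by (intro sum.cong refl) auto
  also have "\<dots> = (\<Sum>b<d. \<rho> g $$ (b, b) * (of_nat (Coset.order G) / of_nat d))"
    by simp
  also have "\<dots> = of_nat (Coset.order G) / of_nat d * mat_trace (\<rho> g)"
    using g by (simp add: tr sum_distrib_right sum_distrib_left mult.commute)
  finally show ?thesis .
qed

lemma character_conj:
  assumes rep: "representation G d \<rho>" and G: "group G" and g: "g \<in> carrier G" "h \<in> carrier G"
  shows "mat_trace (\<rho> (g \<otimes>\<^bsub>G\<^esub> h)) = mat_trace (\<rho> (h \<otimes>\<^bsub>G\<^esub> g))"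
proof -
  interpret G: group G by (rule G)
  have tr: "mat_trace (\<rho> h) = (\<Sum>i<d. \<rho> h $$ (i, i))" if "h \<in> carrier G" for h
    using representationD(1)[OF rep G that] by (simp add: mat_trace_def)
  show ?thesis
    using g by (simp add: tr representation_entries[OF rep G])
      (subst sum.swap, simp add: mult.commute)
qed

text \<open>The sum over a conjugation-invariant set acts as a scalar; when its trace vanishes it acts as
  zero, also after translation by any \<open>g\<close>.\<close>

lemma class_sum_vanishes:
  assumes irr: "irreducible_representation G d \<rho>" and G: "group G"
    and T: "T \<subseteq> carrier G" "finite T"
    and closed: "\<And>g t. g \<in> carrier G \<Longrightarrow> t \<in> T \<Longrightarrow> g \<otimes>\<^bsub>G\<^esub> t \<otimes>\<^bsub>G\<^esub> inv\<^bsub>G\<^esub> g \<in> T"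
    and zero: "(\<Sum>t\<in>T. mat_trace (\<rho> t)) = 0"
    and g: "g \<in> carrier G"
  shows "(\<Sum>t\<in>T. mat_trace (\<rho> (g \<otimes>\<^bsub>G\<^esub> t))) = 0"
proof -
  interpret G: group G by (rule G)
  have rep: "representation G d \<rho>" using irr unfolding irreducible_representation_def by (elim conjE)
  note ent = representation_entries[OF rep G]
  have tr: "mat_trace (\<rho> h) = (\<Sum>i<d. \<rho> h $$ (i, i))" if "h \<in> carrier G" for h
    using representationD(1)[OF rep G that] by (simp add: mat_trace_def)
  define m where "m i j = (\<Sum>t\<in>T. \<rho> t $$ (i, j))" for i j
  have comm: "(\<Sum>k<d. m i k * \<rho> g $$ (k, j)) = (\<Sum>k<d. \<rho> g $$ (i, k) * m k j)"
    if g: "g \<in> carrier G" and ij: "i < d" "j < d" for g i j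
  proof -
    have "(\<Sum>k<d. m i k * \<rho> g $$ (k, j)) = (\<Sum>t\<in>T. \<rho> (t \<otimes>\<^bsub>G\<^esub> g) $$ (i, j))"
      unfolding m_def sum_distrib_right using T g ij
      by (subst sum.swap) (auto intro!: sum.cong simp: ent subset_iff)
    also have "\<dots> = (\<Sum>t\<in>T. \<rho> (g \<otimes>\<^bsub>G\<^esub> t) $$ (i, j))"
    proof (rule sum.reindex_bij_witness[of _ "\<lambda>t. g \<otimes>\<^bsub>G\<^esub> t \<otimes>\<^bsub>G\<^esub> inv\<^bsub>G\<^esub> g" "\<lambda>t. inv\<^bsub>G\<^esub> g \<otimes>\<^bsub>G\<^esub> t \<otimes>\<^bsub>G\<^esub> g"])
      fix t assume t: "t \<in> T"
      then have tc: "t \<in> carrier G" using T by auto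
      have c1: "inv\<^bsub>G\<^esub> g \<otimes>\<^bsub>G\<^esub> (g \<otimes>\<^bsub>G\<^esub> x) = x" "g \<otimes>\<^bsub>G\<^esub> (inv\<^bsub>G\<^esub> g \<otimes>\<^bsub>G\<^esub> x) = x"
        if "x \<in> carrier G" for x
        using g that by (simp_all add: G.m_assoc[symmetric])
      show "g \<otimes>\<^bsub>G\<^esub> (inv\<^bsub>G\<^esub> g \<otimes>\<^bsub>G\<^esub> t \<otimes>\<^bsub>G\<^esub> g) \<otimes>\<^bsub>G\<^esub> inv\<^bsub>G\<^esub> g = t"
        using g tc by (simp add: G.m_assoc c1)
      show "inv\<^bsub>G\<^esub> g \<otimes>\<^bsub>G\<^esub> t \<otimes>\<^bsub>G\<^esub> g \<in> T" using closed[of "inv\<^bsub>G\<^esub> g" t] g t by simp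
      show "inv\<^bsub>G\<^esub> g \<otimes>\<^bsub>G\<^esub> (g \<otimes>\<^bsub>G\<^esub> t \<otimes>\<^bsub>G\<^esub> inv\<^bsub>G\<^esub> g) \<otimes>\<^bsub>G\<^esub> g = t"
        using g tc by (simp add: G.m_assoc c1)
      show "g \<otimes>\<^bsub>G\<^esub> t \<otimes>\<^bsub>G\<^esub> inv\<^bsub>G\<^esub> g \<in> T" using closed g t by simp
      show "\<rho> (g \<otimes>\<^bsub>G\<^esub> (inv\<^bsub>G\<^esub> g \<otimes>\<^bsub>G\<^esub> t \<otimes>\<^bsub>G\<^esub> g)) $$ (i, j) = \<rho> (t \<otimes>\<^bsub>G\<^esub> g) $$ (i, j)"
        using g tc by (simp add: G.m_assoc c1)
    qed
    also have "\<dots> = (\<Sum>k<d. \<rho> g $$ (i, k) * m k j)"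
      unfolding m_def sum_distrib_left using T g ij
      by (subst sum.swap) (auto intro!: sum.cong simp: ent subset_iff)
    finally show ?thesis .
  qed
  have "(\<Sum>k<d. m k k) = (\<Sum>t\<in>T. mat_trace (\<rho> t))"
    unfolding m_def by (subst sum.swap) (use T in \<open>auto intro!: sum.cong simp: tr subset_iff\<close>)
  then have "(\<Sum>k<d. m k k) = 0" using zero by simp
  then have m0: "m i j = 0" if "i < d" "j < d" for i j
    using Schur_entries[OF irr G comm that] by simp
  have "(\<Sum>t\<in>T. mat_trace (\<rho> (g \<otimes>\<^bsub>G\<^esub> t))) = (\<Sum>t\<in>T. \<Sum>i<d. \<Sum>k<d. \<rho> g $$ (i, k) * \<rho> t $$ (k, i))"
    using T g by (intro sum.cong refl) (auto simp: tr ent subset_iff)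
  also have "\<dots> = (\<Sum>i<d. \<Sum>k<d. \<rho> g $$ (i, k) * m k i)"
    unfolding m_def sum_distrib_left
    by (subst sum.swap, intro sum.cong refl, rule sum.swap)
  also have "\<dots> = 0" by (simp add: m0)
  finally show ?thesis .
qed

section \<open>Orbits\<close>

lemma funpow_eq_iff_mod_card_orbit:
  assumes "x \<in> orbit f x"
  shows "(f ^^ i) x = (f ^^ j) x \<longleftrightarrow> i mod card (orbit f x) = j mod card (orbit f x)"
proof -
  let ?p = "funpow_dist1 f x x"
  have p: "(f ^^ ?p) x = x" using funpow_dist1_prop[OF assms] .
  have c: "card (orbit f x) = ?p"
    using orbit_conv_funpow_dist1[OF assms] inj_on_funpow_dist1[OF assms] by (simp add: card_image)
  have "(f ^^ i) x = (f ^^ j) x \<longleftrightarrow> (f ^^ (i mod ?p)) x = (f ^^ (j mod ?p)) x"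
    using funpow_mod_eq[OF p] by simp
  also have "\<dots> \<longleftrightarrow> i mod ?p = j mod ?p"
    using funpow_neq_less_funpow_dist1[OF assms, of "i mod ?p" "j mod ?p"] by fastforce
  finally show ?thesis by (simp add: c)
qed

lemma card_orbit_dvd_iff:
  assumes "x \<in> orbit f x"
  shows "(f ^^ m) x = x \<longleftrightarrow> card (orbit f x) dvd m"
  using funpow_eq_iff_mod_card_orbit[OF assms, of m 0] by (simp add: mod_eq_0_iff_dvd)

lemma orbit_eq_iff:
  assumes "x \<in> orbit f x" "y \<in> orbit f x"
  shows "orbit f y = orbit f x"
  using assms by (meson orbit_swap orbit_trans self_in_orbit_trans subset_antisym subsetI)

section \<open>Class functions that are idempotent up to a scalar\<close>

text \<open>The orbits of \<open>r\<close> have \<open>p\<close>-power length, and a length of at most \<open>p ^ c\<close> would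
  produce a fixed point of \<open>r ^^ (p ^ c)\<close>. Each orbit therefore contributes a multiple of
  \<open>p ^ (c + 1)\<close>.\<close>

lemma prime_power_dvd_sum_free_action:
  fixes F :: "'a \<Rightarrow> int"
  assumes "finite X" and p: "prime p"
    and rX: "\<And>x. x \<in> X \<Longrightarrow> r x \<in> X"
    and Fr: "\<And>x. x \<in> X \<Longrightarrow> F (r x) = F x"
    and per: "\<And>x. x \<in> X \<Longrightarrow> (r ^^ (p ^ n)) x = x"
    and free: "\<And>x. x \<in> X \<Longrightarrow> (r ^^ (p ^ c)) x \<noteq> x"
  shows "int p ^ (c + 1) dvd (\<Sum>x\<in>X. F x)"
proof -
  have self: "x \<in> orbit r x" if "x \<in> X" for x
    using per[OF that] p by (auto simp: orbit_altdef prime_gt_0_nat intro!: exI[of _ "p ^ n"])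
  have sub: "orbit r x \<subseteq> X" if "x \<in> X" for x
  proof
    fix y assume "y \<in> orbit r x" then show "y \<in> X" by induct (auto intro: rX that)
  qed
  have Fo: "F y = F x" if "x \<in> X" "y \<in> orbit r x" for x y
    using that(2)
  proof induct
    case (step y)
    then have "y \<in> X" using sub[OF that(1)] by auto
    then show ?case using step Fr by simp
  qed (simp add: Fr that)
  have card: "p ^ (c + 1) dvd card (orbit r x)" if x: "x \<in> X" for x
  proof -
    have "card (orbit r x) dvd p ^ n" using per[OF x] card_orbit_dvd_iff[OF self[OF x]] by blast
    then obtain i where i: "card (orbit r x) = p ^ i" using divides_primepow_nat[OF p] by auto
    have "\<not> card (orbit r x) dvd p ^ c" using free[OF x] card_orbit_dvd_iff[OF self[OF x]] by blast
    then have "\<not> i \<le> c" using i le_imp_power_dvd by metis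
    then have "c + 1 \<le> i" by simp
    then show ?thesis unfolding i by (rule le_imp_power_dvd)
  qed
  have X: "X = \<Union>(orbit r ` X)" using self sub by auto
  have "(\<Sum>x\<in>\<Union>(orbit r ` X). F x) = (\<Sum>A\<in>orbit r ` X. \<Sum>x\<in>A. F x)"
  proof (subst sum.Union_disjoint)
    show "\<forall>A\<in>orbit r ` X. finite A" using finite_subset[OF sub \<open>finite X\<close>] by auto
    show "\<forall>A\<in>orbit r ` X. \<forall>B\<in>orbit r ` X. A \<noteq> B \<longrightarrow> A \<inter> B = {}"
    proof (intro ballI impI)
      fix A B assume "A \<in> orbit r ` X" "B \<in> orbit r ` X" "A \<noteq> B"
      then obtain x y where xy: "x \<in> X" "y \<in> X" "A = orbit r x" "B = orbit r y" by auto
      have False if "z \<in> A" "z \<in> B" for z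
        using orbit_eq_iff[OF self[OF xy(1)], of z] orbit_eq_iff[OF self[OF xy(2)], of z]
          that xy \<open>A \<noteq> B\<close> by simp
      then show "A \<inter> B = {}" by blast
    qed
  qed simp
  then have "(\<Sum>x\<in>X. F x) = (\<Sum>A\<in>orbit r ` X. \<Sum>x\<in>A. F x)"
    by (simp only: X[symmetric])
  also have "int p ^ (c + 1) dvd \<dots>"
  proof (rule dvd_sum)
    fix A assume "A \<in> orbit r ` X"
    then obtain x where x: "x \<in> X" "A = orbit r x" by auto
    then have "(\<Sum>y\<in>A. F y) = int (card (orbit r x)) * F x" using Fo by simp
    moreover have "int p ^ (c + 1) dvd int (card (orbit r x))"
      using card[OF x(1)] by (metis of_nat_dvd_iff of_nat_power)
    ultimately show "int p ^ (c + 1) dvd (\<Sum>y\<in>A. F y)" by simp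
  qed
  finally show ?thesis .
qed

lemma commute_imp_replicate:
  assumes "u @ v = v @ u" "length v = k * length u"
  shows "v = concat (replicate k u)"
  using assms
proof (induction k arbitrary: v)
  case (Suc k)
  have "take (length u) (v @ u) = u" using Suc.prems(1)[symmetric] by simp
  moreover have "length u \<le> length v" using Suc.prems(2) by simp
  ultimately have "take (length u) v = u" by simp
  then obtain v' where v': "v = u @ v'" by (metis append_take_drop_id)
  have "v' = concat (replicate k u)" using Suc.prems v' by (intro Suc.IH) auto
  then show ?case using v' by simp
qed simp

text \<open>A word that is fixed by a rotation through \<open>m\<close> places is the concatenation of copies of its first
  \<open>m\<close> letters. This makes the product of such a word a power.\<close>

lemma rotate_eq_self_imp_replicate:
  assumes "rotate m w = w" "length w = k * m" "0 < k" "0 < m"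
  shows "w = concat (replicate k (take m w))"
proof -
  obtain j where k: "k = Suc j" using assms(3) gr0_implies_Suc by blast
  let ?u = "take m w" and ?v = "drop m w"
  have len: "m \<le> length w" using assms k by simp
  have lu: "length ?u = m" using len by simp
  have w: "w = ?u @ ?v" by simp
  have "rotate m w = ?v @ ?u"
    using rotate_append[of ?u ?v] lu w by simp
  then have "?u @ ?v = ?v @ ?u" using assms(1) by simp
  then have "?v = concat (replicate j ?u)"
    using assms(2) len k by (intro commute_imp_replicate) auto
  then show ?thesis using k w by (metis concat.simps(2) replicate_Suc)
qed

context group
begin

definition word_prod :: "'a list \<Rightarrow> 'a" where
  "word_prod w = foldr (\<otimes>) w \<one>"

definition words :: "nat \<Rightarrow> 'a list set" where
  "words N = {w. set w \<subseteq> carrier G \<and> length w = N}"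

lemma word_prod_simps [simp]:
  "word_prod [] = \<one>" "word_prod (x # w) = x \<otimes> word_prod w"
  by (simp_all add: word_prod_def)

lemma word_prod_closed [simp]: "set w \<subseteq> carrier G \<Longrightarrow> word_prod w \<in> carrier G"
  by (induction w) auto

lemma word_prod_append:
  "set v \<subseteq> carrier G \<Longrightarrow> set w \<subseteq> carrier G \<Longrightarrow> word_prod (v @ w) = word_prod v \<otimes> word_prod w"
  by (induction v) (auto simp: m_assoc)

lemma word_prod_replicate:
  assumes "set u \<subseteq> carrier G"
  shows "word_prod (concat (replicate k u)) = word_prod u [^] k"
proof (induction k)
  case (Suc k)
  have "set (concat (replicate k u)) \<subseteq> carrier G" using assms by (auto simp: set_replicate_conv_if)
  then have "word_prod (concat (replicate (Suc k) u)) = word_prod u \<otimes> word_prod u [^] k"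
    using Suc assms by (simp add: word_prod_append)
  also have "\<dots> = word_prod u [^] Suc k" using assms nat_pow_Suc2[of "word_prod u" k] by simp
  finally show ?case .
qed simp

lemma finite_words: "finite (carrier G) \<Longrightarrow> finite (words N)"
  unfolding words_def by (rule finite_lists_length_eq)

text \<open>The value at \<open>g\<close> of the \<open>(N + 1)\<close>-fold convolution power, expanded into words.\<close>

lemma word_sum:
  fixes \<chi> :: "'a \<Rightarrow> complex"
  assumes fin: "finite (carrier G)"
    and conv: "\<And>g. g \<in> carrier G \<Longrightarrow> (\<Sum>h\<in>carrier G. \<chi> h * \<chi> (inv h \<otimes> g)) = c * \<chi> g"
    and g: "g \<in> carrier G"
  shows "(\<Sum>w | w \<in> words (Suc N) \<and> word_prod w = g. \<Prod>x\<leftarrow>w. \<chi> x) = c ^ N * \<chi> g"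
  using g
proof (induction N arbitrary: g)
  case 0
  have "{w. w \<in> words (Suc 0) \<and> word_prod w = g} = {[g]}"
    using 0 by (auto simp: words_def length_Suc_conv)
  then show ?case by simp
next
  case (Suc N)
  let ?A = "\<lambda>N g. {w. w \<in> words N \<and> word_prod w = g}"
  have "(\<Sum>w\<in>?A (Suc (Suc N)) g. \<Prod>x\<leftarrow>w. \<chi> x)
      = (\<Sum>(h, v)\<in>Sigma (carrier G) (\<lambda>h. ?A (Suc N) (inv h \<otimes> g)). \<chi> h * (\<Prod>x\<leftarrow>v. \<chi> x))"
  proof (rule sum.reindex_bij_witness[of _ "\<lambda>(h, v). h # v" "\<lambda>w. (hd w, tl w)"])
    fix w assume "w \<in> ?A (Suc (Suc N)) g"
    then obtain h v where w: "w = h # v" "set v \<subseteq> carrier G" "h \<in> carrier G" "length v = Suc N"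
      "h \<otimes> word_prod v = g"
      by (auto simp: words_def length_Suc_conv)
    then show "(case (hd w, tl w) of (h, v) \<Rightarrow> h # v) = w" by simp
    have "inv h \<otimes> g = word_prod v" using w inv_solve_left by (metis Suc.prems word_prod_closed)
    then show "(hd w, tl w) \<in> Sigma (carrier G) (\<lambda>h. ?A (Suc N) (inv h \<otimes> g))"
      using w by (auto simp: words_def)
    show "(case (hd w, tl w) of (h, v) \<Rightarrow> \<chi> h * (\<Prod>x\<leftarrow>v. \<chi> x)) = (\<Prod>x\<leftarrow>w. \<chi> x)"
      using w by simp
  next
    fix b assume b: "b \<in> Sigma (carrier G) (\<lambda>h. ?A (Suc N) (inv h \<otimes> g))"
    obtain h v where hv: "b = (h, v)" by (cases b)
    have h: "h \<in> carrier G" "set v \<subseteq> carrier G" "length v = Suc N" "word_prod v = inv h \<otimes> g"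
      using b hv by (auto simp: words_def)
    show "(hd (case b of (h, v) \<Rightarrow> h # v), tl (case b of (h, v) \<Rightarrow> h # v)) = b" using hv by simp
    have "h \<otimes> (inv h \<otimes> g) = g" using h Suc.prems by (simp add: m_assoc[symmetric])
    then show "(case b of (h, v) \<Rightarrow> h # v) \<in> ?A (Suc (Suc N)) g"
      using h hv by (auto simp: words_def)
  qed
  also have "\<dots> = (\<Sum>h\<in>carrier G. \<chi> h * (\<Sum>v\<in>?A (Suc N) (inv h \<otimes> g). \<Prod>x\<leftarrow>v. \<chi> x))"
    using fin finite_words[OF fin] by (subst sum.Sigma[symmetric]) (auto simp: sum_distrib_left)
  also have "\<dots> = (\<Sum>h\<in>carrier G. \<chi> h * (c ^ N * \<chi> (inv h \<otimes> g)))"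
    using Suc by (intro sum.cong refl) auto
  also have "\<dots> = c ^ N * (\<Sum>h\<in>carrier G. \<chi> h * \<chi> (inv h \<otimes> g))"
    by (simp add: sum_distrib_left mult_ac)
  also have "\<dots> = c ^ Suc N * \<chi> g" using conv[OF Suc.prems] by simp
  finally show ?case .
qed

text \<open>The sum of \<open>z\<close> over the conjugacy class \<open>K\<close> of \<open>g\<close> is compared with a sum over words whose
  length \<open>N\<close> is a power of \<open>p\<close> and whose product lies in \<open>K\<close>. Rotating a word conjugates its
  product, so the words are permuted. A rotation through \<open>p ^ c\<close> places cannot fix a word of length
  \<open>p ^ (a + c)\<close>, since its product would be a \<open>p ^ a\<close>-th power. Hence \<open>p ^ (c + 1)\<close> divides the sum
  over words. Here \<open>a\<close> is fixed and \<open>c\<close> is arbitrary, so the sum over the class is zero. The hypothesis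
  on \<open>q\<close> makes the scalar \<open>q / e\<close> harmless: the powers of \<open>e\<close> appear on the side that is divisible
  anyway.\<close>

theorem vanishes_off_prime_powers:
  fixes z :: "'a \<Rightarrow> int"
  assumes fin: "finite (carrier G)" and p: "prime p"
    and cls: "\<And>g h. g \<in> carrier G \<Longrightarrow> h \<in> carrier G \<Longrightarrow> z (g \<otimes> h) = z (h \<otimes> g)"
    and conv: "\<And>g. g \<in> carrier G \<Longrightarrow>
        int e * (\<Sum>h\<in>carrier G. z h * z (inv h \<otimes> g)) = int q * z g"
    and eq: "\<not> p dvd q" "0 < e"
    and g: "g \<in> carrier G" and nopow: "\<And>x. x \<in> carrier G \<Longrightarrow> x [^] (p ^ a) \<noteq> g"
  shows "z g = 0"
proof -
  define K where "K = (\<lambda>k. k \<otimes> g \<otimes> inv k) ` carrier G"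
  have finK: "finite K" and gK: "g \<in> K" and KG: "K \<subseteq> carrier G"
    using fin g by (auto simp: K_def intro!: image_eqI[of _ _ \<one>])
  have conjK: "h \<otimes> x \<otimes> inv h \<in> K" if hx: "h \<in> carrier G" "x \<in> K" for h x
  proof -
    obtain k where k: "k \<in> carrier G" "x = k \<otimes> g \<otimes> inv k" using hx by (auto simp: K_def)
    then have "h \<otimes> x \<otimes> inv h = (h \<otimes> k) \<otimes> g \<otimes> inv (h \<otimes> k)"
      using hx g by (simp add: m_assoc inv_mult_group)
    then show ?thesis using k hx by (auto simp: K_def)
  qed
  have zK: "z x = z g" if xK: "x \<in> K" for x
  proof -
    obtain k where k: "k \<in> carrier G" "x = k \<otimes> g \<otimes> inv k" using xK by (auto simp: K_def)
    have "z (k \<otimes> (g \<otimes> inv k)) = z (g \<otimes> inv k \<otimes> k)" using cls k g by auto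
    then show ?thesis using k g by (simp add: m_assoc)
  qed
  have nopowK: "x [^] (p ^ a) \<notin> K" if x: "x \<in> carrier G" for x
  proof
    assume "x [^] (p ^ a) \<in> K"
    then obtain k where k: "k \<in> carrier G" "x [^] (p ^ a) = k \<otimes> g \<otimes> inv k" by (auto simp: K_def)
    have pw: "(inv k \<otimes> x \<otimes> k) [^] m = inv k \<otimes> x [^] m \<otimes> k" for m :: nat
    proof (induction m)
      case (Suc m)
      have "(inv k \<otimes> x [^] m \<otimes> k) \<otimes> (inv k \<otimes> x \<otimes> k) = inv k \<otimes> x [^] m \<otimes> (k \<otimes> inv k) \<otimes> x \<otimes> k"
        using k x by (simp only: m_assoc m_closed inv_closed nat_pow_closed)
      then show ?case using Suc k x by (simp add: m_assoc)
    qed (use k in simp)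
    have "(inv k \<otimes> x \<otimes> k) [^] (p ^ a) = (inv k \<otimes> k) \<otimes> g \<otimes> (inv k \<otimes> k)"
      unfolding pw k(2) using k g by (simp only: m_assoc m_closed inv_closed)
    then have "(inv k \<otimes> x \<otimes> k) [^] (p ^ a) = g" using k g by simp
    then show False using nopow[of "inv k \<otimes> x \<otimes> k"] k x by simp
  qed
  have "int p ^ (c + 1) dvd int (card K) * z g" for c
  proof -
    \<comment> \<open>Long enough for the period \<open>p ^ c\<close> to leave \<open>p ^ a\<close> repetitions.\<close>
    define N where "N = p ^ (a + c)"
    have N: "0 < N" using p by (simp add: N_def prime_gt_0_nat)
    then obtain N' where N': "N = Suc N'" using gr0_implies_Suc by blast
    define X where "X = {w \<in> words N. word_prod w \<in> K}"
    define F where "F w = (\<Prod>x\<leftarrow>w. z x)" for w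
    have rotp: "word_prod (rotate1 w) \<in> K" if "set w \<subseteq> carrier G" "word_prod w \<in> K" for w
    proof (cases w)
      case (Cons h v)
      have "inv h \<otimes> (h \<otimes> word_prod v) \<otimes> inv (inv h) \<in> K"
        using that Cons conjK[of "inv h" "h \<otimes> word_prod v"] by auto
      then show ?thesis using that Cons by (simp add: word_prod_append m_assoc[symmetric])
    qed (use that in simp)
    have "int p ^ (c + 1) dvd (\<Sum>w\<in>X. F w)"
    proof (rule prime_power_dvd_sum_free_action[where r = rotate1 and n = "a + c"])
      show "finite X" using finite_words[OF fin] by (simp add: X_def)
      fix w assume "w \<in> X"
      then have w: "set w \<subseteq> carrier G" "length w = N" "word_prod w \<in> K"
        by (auto simp: X_def words_def)
      show "rotate1 w \<in> X" using rotp w by (simp add: X_def words_def)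
      show "F (rotate1 w) = F w" unfolding F_def by (cases w) (auto simp: mult.commute)
      have rot: "(rotate1 ^^ m) w = rotate m w" for m by (simp add: rotate_def)
      show "(rotate1 ^^ (p ^ (a + c))) w = w"
        using w by (simp add: rot N_def rotate_length01 rotate_conv_mod[of _ w])
      show "(rotate1 ^^ (p ^ c)) w \<noteq> w"
      proof
        assume "(rotate1 ^^ (p ^ c)) w = w"
        then have "w = concat (replicate (p ^ a) (take (p ^ c) w))"
          using w p by (intro rotate_eq_self_imp_replicate) (simp_all add: rot N_def power_add prime_gt_0_nat)
        moreover have "set (take (p ^ c) w) \<subseteq> carrier G" using w by (meson set_take_subset subset_trans)
        ultimately have "word_prod w = word_prod (take (p ^ c) w) [^] (p ^ a)"
          using word_prod_replicate by metis
        then show False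
          using nopowK[of "word_prod (take (p ^ c) w)"] w \<open>set (take (p ^ c) w) \<subseteq> carrier G\<close> by auto
      qed
    qed (use p in auto)
    moreover have "int e ^ N' * (\<Sum>w\<in>X. F w) = int q ^ N' * (int (card K) * z g)"
    proof -
      define \<chi> :: "'a \<Rightarrow> complex" where "\<chi> x = of_int (z x)" for x
      have cv: "(\<Sum>h\<in>carrier G. \<chi> h * \<chi> (inv h \<otimes> x)) = (of_nat q / of_nat e) * \<chi> x"
        if "x \<in> carrier G" for x
      proof -
        have "of_nat e * (\<Sum>h\<in>carrier G. \<chi> h * \<chi> (inv h \<otimes> x))
          = of_int (int e * (\<Sum>h\<in>carrier G. z h * z (inv h \<otimes> x)))"
          by (simp add: \<chi>_def)
        also have "\<dots> = of_nat q * \<chi> x" unfolding conv[OF that] by (simp add: \<chi>_def)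
        finally show ?thesis using eq by (simp add: field_simps)
      qed
      have FX: "of_int (F w) = (\<Prod>x\<leftarrow>w. \<chi> x)" for w
        unfolding F_def \<chi>_def by (induction w) auto
      have "X = (\<Union>k\<in>K. {w. w \<in> words N \<and> word_prod w = k})" by (auto simp: X_def)
      then have "(\<Sum>w\<in>X. of_int (F w)) = (\<Sum>k\<in>K. \<Sum>w | w \<in> words N \<and> word_prod w = k. \<Prod>x\<leftarrow>w. \<chi> x)"
        using finK finite_words[OF fin]
        by (simp add: FX) (subst sum.UNION_disjoint, auto)
      also have "\<dots> = (\<Sum>k\<in>K. (of_nat q / of_nat e) ^ N' * \<chi> g)"
        unfolding N' using KG zK
        by (intro sum.cong refl, subst word_sum[OF fin cv]) (auto simp: \<chi>_def)
      also have "\<dots> = of_nat (card K) * ((of_nat q / of_nat e) ^ N' * \<chi> g)" by simp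
      finally have "of_nat e ^ N' * (\<Sum>w\<in>X. of_int (F w)) = of_nat q ^ N' * (of_nat (card K) * \<chi> g)"
        using eq by (simp add: power_divide field_simps)
      then have "(of_int (int e ^ N' * (\<Sum>w\<in>X. F w)) :: complex) = of_int (int q ^ N' * (int (card K) * z g))"
        by (simp add: \<chi>_def)
      then show ?thesis by (simp only: of_int_eq_iff)
    qed
    ultimately have "int p ^ (c + 1) dvd int q ^ N' * (int (card K) * z g)"
      by (metis dvd_mult)
    moreover have "coprime (int p ^ (c + 1)) (int q ^ N')"
      using eq p by (simp add: coprime_power_left_iff coprime_power_right_iff prime_imp_coprime_nat)
    ultimately show ?thesis by (simp add: coprime_dvd_mult_right_iff)
  qed
  note dvd = this
  have "int (card K) * z g = 0"
  proof (rule ccontr)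
    assume nz: "int (card K) * z g \<noteq> 0"
    define y where "y = nat \<bar>int (card K) * z g\<bar>"
    have "int p ^ (y + 1) \<le> \<bar>int (card K) * z g\<bar>"
      using dvd[of y] nz by (metis abs_of_nonneg dvd_imp_le_int of_nat_0_le_iff zero_le_power)
    moreover have "y < p ^ (y + 1)"
      using p by (metis Suc_eq_plus1 Suc_lessD less_exp power_gt_expt prime_ge_2_nat Suc_le_eq numeral_2_eq_2)
    ultimately show False by (simp add: y_def) (metis nat_less_iff abs_ge_zero not_le of_nat_power of_nat_mult of_nat_power power_Suc linorder_not_less nat_less_iff)
  qed
  moreover have "card K \<noteq> 0" using finK gK by auto
  ultimately show ?thesis by simp
qed

end

section \<open>Rationality of characters\<close>

text \<open>The sum of all \<open>\<zeta> ^ j\<close> with \<open>0 < j \<le> N\<close> is \<open>0\<close> or \<open>N\<close>. Sorting the exponents by their greatest common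
  divisor \<open>d\<close> with \<open>N\<close> splits it into Ramanujan sums for \<open>\<zeta> ^ d\<close> and \<open>N div d\<close>, so the one with \<open>d = 1\<close>
  is an integer by induction.\<close>

lemma Ramanujan_sum_int:
  fixes \<zeta> :: complex
  assumes "0 < N" "\<zeta> ^ N = 1"
  shows "(\<Sum>j\<in>totatives N. \<zeta> ^ j) \<in> \<int>"
  using assms
proof (induction N arbitrary: \<zeta> rule: less_induct)
  case (less N)
  have full: "(\<Sum>j\<in>{0<..N}. \<zeta> ^ j) \<in> \<int>"
  proof (cases "\<zeta> = 1")
    case False
    have "(\<Sum>j\<in>{0<..N}. \<zeta> ^ j) = (\<Sum>j<N. \<zeta> ^ Suc j)"
      by (rule sum.reindex_bij_witness[of _ Suc "\<lambda>j. j - 1"]) auto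
    also have "\<dots> = \<zeta> * (\<Sum>j<N. \<zeta> ^ j)" by (simp add: sum_distrib_left)
    also have "(\<Sum>j<N. \<zeta> ^ j) = 0"
      using geometric_sum[OF False, of N] less.prems by simp
    finally show ?thesis by simp
  qed simp
  have part: "(\<Sum>j\<in>{0<..N}. \<zeta> ^ j) = (\<Sum>d | d dvd N. \<Sum>j | j \<in> {0<..N} \<and> gcd j N = d. \<zeta> ^ j)"
    using less.prems by (subst sum.group[where g = "\<lambda>j. gcd j N", symmetric, of _ "{d. d dvd N}"]) auto
  have gcd_part: "(\<Sum>j | j \<in> {0<..N} \<and> gcd j N = d. \<zeta> ^ j) = (\<Sum>j\<in>totatives (N div d). (\<zeta> ^ d) ^ j)"
    if d: "d dvd N" for d
  proof -
    have d0: "0 < d" using d less.prems by (auto intro: dvd_pos_nat)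
    obtain e where e: "N = d * e" using d by auto
    show ?thesis
    proof (rule sum.reindex_bij_witness[of _ "\<lambda>j. d * j" "\<lambda>j. j div d"])
      fix j assume "j \<in> {j. j \<in> {0<..N} \<and> gcd j N = d}"
      then have j: "0 < j" "j \<le> N" "gcd j N = d" by auto
      then obtain k where k: "j = d * k" by (metis dvdE gcd_dvd1)
      have "coprime k e" using j k e d0 by (simp add: gcd_mult_distrib_nat[symmetric] coprime_iff_gcd_eq_1)
      then show "j div d \<in> totatives (N div d)" using j k e d0 by (simp add: totatives_def)
      show "d * (j div d) = j" using k d0 by simp
      show "(\<zeta> ^ d) ^ (j div d) = \<zeta> ^ j" using k d0 by (simp add: power_mult)
    next
      fix j assume "j \<in> totatives (N div d)"
      then have "0 < j" "j \<le> e" "coprime j e" using e d0 by (auto simp: totatives_def)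
      then show "d * j \<in> {j. j \<in> {0<..N} \<and> gcd j N = d}"
        using e d0 by (simp add: gcd_mult_distrib_nat[symmetric] coprime_iff_gcd_eq_1)
      show "d * j div d = j" using d0 by simp
    qed
  qed
  have fin: "finite {d. d dvd N}" using less.prems by simp
  have "(\<Sum>j\<in>{0<..N}. \<zeta> ^ j) = (\<Sum>d | d dvd N. \<Sum>j\<in>totatives (N div d). (\<zeta> ^ d) ^ j)"
    unfolding part by (rule sum.cong[OF refl], rule gcd_part) simp
  also have "\<dots> = (\<Sum>j\<in>totatives N. \<zeta> ^ j)
      + (\<Sum>d\<in>{d. d dvd N} - {1}. \<Sum>j\<in>totatives (N div d). (\<zeta> ^ d) ^ j)"
    using fin by (subst sum.remove[of _ 1]) auto
  finally have "(\<Sum>j\<in>totatives N. \<zeta> ^ j) = (\<Sum>j\<in>{0<..N}. \<zeta> ^ j)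
      - (\<Sum>d\<in>{d. d dvd N} - {1}. \<Sum>j\<in>totatives (N div d). (\<zeta> ^ d) ^ j)" by simp
  moreover have "(\<Sum>d\<in>{d. d dvd N} - {1}. \<Sum>j\<in>totatives (N div d). (\<zeta> ^ d) ^ j) \<in> \<int>"
  proof (rule Ints_sum)
    fix d assume "d \<in> {d. d dvd N} - {1}"
    then have d: "d dvd N" "d \<noteq> 1" by auto
    have d0: "0 < d" using d less.prems by (auto intro: dvd_pos_nat)
    have "N div d < N" using d d0 less.prems by (intro div_less_dividend) auto
    moreover have "0 < N div d" using d less.prems by (intro gr0I) (simp add: dvd_div_eq_0_iff)
    moreover have "(\<zeta> ^ d) ^ (N div d) = 1" using d less.prems by (simp add: power_mult[symmetric])
    ultimately show "(\<Sum>j\<in>totatives (N div d). (\<zeta> ^ d) ^ j) \<in> \<int>" by (rule less.IH)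
  qed
  ultimately show ?case using full by simp
qed

text \<open>All products of \<open>r\<close> factors from \<open>L\<close>, that is, the terms in the expansion of the \<open>r\<close>-th power of
  \<open>sum_list L\<close>. For the eigenvalues of a matrix these are the eigenvalues of its \<open>r\<close>-th tensor power.\<close>

fun products :: "'a::comm_monoid_mult list \<Rightarrow> nat \<Rightarrow> 'a list" where
  "products L 0 = [1]"
| "products L (Suc r) = concat (map (\<lambda>x. map ((*) x) (products L r)) L)"

lemma sum_list_products_power:
  fixes L :: "'a::comm_semiring_1 list"
  shows "(\<Sum>x\<leftarrow>L. x ^ j) ^ r = (\<Sum>y\<leftarrow>products L r. y ^ j)"
proof (induction r)
  case (Suc r)
  have *: "(\<Sum>y\<leftarrow>concat (map (\<lambda>x. map ((*) x) P) K). y ^ j) = (\<Sum>x\<leftarrow>K. x ^ j) * (\<Sum>y\<leftarrow>P. y ^ j)"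
    for P K :: "'a list"
    by (induction K) (simp_all add: distrib_right power_mult_distrib comp_def sum_list_const_mult)
  show ?case using Suc by (simp add: *)
qed simp

lemma set_products_root:
  assumes "\<And>x. x \<in> set L \<Longrightarrow> x ^ N = 1" "y \<in> set (products L r)"
  shows "y ^ N = 1"
  using assms(2) by (induction r arbitrary: y) (auto simp: power_mult_distrib assms(1))

text \<open>If \<open>b\<close> is the denominator of \<open>x\<close> in lowest terms, then \<open>b ^ r\<close> divides \<open>F\<close> for every \<open>r\<close>, which forces
  \<open>b = 1\<close>.\<close>

lemma rat_int_if_powers_int:
  fixes x :: complex
  assumes x: "x \<in> \<rat>" and F: "0 < F" and pow: "\<And>r. of_nat F * x ^ r \<in> \<int>"
  shows "x \<in> \<int>"
proof -
  obtain a b where ab: "0 < b" "coprime a b" "x = of_int a / of_int b"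
    using x by (rule Rats_cases')
  have dvd: "b ^ r dvd int F" for r
  proof -
    obtain z where z: "of_nat F * x ^ r = of_int z" using pow[of r] by (elim Ints_cases)
    have "(of_int (int F * a ^ r) :: complex) = of_int (z * b ^ r)"
      using z ab by (simp add: power_divide field_simps)
    then have "int F * a ^ r = z * b ^ r" by (simp only: of_int_eq_iff)
    then have "b ^ r dvd int F * a ^ r" by simp
    then show ?thesis using ab(2)
      by (simp add: coprime_dvd_mult_left_iff coprime_power_left_iff coprime_power_right_iff coprime_commute)
  qed
  have "b ^ F \<le> int F" using dvd[of F] F by (intro zdvd_imp_le) auto
  have "b = 1"
  proof (rule ccontr)
    assume "b \<noteq> 1"
    then have "(2::int) ^ F \<le> b ^ F" using ab(1) by (intro power_mono) auto
    moreover have "int F < 2 ^ F" using of_nat_less_iff[of F "2 ^ F", where ?'a = int] less_exp[of F] by simp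
    ultimately show False using \<open>b ^ F \<le> int F\<close> by linarith
  qed
  then show ?thesis using ab by simp
qed

text \<open>Let \<open>s\<close> be the sum of \<open>L\<close>. By invariance \<open>totient N * s ^ r\<close> is the sum of the \<open>r\<close>-th powers of
  all the conjugate power sums, and expanding these powers yields a sum of Ramanujan sums. So all powers of \<open>s\<close>
  have the common denominator \<open>totient N\<close>.\<close>

lemma power_sums_of_roots_int:
  fixes L :: "complex list"
  assumes N: "0 < N" and root: "\<And>x. x \<in> set L \<Longrightarrow> x ^ N = 1"
    and inv: "\<And>j. j \<in> totatives N \<Longrightarrow> (\<Sum>x\<leftarrow>L. x ^ j) = (\<Sum>x\<leftarrow>L. x)"
  shows "(\<Sum>x\<leftarrow>L. x) \<in> \<int>"
proof -
  let ?s = "\<Sum>x\<leftarrow>L. x"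
  have "of_nat (totient N) * ?s ^ r \<in> \<int>" for r
  proof -
    have "of_nat (totient N) * ?s ^ r = (\<Sum>j\<in>totatives N. (\<Sum>x\<leftarrow>L. x ^ j) ^ r)"
      using inv by (simp add: totient_def)
    also have "\<dots> = (\<Sum>j\<in>totatives N. \<Sum>y\<leftarrow>products L r. y ^ j)"
      by (simp add: sum_list_products_power)
    also have "\<dots> = (\<Sum>y\<leftarrow>products L r. \<Sum>j\<in>totatives N. y ^ j)"
    proof -
      have "(\<Sum>j\<in>totatives N. \<Sum>y\<leftarrow>P. y ^ j) = (\<Sum>y\<leftarrow>P. \<Sum>j\<in>totatives N. y ^ j)" for P :: "complex list"
        by (induction P) (simp_all add: sum.distrib)
      then show ?thesis .
    qed
    also have "\<dots> \<in> \<int>"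
    proof -
      have "(\<Sum>y\<leftarrow>P. \<Sum>j\<in>totatives N. y ^ j) \<in> \<int>" if "\<And>y. y \<in> set P \<Longrightarrow> y ^ N = 1" for P :: "complex list"
        using that by (induction P) (auto intro!: Ints_add Ramanujan_sum_int[OF N])
      then show ?thesis using set_products_root[OF root] by blast
    qed
    finally show ?thesis .
  qed
  note pow = this
  have t: "0 < totient N" using N by simp
  obtain z where z: "of_nat (totient N) * ?s = of_int z" using pow[of 1] by (auto elim: Ints_cases)
  then have "?s = of_int z / of_nat (totient N)" using t by (simp add: field_simps)
  then have "?s \<in> \<rat>" by simp
  then show ?thesis using t pow by (rule rat_int_if_powers_int)
qed

lemma mat_trace_mult_comm:
  fixes A B :: "'a::comm_semiring_0 mat"
  assumes "A \<in> carrier_mat d d" "B \<in> carrier_mat d d"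
  shows "mat_trace (A * B) = mat_trace (B * A)"
  using assms by (simp add: mat_trace_def scalar_prod_def atLeast0LessThan)
    (subst sum.swap, simp add: mult.commute)

lemma upper_triangular_pow:
  fixes B :: "'a::comm_semiring_1 mat"
  assumes B: "B \<in> carrier_mat d d" "upper_triangular B"
  shows "upper_triangular (B ^\<^sub>m j) \<and> (\<forall>i<d. (B ^\<^sub>m j) $$ (i, i) = (B $$ (i, i)) ^ j)"
proof (induction j)
  case 0
  then show ?case using B by auto
next
  case (Suc j)
  let ?C = "B ^\<^sub>m j"
  have C: "?C \<in> carrier_mat d d" using B(1) by (rule pow_carrier_mat)
  have ent: "(?C * B) $$ (i, k) = (\<Sum>l<d. ?C $$ (i, l) * B $$ (l, k))" if "i < d" "k < d" for i k
    using that B C by (simp add: scalar_prod_def atLeast0LessThan)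
  have z: "?C $$ (i, l) * B $$ (l, k) = 0" if "i < d" "l < d" "k < d" "k < l \<or> l < i" for i k l
    using that upper_triangularD[OF B(2), of k l] upper_triangularD[of ?C l i] Suc B C by auto
  have "(?C * B) $$ (i, i) = B $$ (i, i) ^ Suc j" if i: "i < d" for i
  proof -
    have "(?C * B) $$ (i, i) = (\<Sum>l<d. if l = i then ?C $$ (i, i) * B $$ (i, i) else 0)"
      unfolding ent[OF i i] using i z by (intro sum.cong refl) (auto simp: nat_neq_iff)
    then show ?thesis using i Suc by (simp add: mult.commute)
  qed
  moreover have "upper_triangular (?C * B)"
  proof (rule upper_triangularI)
    fix i k assume "k < i" "i < dim_row (?C * B)"
    then have ik: "i < d" "k < d" "k < i" using C by auto
    show "(?C * B) $$ (i, k) = 0"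
      unfolding ent[OF ik(1,2)] using z[of i _ k] ik by (intro sum.neutral ballI) (metis lessThan_iff linorder_neqE_nat order.strict_trans)
  qed
  ultimately show ?case by simp
qed

text \<open>The list consists of the diagonal entries of a triangular form of \<open>A\<close>.\<close>

lemma trace_powers:
  fixes A :: "complex mat"
  assumes A: "A \<in> carrier_mat d d"
  obtains L where "\<And>j. mat_trace (A ^\<^sub>m j) = (\<Sum>x\<leftarrow>L. x ^ j)"
    and "\<And>N x. A ^\<^sub>m N = 1\<^sub>m d \<Longrightarrow> x \<in> set L \<Longrightarrow> x ^ N = 1"
proof -
  obtain es where es: "char_poly A = (\<Prod>a\<leftarrow>es. [:- a, 1:])" using char_poly_factorized[OF A] by blast
  obtain B P Q where BPQ: "schur_decomposition A es = (B, P, Q)" by (cases "schur_decomposition A es")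
  have sim: "similar_mat_wit A B P Q" and ut: "upper_triangular B"
    using schur_decomposition[OF A es BPQ] by auto
  note w = similar_mat_witD2[OF A sim]
  have B: "B \<in> carrier_mat d d" and P: "P \<in> carrier_mat d d" and Q: "Q \<in> carrier_mat d d"
    and QP: "Q * P = 1\<^sub>m d" using w by auto
  have Bj: "B ^\<^sub>m j \<in> carrier_mat d d" for j using B by (rule pow_carrier_mat)
  have pw: "A ^\<^sub>m j = P * B ^\<^sub>m j * Q" for j using sim by (rule similar_mat_wit_pow_id)
  have diag: "(B ^\<^sub>m j) $$ (i, i) = (B $$ (i, i)) ^ j" if "i < d" for i j
    using upper_triangular_pow[OF B ut] that by blast
  define L where "L = map (\<lambda>i. B $$ (i, i)) [0..<d]"
  show ?thesis
  proof (rule that[of L])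
    fix j
    have "mat_trace (A ^\<^sub>m j) = mat_trace (Q * (P * B ^\<^sub>m j))"
      unfolding pw using Q P Bj by (intro mat_trace_mult_comm[where d = d]) auto
    also have "Q * (P * B ^\<^sub>m j) = (Q * P) * B ^\<^sub>m j" using Q P Bj[of j] by (simp add: assoc_mult_mat)
    also have "\<dots> = B ^\<^sub>m j" unfolding QP using Bj[of j] by (rule left_mult_one_mat)
    also have "mat_trace (B ^\<^sub>m j) = (\<Sum>i<d. (B $$ (i, i)) ^ j)"
      using Bj[of j] B diag by (simp add: mat_trace_def)
    also have "\<dots> = (\<Sum>x\<leftarrow>L. x ^ j)"
      by (simp add: L_def comp_def interv_sum_list_conv_sum_set_nat atLeast0LessThan)
    finally show "mat_trace (A ^\<^sub>m j) = (\<Sum>x\<leftarrow>L. x ^ j)" .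
  next
    fix N x assume AN: "A ^\<^sub>m N = 1\<^sub>m d" and x: "x \<in> set L"
    have "Q * (P * B ^\<^sub>m N * Q) * P = (Q * P) * B ^\<^sub>m N * (Q * P)"
      using Q P Bj[of N] by (simp add: assoc_mult_mat[of _ d d _ d _ d])
    also have "\<dots> = B ^\<^sub>m N"
      unfolding QP using left_mult_one_mat[OF Bj[of N]] right_mult_one_mat[OF Bj[of N]] by simp
    finally have "B ^\<^sub>m N = Q * 1\<^sub>m d * P" using AN pw[of N] by simp
    then have "B ^\<^sub>m N = 1\<^sub>m d" using QP Q by simp
    then show "x ^ N = 1" using x diag[of _ N] by (auto simp: L_def)
  qed
qed

lemma representation_pow:
  assumes rep: "representation G d \<rho>" and G: "group G" and g: "g \<in> carrier G"
  shows "\<rho> (g [^]\<^bsub>G\<^esub> (j::nat)) = \<rho> g ^\<^sub>m j"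
proof -
  interpret G: group G by (rule G)
  note r = representationD[OF rep G]
  show ?thesis using g r(1)[OF g] by (induction j) (simp_all add: r(2,3))
qed

text \<open>In the symmetric group the hypothesis on coprime powers holds for every element, because such
  powers are conjugate to the element.\<close>

theorem character_int_if_conjugate_powers:
  assumes rep: "representation G d \<rho>" and G: "group G" and g: "g \<in> carrier G"
    and N: "0 < N" "g [^]\<^bsub>G\<^esub> N = \<one>\<^bsub>G\<^esub>"
    and conj: "\<And>j. j \<in> totatives N \<Longrightarrow> mat_trace (\<rho> (g [^]\<^bsub>G\<^esub> j)) = mat_trace (\<rho> g)"
  shows "mat_trace (\<rho> g) \<in> \<int>"
proof -
  note r = representationD[OF rep G] and p = representation_pow[OF rep G g]
  obtain L where L: "\<And>j. mat_trace (\<rho> g ^\<^sub>m j) = (\<Sum>x\<leftarrow>L. x ^ j)"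
    and root: "\<And>N x. \<rho> g ^\<^sub>m N = 1\<^sub>m d \<Longrightarrow> x \<in> set L \<Longrightarrow> x ^ N = 1"
    using trace_powers[OF r(1)[OF g]] by metis
  have t1: "mat_trace (\<rho> g) = (\<Sum>x\<leftarrow>L. x)" using L[of 1] r(1)[OF g] by simp
  have "\<rho> g ^\<^sub>m N = 1\<^sub>m d" using p[of N] N r(3) by simp
  then have "(\<Sum>x\<leftarrow>L. x) \<in> \<int>"
    using N(1) root conj L p t1 by (intro power_sums_of_roots_int[of N]) auto
  then show ?thesis using t1 by simp
qed

section \<open>Cycle types\<close>

lemma image_mset_eq_imp_bij_betw:
  assumes "finite A" "finite B" "image_mset f (mset_set A) = image_mset g (mset_set B)"
  shows "\<exists>b. bij_betw b A B \<and> (\<forall>a\<in>A. g (b a) = f a)"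
  using assms
proof (induction A arbitrary: B rule: finite_induct)
  case empty
  then show ?case by (auto simp: mset_set_empty_iff bij_betw_def)
next
  case (insert a A)
  have "f a \<in># image_mset g (mset_set B)"
    using insert.hyps insert.prems(2)[symmetric] by simp
  then obtain c where c: "c \<in> B" "g c = f a" using insert.prems(1) by auto
  have "mset_set B = add_mset c (mset_set (B - {c}))"
    using c insert.prems(1) by (simp add: mset_set.remove)
  then have "image_mset f (mset_set A) = image_mset g (mset_set (B - {c}))"
    using insert.hyps insert.prems c by simp
  then obtain b where b: "bij_betw b A (B - {c})" "\<forall>a\<in>A. g (b a) = f a"
    using insert.IH[of "B - {c}"] insert.prems by auto
  have "bij_betw (b(a := c)) A (B - {c})"
    using b(1) insert.hyps(2) by (subst bij_betw_cong[where g = b]) auto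
  then have "bij_betw (b(a := c)) (A \<union> {a}) (B - {c} \<union> {c})"
    using notIn_Un_bij_betw[of a A "b(a := c)" "B - {c}"] insert.hyps(2) by simp
  then have "bij_betw (b(a := c)) (insert a A) B" using c by (simp add: insert_absorb)
  moreover have "\<forall>x\<in>insert a A. g ((b(a := c)) x) = f x" using b(2) c insert.hyps(2) by auto
  ultimately show ?case by blast
qed

context
  fixes n :: nat
begin

lemma permutes_in_orbit: "p permutes {1..n} \<Longrightarrow> x \<in> orbit p x"
  by (metis finite_atLeastAtMost permutation_permutes permutation_self_in_orbit)

lemma permutes_orbit_eq: "p permutes {1..n} \<Longrightarrow> y \<in> orbit p x \<Longrightarrow> orbit p y = orbit p x"
  by (meson orbit_eq_iff permutes_in_orbit)

lemma permutes_orbitE: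
  assumes "p permutes {1..n}" "y \<in> orbit p x"
  obtains k where "y = (p ^^ k) x"
  using assms by (auto simp: orbit_altdef)

lemma permutes_orbit_le: "p permutes {1..n} \<Longrightarrow> x \<in> {1..n} \<Longrightarrow> orbit p x \<subseteq> {1..n}"
  by (rule permutes_orbit_subset)

text \<open>A bijection between the cycles that preserves lengths, together with a base point in every cycle, gives
  the conjugating permutation: it sends the \<open>j\<close>-th iterate of a base point to the \<open>j\<close>-th
  iterate of the corresponding base point. This is well defined as corresponding cycles have equal
  length.\<close>

theorem conjugate_if_same_cycle_type:
  assumes p: "p permutes {1..n}" and q: "q permutes {1..n}"
    and ct: "cycle_type n p = cycle_type n q"
  shows "\<exists>s. s permutes {1..n} \<and> s \<circ> p = q \<circ> s"
proof -
  note pin = permutes_in_orbit[OF p] and qin = permutes_in_orbit[OF q]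
  obtain b where b: "bij_betw b (orbit p ` {1..n}) (orbit q ` {1..n})"
    and card_b: "\<And>A. A \<in> orbit p ` {1..n} \<Longrightarrow> card (b A) = card A"
    using image_mset_eq_imp_bij_betw[of "orbit p ` {1..n}" "orbit q ` {1..n}" card card] ct
    by (auto simp: cycle_type_def)
  \<comment> \<open>\<open>\<beta> x\<close> is the base point of the cycle of \<open>x\<close>, and \<open>\<gamma> x\<close> that of the corresponding cycle of \<open>q\<close>.\<close>
  define \<beta> where "\<beta> x = (SOME y. y \<in> orbit p x)" for x
  define \<gamma> where "\<gamma> x = (SOME y. y \<in> b (orbit p x))" for x
  have \<beta>: "\<beta> x \<in> orbit p x" for x unfolding \<beta>_def using pin by (rule someI)
  have \<beta>_eq: "orbit p (\<beta> x) = orbit p x" for x using permutes_orbit_eq[OF p \<beta>] .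
  have \<beta>_cong: "\<beta> y = \<beta> x" "\<gamma> y = \<gamma> x" if "y \<in> orbit p x" for x y
    using permutes_orbit_eq[OF p that] by (simp_all add: \<beta>_def \<gamma>_def)
  have b_in: "b (orbit p x) \<in> orbit q ` {1..n}" if "x \<in> {1..n}" for x
    using b that unfolding bij_betw_def by blast
  have \<gamma>_eq: "orbit q (\<gamma> x) = b (orbit p x)" if x: "x \<in> {1..n}" for x
  proof -
    obtain y where y: "b (orbit p x) = orbit q y" using b_in[OF x] by auto
    then have "y \<in> b (orbit p x)" using qin by simp
    then have "\<gamma> x \<in> b (orbit p x)" unfolding \<gamma>_def by (rule someI)
    then show ?thesis using y permutes_orbit_eq[OF q] by simp
  qed
  have card_eq: "card (orbit q (\<gamma> x)) = card (orbit p (\<beta> x))" if "x \<in> {1..n}" for x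
    using that card_b by (simp add: \<gamma>_eq \<beta>_eq)
  define k where "k x = (SOME k. x = (p ^^ k) (\<beta> x))" for x
  have k: "x = (p ^^ k x) (\<beta> x)" for x
  proof -
    have "x \<in> orbit p (\<beta> x)" using \<beta>_eq pin by simp
    then have "\<exists>k. x = (p ^^ k) (\<beta> x)" using p by (blast elim: permutes_orbitE)
    then show ?thesis unfolding k_def by (rule someI_ex)
  qed
  define s where "s x = (if x \<in> {1..n} then (q ^^ k x) (\<gamma> x) else x)" for x
  have s_pow: "s ((p ^^ j) (\<beta> x)) = (q ^^ j) (\<gamma> x)" if x: "x \<in> {1..n}" for x j
  proof -
    let ?y = "(p ^^ j) (\<beta> x)"
    have "?y \<in> orbit p x" using \<beta> by (rule funpow_in_orbit)
    then have y: "?y \<in> {1..n}" "\<beta> ?y = \<beta> x" "\<gamma> ?y = \<gamma> x"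
      using permutes_orbit_le[OF p x] \<beta>_cong by auto
    have "(p ^^ k ?y) (\<beta> x) = (p ^^ j) (\<beta> x)" using k[of ?y] y by simp
    then have "(q ^^ k ?y) (\<gamma> x) = (q ^^ j) (\<gamma> x)"
      unfolding funpow_eq_iff_mod_card_orbit[OF pin] funpow_eq_iff_mod_card_orbit[OF qin]
      using card_eq[OF x] by simp
    then show ?thesis using y by (simp add: s_def)
  qed
  have comm: "s (p x) = q (s x)" for x
  proof (cases "x \<in> {1..n}")
    case True
    have "s (p x) = s ((p ^^ Suc (k x)) (\<beta> x))" using k[of x] by simp
    also have "\<dots> = q ((q ^^ k x) (\<gamma> x))" unfolding s_pow[OF True] by simp
    also have "\<dots> = q (s x)" using True by (simp add: s_def)
    finally show ?thesis .
  next
    case False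
    then have "p x = x" "q x = x" using permutes_not_in p q by metis+
    then show ?thesis using False by (auto simp: s_def)
  qed
  have surj: "{1..n} \<subseteq> s ` {1..n}"
  proof
    fix y assume y: "y \<in> {1..n}"
    then have "orbit q y \<in> b ` orbit p ` {1..n}" unfolding bij_betw_imp_surj_on[OF b] by (rule imageI)
    then obtain x where x: "x \<in> {1..n}" "b (orbit p x) = orbit q y" by (elim imageE) simp
    then have "y \<in> orbit q (\<gamma> x)" using \<gamma>_eq qin by simp
    then obtain j where j: "y = (q ^^ j) (\<gamma> x)" using q by (blast elim: permutes_orbitE)
    have "(p ^^ j) (\<beta> x) \<in> orbit p x" using \<beta> by (rule funpow_in_orbit)
    then have "(p ^^ j) (\<beta> x) \<in> {1..n}" using permutes_orbit_le[OF p x(1)] by auto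
    then show "y \<in> s ` {1..n}" using s_pow[OF x(1)] j by (metis imageI)
  qed
  have into: "s ` {1..n} \<subseteq> {1..n}"
  proof
    fix y assume "y \<in> s ` {1..n}"
    then obtain x where x: "x \<in> {1..n}" "y = (q ^^ k x) (\<gamma> x)" by (auto simp: s_def)
    have "y \<in> orbit q (\<gamma> x)" unfolding x(2) using qin by (rule funpow_in_orbit)
    then have "y \<in> b (orbit p x)" using \<gamma>_eq[OF x(1)] by simp
    moreover obtain z where "z \<in> {1..n}" "b (orbit p x) = orbit q z" using b_in[OF x(1)] by (elim imageE)
    ultimately show "y \<in> {1..n}" using permutes_orbit_le[OF q] by blast
  qed
  have "inj_on s {1..n}"
    using surj into by (metis eq_card_imp_inj_on finite_atLeastAtMost subset_antisym)
  then have "s permutes {1..n}"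
    using surj into by (intro bij_imp_permutes) (auto simp: bij_betw_def s_def)
  then show ?thesis using comm by (intro exI[of _ s]) (auto simp: fun_eq_iff)
qed

end

text \<open>How orbits are identified below: an explicit listing of points along which \<open>f\<close> moves and then
  returns to the start.\<close>

lemma orbit_of_cycle:
  assumes m: "0 < m" and step: "\<And>k. Suc k < m \<Longrightarrow> f (c k) = c (Suc k)"
    and close: "f (c (m - 1)) = c 0"
  shows "orbit f (c 0) = c ` {..<m}"
proof -
  have pow: "(f ^^ k) (c 0) = c k" if "k < m" for k
    using that by (induction k) (auto simp: step)
  obtain m' where m': "m = Suc m'" using m gr0_implies_Suc by blast
  have "(f ^^ m) (c 0) = c 0" using pow[of m'] close by (simp add: m')
  from orbit_altdef_bounded[OF this m] have "orbit f (c 0) = (\<lambda>k. (f ^^ k) (c 0)) ` {..<m}" by auto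
  also have "\<dots> = c ` {..<m}" using pow by (intro image_cong) auto
  finally show ?thesis .
qed

context
  fixes n :: nat and g :: "nat \<Rightarrow> nat"
  assumes g: "g permutes {1..n}"
begin

private lemma gin: "x \<in> orbit g x" using permutes_in_orbit[OF g] .
private lemma geq: "y \<in> orbit g x \<Longrightarrow> orbit g y = orbit g x" using permutes_orbit_eq[OF g] .

lemma funpow_eq_start_iff:
  assumes "0 < a" "a \<le> card (orbit g i)" "b \<le> card (orbit g i)" "0 < b"
  shows "(g ^^ a) i = (g ^^ b) i \<longleftrightarrow> a = b"
proof -
  let ?m = "card (orbit g i)"
  have "(g ^^ a) i = (g ^^ b) i \<longleftrightarrow> a mod ?m = b mod ?m"
    by (rule funpow_eq_iff_mod_card_orbit[OF gin])
  also have "\<dots> \<longleftrightarrow> a = b"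
    using assms by (cases "a = ?m"; cases "b = ?m") auto
  finally show ?thesis .
qed

lemma orbit_eq_funpows: "orbit g i = (\<lambda>k. (g ^^ Suc k) i) ` {..<card (orbit g i)}"
proof -
  have fin: "finite (orbit g i)" using finite_orbit[OF gin] .
  have "inj_on (\<lambda>k. (g ^^ Suc k) i) {..<card (orbit g i)}"
    using funpow_eq_start_iff by (intro inj_onI) (auto simp del: funpow.simps)
  moreover have "(\<lambda>k. (g ^^ Suc k) i) ` {..<card (orbit g i)} \<subseteq> orbit g i"
    by (auto simp: orbit_altdef simp del: funpow.simps)
  ultimately show ?thesis
    by (metis card_image card_lessThan card_subset_eq fin)
qed

lemma funpow_card_orbit: "(g ^^ card (orbit g i)) i = i"
  using funpow_eq_iff_mod_card_orbit[OF gin, where x = i and i = "card (orbit g i)" and j = 0] by simp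

lemma orbit_comp_transpose_disjoint:
  assumes "i \<notin> orbit g x" "j \<notin> orbit g x"
  shows "orbit (g \<circ> transpose i j) x = orbit g x"
  using gin by (rule orbit_cong) (use assms in \<open>auto simp: transpose_def\<close>)

text \<open>Going round the cycle from \<open>g i\<close>, the new permutation returns to \<open>g i\<close> after reaching
  the \<open>d\<close>-th iterate of \<open>i\<close>; the remaining \<open>card (orbit g i) - d\<close> points form the second cycle.\<close>

lemma cycle_type_split:
  assumes i: "i \<in> {1..n}" and d: "0 < d" "d < card (orbit g i)"
  shows "cycle_type n (g \<circ> transpose i ((g ^^ d) i))
       = cycle_type n g - {#card (orbit g i)#} + {#d, card (orbit g i) - d#}"
proof -
  let ?A = "orbit g i" and ?m = "card (orbit g i)" and ?j = "(g ^^ d) i"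
  let ?h = "g \<circ> transpose i ?j"
  have hi: "?h i = g ?j" "?h ?j = g i" by auto
  have hne: "?h x = g x" if "x \<noteq> i" "x \<noteq> ?j" for x using that by (simp add: transpose_def)
  have fp: "g ((g ^^ k) i) = (g ^^ Suc k) i" for k by simp
  have ne: "(g ^^ k) i \<noteq> i" "k \<noteq> d \<Longrightarrow> (g ^^ k) i \<noteq> ?j" if k: "0 < k" "k < ?m" for k
  proof -
    show "(g ^^ k) i \<noteq> i"
      using funpow_eq_start_iff[of k i ?m] k unfolding funpow_card_orbit[of i] by linarith
    show "(g ^^ k) i \<noteq> ?j" if "k \<noteq> d"
      using funpow_eq_start_iff[of k i d] k d that by linarith
  qed
  define A1 where "A1 = (\<lambda>k. (g ^^ Suc k) i) ` {..<d}"
  define A2 where "A2 = (\<lambda>k. (g ^^ Suc k) i) ` {d..<?m}"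
  have inj: "inj_on (\<lambda>k. (g ^^ Suc k) i) {..<?m}"
    using funpow_eq_start_iff by (intro inj_onI) (auto simp del: funpow.simps)
  have A12: "A1 \<union> A2 = ?A" "A1 \<inter> A2 = {}"
  proof -
    have "A1 \<union> A2 = (\<lambda>k. (g ^^ Suc k) i) ` {..<?m}"
      unfolding A1_def A2_def image_Un[symmetric] using d
      by (intro arg_cong2[where f = image]) auto
    then show "A1 \<union> A2 = ?A" using orbit_eq_funpows[of i] by (metis (no_types))
    show "A1 \<inter> A2 = {}"
      unfolding A1_def A2_def using d
      by (subst inj_on_image_Int[OF inj, symmetric]) auto
  qed
  have card: "card A1 = d" "card A2 = ?m - d"
  proof -
    have "{..<d} \<subseteq> {..<?m}" "{d..<?m} \<subseteq> {..<?m}" using d by auto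
    from this[THEN card_image[OF inj_on_subset[OF inj]]]
    show "card A1 = d" "card A2 = ?m - d" unfolding A1_def A2_def by simp_all
  qed
  have o1: "orbit ?h ((g ^^ Suc 0) i) = A1"
    unfolding A1_def
  proof (rule orbit_of_cycle)
    fix k assume "Suc k < d"
    then show "?h ((g ^^ Suc k) i) = (g ^^ Suc (Suc k)) i"
      using ne[of "Suc k"] d fp[of "Suc k"] by (subst hne) (auto simp del: funpow.simps)
  qed (use d hi in \<open>auto simp del: comp_apply\<close>)
  have o2: "orbit ?h ((g ^^ Suc (0 + d)) i) = A2"
  proof -
    have "orbit ?h ((g ^^ Suc (0 + d)) i) = (\<lambda>k. (g ^^ Suc (k + d)) i) ` {..<?m - d}"
    proof (rule orbit_of_cycle)
      fix k assume "Suc k < ?m - d"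
      then show "?h ((g ^^ Suc (k + d)) i) = (g ^^ Suc (Suc k + d)) i"
        using ne[of "Suc (k + d)"] d fp[of "Suc (k + d)"]
        by (subst hne) (auto simp del: funpow.simps)
    next
      have "(g ^^ Suc (?m - d - 1 + d)) i = i" using d funpow_card_orbit[of i] by (simp del: funpow.simps)
      then show "?h ((g ^^ Suc (?m - d - 1 + d)) i) = (g ^^ Suc (0 + d)) i" using hi by simp
    qed (use d in auto)
    also have "\<dots> = A2"
    proof -
      have "{d..<?m} = (\<lambda>k. k + d) ` {..<?m - d}"
        using d image_add_atLeastLessThan'[of d 0 "?m - d"] by (simp add: lessThan_atLeast0)
      then show ?thesis by (simp add: A2_def image_image del: funpow.simps)
    qed
    finally show ?thesis .
  qed
  have hperm: "?h permutes {1..n}"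
  proof -
    have "?j \<in> orbit g i" using gin by (rule funpow_in_orbit)
    then have "?j \<in> {1..n}" using permutes_orbit_le[OF g i] by auto
    then show ?thesis using g i by (intro permutes_compose permutes_swap_id) auto
  qed
  have hA: "orbit ?h ` ?A = {A1, A2}"
  proof -
    have 1: "orbit ?h x = A1" if "x \<in> A1" for x
      using permutes_orbit_eq[OF hperm, of x "(g ^^ Suc 0) i"] that by (simp only: o1)
    have 2: "orbit ?h x = A2" if "x \<in> A2" for x
      using permutes_orbit_eq[OF hperm, of x "(g ^^ Suc (0 + d)) i"] that by (simp only: o2)
    have "A1 \<noteq> {}" "A2 \<noteq> {}" using d card by auto
    then show ?thesis using 1 2 A12(1) by (auto simp: image_iff)
  qed
  have A: "?A \<subseteq> {1..n}" using permutes_orbit_le[OF g i] .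
  have rest: "orbit ?h x = orbit g x" "orbit g x \<noteq> ?A" if "x \<in> {1..n} - ?A" for x
  proof -
    show "orbit g x \<noteq> ?A" using that gin by auto
    have "i \<notin> orbit g x" using that geq[of i x] gin by auto
    moreover have "?j \<notin> orbit g x"
      using that geq[of ?j x] geq[of ?j i] gin funpow_in_orbit[OF gin, of d i] gin[of x] by auto
    ultimately show "orbit ?h x = orbit g x" by (rule orbit_comp_transpose_disjoint)
  qed
  define R where "R = orbit g ` ({1..n} - ?A)"
  have S: "{1..n} = ({1..n} - ?A) \<union> ?A" using A by auto
  have "orbit g ` ?A = {?A}" using geq[of _ i] gin[of i] by blast
  then have Og: "orbit g ` {1..n} = insert ?A R"
    unfolding R_def by (subst S, subst image_Un) simp
  have Oh: "orbit ?h ` {1..n} = insert A1 (insert A2 R)"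
    unfolding R_def by (subst S, subst image_Un) (use hA rest in auto)
  have disj: "B \<inter> ?A = {}" if B: "B \<in> R" for B
  proof -
    obtain x where x: "x \<in> {1..n} - ?A" "B = orbit g x" using B unfolding R_def by blast
    have False if "y \<in> B" "y \<in> ?A" for y
      using that x geq[of y x] geq[of y i] gin[of x] by auto
    then show ?thesis by blast
  qed
  have sub12: "A1 \<inter> ?A = A1" "A2 \<inter> ?A = A2" and ne12: "A1 \<noteq> {}" "A2 \<noteq> {}"
    using A12(1) card d by auto
  have notin: "?A \<notin> R" "A2 \<notin> R" "A1 \<notin> insert A2 R"
    using disj[of ?A] disj[of A1] disj[of A2] A12(2) sub12 ne12 gin[of i] by auto
  have fin: "finite R" by (simp add: R_def)
  show ?thesis
    unfolding cycle_type_def Og Oh using notin fin card by simp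
qed

text \<open>The new cycle runs through the cycle of \<open>j\<close>, starting from \<open>g j\<close> and ending with \<open>j\<close>, and then jumps to \<open>g i\<close>
  and runs through the cycle of \<open>i\<close>.\<close>

lemma cycle_type_merge:
  assumes i: "i \<in> {1..n}" and j: "j \<in> {1..n}" "j \<notin> orbit g i"
  shows "cycle_type n (g \<circ> transpose i j)
       = cycle_type n g - {#card (orbit g i), card (orbit g j)#} + {#card (orbit g i) + card (orbit g j)#}"
proof -
  let ?A = "orbit g i" and ?B = "orbit g j" and ?h = "g \<circ> transpose i j"
  let ?a = "card ?A" and ?b = "card ?B"
  have AB: "?A \<inter> ?B = {}" using geq j gin by (metis disjoint_iff)
  have hi: "?h i = g j" "?h j = g i" by auto
  have hne: "?h x = g x" if "x \<noteq> i" "x \<noteq> j" for x using that by (simp add: transpose_def)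
  have fp: "g ((g ^^ k) x) = (g ^^ Suc k) x" for k x by simp
  have pos: "0 < ?a" "0 < ?b"
    using finite_orbit[OF gin] gin by (auto simp: card_gt_0_iff)
  have inA: "(g ^^ k) i \<in> ?A" "(g ^^ k) j \<in> ?B" for k using gin by (auto intro: funpow_in_orbit)
  have neA: "(g ^^ k) i \<noteq> i" if "0 < k" "k < ?a" for k
    using funpow_eq_start_iff[of k i ?a] that unfolding funpow_card_orbit[of i] by linarith
  have neB: "(g ^^ k) j \<noteq> j" if "0 < k" "k < ?b" for k
    using funpow_eq_start_iff[of k j ?b] that unfolding funpow_card_orbit[of j] by linarith
  have ij: "(g ^^ k) i \<noteq> j" "(g ^^ k) j \<noteq> i" for k
    using inA(1)[of k] inA(2)[of k] gin[of i] gin[of j] AB by auto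
  \<comment> \<open>The points of the merged cycle in order.\<close>
  define c where "c k = (if k < ?b then (g ^^ Suc k) j else (g ^^ Suc (k - ?b)) i)" for k
  have orb: "orbit ?h (c 0) = c ` {..<?a + ?b}"
  proof (rule orbit_of_cycle)
    fix k assume k: "Suc k < ?a + ?b"
    consider "Suc k < ?b" | "Suc k = ?b" | "?b < Suc k" by linarith
    then show "?h (c k) = c (Suc k)"
    proof cases
      case 1
      then have "c k = (g ^^ Suc k) j" "c (Suc k) = (g ^^ Suc (Suc k)) j" by (simp_all add: c_def)
      then show ?thesis using neB[of "Suc k"] ij(2)[of "Suc k"] 1 fp[of "Suc k" j] hne[of "(g ^^ Suc k) j"]
        by (simp del: funpow.simps comp_apply)
    next
      case 2
      then have "c k = j" "c (Suc k) = g i" using funpow_card_orbit[of j] by (simp_all add: c_def del: funpow.simps) simp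
      then show ?thesis using hi by simp
    next
      case 3
      then have "c k = (g ^^ Suc (k - ?b)) i" "c (Suc k) = (g ^^ Suc (Suc (k - ?b))) i"
        by (simp_all add: c_def Suc_diff_le del: funpow.simps)
      moreover have "Suc (k - ?b) < ?a" using 3 k by linarith
      ultimately show ?thesis using neA[of "Suc (k - ?b)"] ij(1)[of "Suc (k - ?b)"] fp[of "Suc (k - ?b)" i]
          hne[of "(g ^^ Suc (k - ?b)) i"]
        by (simp del: funpow.simps comp_apply)
    qed
  next
    have "Suc (?a + ?b - 1 - ?b) = ?a" "\<not> ?a + ?b - 1 < ?b" using pos by auto
    then have "c (?a + ?b - 1) = i" using funpow_card_orbit[of i] by (simp only: c_def if_False)
    moreover have "c 0 = g j" using pos by (simp add: c_def)
    ultimately show "?h (c (?a + ?b - 1)) = c 0" using hi by simp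
  qed (use pos in auto)
  have "c ` {..<?a + ?b} = c ` {..<?b} \<union> c ` {?b..<?b + ?a}"
    unfolding image_Un[symmetric] by (intro arg_cong2[where f = image]) auto
  also have "c ` {..<?b} = (\<lambda>k. (g ^^ Suc k) j) ` {..<?b}"
    by (intro image_cong) (auto simp: c_def)
  also have "\<dots> = ?B" by (rule orbit_eq_funpows[symmetric])
  also have "c ` {?b..<?b + ?a} = ?A"
  proof -
    have "{?b..<?b + ?a} = (\<lambda>k. k + ?b) ` {..<?a}"
      using image_add_atLeastLessThan'[of ?b 0 ?a] by (simp add: lessThan_atLeast0 add.commute)
    then have "c ` {?b..<?b + ?a} = (\<lambda>k. c (k + ?b)) ` {..<?a}" by (simp only: image_image)
    also have "\<dots> = (\<lambda>k. (g ^^ Suc k) i) ` {..<?a}"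
      by (simp add: c_def del: funpow.simps)
    also have "\<dots> = ?A" by (rule orbit_eq_funpows[symmetric])
    finally show ?thesis .
  qed
  finally have o: "orbit ?h (c 0) = ?A \<union> ?B" using orb by auto
  have hperm: "?h permutes {1..n}"
    using g i j by (intro permutes_compose permutes_swap_id) auto
  have hA: "orbit ?h ` (?A \<union> ?B) = {?A \<union> ?B}"
  proof -
    have "orbit ?h x = ?A \<union> ?B" if "x \<in> ?A \<union> ?B" for x
      using permutes_orbit_eq[OF hperm, of x "c 0"] that by (simp only: o)
    then show ?thesis using gin by auto
  qed
  have A: "?A \<union> ?B \<subseteq> {1..n}" using permutes_orbit_le[OF g] i j by simp
  have rest: "orbit ?h x = orbit g x" if "x \<in> {1..n} - (?A \<union> ?B)" for x
  proof -
    have "i \<notin> orbit g x" "j \<notin> orbit g x" using that geq[of i x] geq[of j x] gin by auto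
    then show "orbit ?h x = orbit g x" by (rule orbit_comp_transpose_disjoint)
  qed
  define R where "R = orbit g ` ({1..n} - (?A \<union> ?B))"
  have S: "{1..n} = ({1..n} - (?A \<union> ?B)) \<union> (?A \<union> ?B)" using A by auto
  have Og: "orbit g ` {1..n} = insert ?A (insert ?B R)"
    unfolding R_def by (subst S, subst image_Un) (use geq gin in \<open>auto simp: image_iff\<close>)
  have Oh: "orbit ?h ` {1..n} = insert (?A \<union> ?B) R"
    unfolding R_def by (subst S, subst image_Un) (use hA rest in auto)
  have disj: "C \<inter> (?A \<union> ?B) = {}" if C: "C \<in> R" for C
  proof -
    obtain x where x: "x \<in> {1..n} - (?A \<union> ?B)" "C = orbit g x" using C unfolding R_def by blast
    have False if "y \<in> C" "y \<in> ?A \<union> ?B" for y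
      using that x geq[of y x] geq[of y i] geq[of y j] gin[of x] by auto
    then show ?thesis by blast
  qed
  have notin: "?A \<notin> insert ?B R" "?B \<notin> R" "?A \<union> ?B \<notin> R"
    using disj[of ?A] disj[of ?B] disj[of "?A \<union> ?B"] gin[of i] gin[of j] j by auto
  have fin: "finite R" by (simp add: R_def)
  have "card (?A \<union> ?B) = ?a + ?b" using AB finite_orbit[OF gin] by (intro card_Un_disjoint) auto
  then show ?thesis
    unfolding cycle_type_def Og Oh using notin fin by simp
qed

end

text \<open>Each cycle of length \<open>r\<close> is met by \<open>r\<close> points.\<close>

lemma sum_card_orbit:
  fixes f :: "nat \<Rightarrow> complex"
  assumes g: "g permutes {1..n}"
  shows "(\<Sum>j\<in>{1..n}. f (card (orbit g j))) = (\<Sum>r\<in>#cycle_type n g. of_nat r * f r)"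
proof -
  have fib: "{j \<in> {1..n}. orbit g j = A} = A" if A: "A \<in> orbit g ` {1..n}" for A
  proof -
    obtain x where x: "x \<in> {1..n}" "A = orbit g x" using A by blast
    show ?thesis
      using permutes_in_orbit[OF g] permutes_orbit_eq[OF g, of _ x] permutes_orbit_le[OF g x(1)] x(2) by blast
  qed
  have "(\<Sum>j\<in>{1..n}. f (card (orbit g j)))
      = (\<Sum>A\<in>orbit g ` {1..n}. \<Sum>j\<in>{j \<in> {1..n}. orbit g j = A}. f (card (orbit g j)))"
    by (rule sum.image_gen) simp
  also have "\<dots> = (\<Sum>A\<in>orbit g ` {1..n}. of_nat (card A) * f (card A))"
  proof (rule sum.cong[OF refl])
    fix A assume "A \<in> orbit g ` {1..n}"
    from fib[OF this]
    have "(\<Sum>j\<in>{j \<in> {1..n}. orbit g j = A}. f (card (orbit g j))) = (\<Sum>j\<in>{j \<in> {1..n}. orbit g j = A}. f (card A))"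
      by (intro sum.cong) auto
    also have "\<dots> = of_nat (card A) * f (card A)"
      unfolding fib[OF \<open>A \<in> orbit g ` {1..n}\<close>] by simp
    finally show "(\<Sum>j\<in>{j \<in> {1..n}. orbit g j = A}. f (card (orbit g j))) = of_nat (card A) * f (card A)" .
  qed
  also have "\<dots> = (\<Sum>r\<in>#cycle_type n g. of_nat r * f r)"
    by (simp add: cycle_type_def sum_unfold_sum_mset image_mset.compositionality comp_def)
  finally show ?thesis .
qed

lemma mem_cycle_typeE:
  assumes "m \<in># cycle_type n g"
  obtains i where "i \<in> {1..n}" "card (orbit g i) = m"
  using assms by (auto simp: cycle_type_def)

lemma mem_cycle_typeI: "i \<in> {1..n} \<Longrightarrow> card (orbit g i) \<in># cycle_type n g"
  by (auto simp: cycle_type_def)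

text \<open>Let \<open>A\<close> be a cycle of even length \<open>m\<close>. If neither point of a transposition lies in \<open>A\<close>, then \<open>A\<close>
  remains a cycle and \<open>\<Phi>\<close> vanishes. If both do, \<open>A\<close> is cut into \<open>d\<close> and \<open>m - d\<close> points. If one does,
  \<open>A\<close> is joined to another cycle. Every row of the double sum with \<open>i \<in> A\<close> has the same value,
  and the mixed terms occur twice, so the total is \<open>m\<close> times the asserted expression.\<close>

theorem transposition_sum_cycle_type:
  fixes \<Phi> :: "nat multiset \<Rightarrow> complex"
  assumes g: "g permutes {1..n}"
    and even: "\<And>\<tau> r. r \<in># \<tau> \<Longrightarrow> even r \<Longrightarrow> \<Phi> \<tau> = 0"
    and zero: "(\<Sum>i\<in>{1..n}. \<Sum>j\<in>{1..n} - {i}. \<Phi> (cycle_type n (g \<circ> transpose i j))) = 0"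
    and ct: "cycle_type n g = add_mset m \<gamma>" and m: "even m"
  shows "(\<Sum>d\<in>{1..<m}. \<Phi> (\<gamma> + {#d, m - d#}))
       + 2 * (\<Sum>r\<in>#\<gamma>. of_nat r * \<Phi> (\<gamma> - {#r#} + {#m + r#})) = 0"
proof -
  note gin = permutes_in_orbit[OF g] and geq = permutes_orbit_eq[OF g]
  obtain i0 where i0: "i0 \<in> {1..n}" "card (orbit g i0) = m"
    using ct by (metis mem_cycle_typeE union_single_eq_member)
  define S where "S = {1..n}"
  define A where "A = orbit g i0"
  have AS: "A \<subseteq> S" using permutes_orbit_le[OF g i0(1)] by (simp add: A_def S_def)
  have finS: "finite S" by (simp add: S_def)
  have finA: "finite A" using AS finS finite_subset by blast
  have cA: "card A = m" by (simp add: A_def i0)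
  have oA: "orbit g i = A" if "i \<in> A" for i using that geq unfolding A_def by blast
  have m0: "0 < m" using cA finA gin[of i0] by (auto simp: A_def card_gt_0_iff)
  define f where "f i j = \<Phi> (cycle_type n (g \<circ> transpose i j))" for i j
  define D where "D = (\<Sum>d\<in>{1..<m}. \<Phi> (\<gamma> + {#d, m - d#}))"
  define F where "F r = \<Phi> (\<gamma> - {#r#} + {#m + r#})" for r
  define M where "M = (\<Sum>r\<in>#\<gamma>. of_nat r * F r)"
  have fsym: "f i j = f j i" for i j by (simp add: f_def transpose_commute)
  have inner: "(\<Sum>j\<in>A - {i}. f i j) = D" if i: "i \<in> A" for i
  proof -
    have ci: "card (orbit g i) = m" using oA[OF i] cA by simp
    have pow: "(g ^^ a) i = (g ^^ b) i \<longleftrightarrow> a = b" if "0 < a" "a \<le> m" "0 < b" "b \<le> m" for a b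
      using funpow_eq_start_iff[OF g, of a i b] that ci by simp
    have im: "A = (\<lambda>k. (g ^^ Suc k) i) ` {..<m}"
      using orbit_eq_funpows[OF g, of i] oA[OF i] ci by simp
    have gm: "(g ^^ m) i = i" using funpow_card_orbit[OF g, of i] ci by simp
    have "A - {i} = (\<lambda>k. (g ^^ k) i) ` {1..<m}"
    proof -
      have "A = (\<lambda>k. (g ^^ k) i) ` Suc ` {..<m}" unfolding im image_image by simp
      also have "Suc ` {..<m} = insert m {1..<m}"
        using m0 by (auto simp: image_Suc_lessThan)
      finally have "A = insert i ((\<lambda>k. (g ^^ k) i) ` {1..<m})" by (simp add: gm)
      moreover have "i \<notin> (\<lambda>k. (g ^^ k) i) ` {1..<m}"
      proof
        assume "i \<in> (\<lambda>k. (g ^^ k) i) ` {1..<m}"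
        then obtain k where k: "1 \<le> k" "k < m" "(g ^^ k) i = i" by auto
        then show False using pow[of m k] gm m0 by simp
      qed
      ultimately show ?thesis by blast
    qed
    moreover have "inj_on (\<lambda>k. (g ^^ k) i) {1..<m}" using pow by (intro inj_onI) auto
    ultimately have "(\<Sum>j\<in>A - {i}. f i j) = (\<Sum>d\<in>{1..<m}. f i ((g ^^ d) i))"
      by (simp add: sum.reindex)
    also have "\<dots> = D" unfolding D_def f_def
    proof (rule sum.cong[OF refl])
      fix d assume "d \<in> {1..<m}"
      then have "cycle_type n (g \<circ> transpose i ((g ^^ d) i)) = \<gamma> + {#d, m - d#}"
        using cycle_type_split[OF g, of i d] AS i ct ci by (auto simp: S_def)
      then show "\<Phi> (cycle_type n (g \<circ> transpose i ((g ^^ d) i))) = \<Phi> (\<gamma> + {#d, m - d#})" by simp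
    qed
    finally show ?thesis .
  qed
  have outer: "(\<Sum>j\<in>S - A. f i j) = M" if i: "i \<in> A" for i
  proof -
    have "(\<Sum>j\<in>S - A. f i j) = (\<Sum>j\<in>S - A. F (card (orbit g j)))"
    proof (rule sum.cong[OF refl])
      fix j assume j: "j \<in> S - A"
      have "cycle_type n (g \<circ> transpose i j) = \<gamma> - {#card (orbit g j)#} + {#m + card (orbit g j)#}"
        using cycle_type_merge[OF g, of i j] AS i j ct oA[OF i] cA by (auto simp: S_def)
      then show "f i j = F (card (orbit g j))" by (simp add: f_def F_def)
    qed
    also have "\<dots> = (\<Sum>j\<in>S. F (card (orbit g j))) - (\<Sum>j\<in>A. F (card (orbit g j)))"
      using AS finS by (simp add: sum_diff)
    also have "(\<Sum>j\<in>A. F (card (orbit g j))) = of_nat m * F m" using oA cA by simp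
    also have "(\<Sum>j\<in>S. F (card (orbit g j))) = of_nat m * F m + M"
      unfolding S_def sum_card_orbit[OF g, of F] ct M_def by simp
    finally show ?thesis by simp
  qed
  have off: "f i j = 0" if "i \<in> S - A" "j \<in> S - A" for i j
  proof -
    have "orbit (g \<circ> transpose i j) i0 = orbit g i0"
      using that by (intro orbit_comp_transpose_disjoint[OF g]) (auto simp: A_def)
    then have "m \<in># cycle_type n (g \<circ> transpose i j)"
      using mem_cycle_typeI[OF i0(1), of "g \<circ> transpose i j"] i0(2) by simp
    then show ?thesis using even m by (simp add: f_def)
  qed
  have rowA: "(\<Sum>j\<in>S - {i}. f i j) = D + M" if i: "i \<in> A" for i
  proof -
    have "S - {i} = (A - {i}) \<union> (S - A)" using AS i by auto
    then have "(\<Sum>j\<in>S - {i}. f i j) = (\<Sum>j\<in>A - {i}. f i j) + (\<Sum>j\<in>S - A. f i j)"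
      using finA finS by (simp only:) (rule sum.union_disjoint, auto)
    then show ?thesis using inner[OF i] outer[OF i] by simp
  qed
  have rowB: "(\<Sum>j\<in>S - {i}. f i j) = (\<Sum>j\<in>A. f i j)" if i: "i \<in> S - A" for i
  proof -
    have "S - {i} = A \<union> (S - A - {i})" using AS i by auto
    then have "(\<Sum>j\<in>S - {i}. f i j) = (\<Sum>j\<in>A. f i j) + (\<Sum>j\<in>S - A - {i}. f i j)"
      using finA finS by (simp only:) (rule sum.union_disjoint, auto)
    moreover have "(\<Sum>j\<in>S - A - {i}. f i j) = 0" using off[OF i] by (intro sum.neutral) auto
    ultimately show ?thesis by simp
  qed
  have "0 = (\<Sum>i\<in>S. \<Sum>j\<in>S - {i}. f i j)" using zero by (simp add: S_def f_def)
  also have "\<dots> = (\<Sum>i\<in>A. \<Sum>j\<in>S - {i}. f i j) + (\<Sum>i\<in>S - A. \<Sum>j\<in>S - {i}. f i j)"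
    using sum.subset_diff[OF AS finS, of "\<lambda>i. \<Sum>j\<in>S - {i}. f i j"] by (simp add: add.commute)
  also have "(\<Sum>i\<in>A. \<Sum>j\<in>S - {i}. f i j) = of_nat m * (D + M)" using rowA cA by simp
  also have "(\<Sum>i\<in>S - A. \<Sum>j\<in>S - {i}. f i j) = (\<Sum>i\<in>S - A. \<Sum>j\<in>A. f j i)"
    using rowB fsym by simp
  also have "\<dots> = (\<Sum>j\<in>A. \<Sum>i\<in>S - A. f j i)" by (rule sum.swap)
  also have "\<dots> = of_nat m * M" using outer cA by simp
  finally have "of_nat m * (D + 2 * M) = 0" by (simp add: algebra_simps)
  then show ?thesis using m0 by (simp add: D_def M_def F_def)
qed

lemma cycle_type_id: "cycle_type n id = replicate_mset n 1"
proof -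
  have o: "orbit id x = {x}" for x :: nat by (simp add: orbit_eq_singleton_iff)
  have "mset_set ((\<lambda>x. {x}) ` {1..n}) = image_mset (\<lambda>x. {x}) (mset_set {1..n})"
    by (rule image_mset_mset_set[symmetric]) auto
  then show ?thesis unfolding cycle_type_def o
    by (simp add: image_mset.compositionality comp_def image_mset_const_eq)
qed

text \<open>Starting from the identity, a cycle of length \<open>m\<close> is obtained by joining a fixed point to a cycle of
  length \<open>m - 1\<close>. The induction is on \<open>n\<close> minus the number of cycles.\<close>

theorem exists_permutation_of_cycle_type:
  assumes "partition_of n \<tau>"
  shows "\<exists>g. g permutes {1..n} \<and> cycle_type n g = \<tau>"
  using assms
proof (induction "n - size \<tau>" arbitrary: \<tau> rule: less_induct)
  case less
  have size_le: "size \<sigma> \<le> sum_mset \<sigma>" if "0 \<notin># \<sigma>" for \<sigma> :: "nat multiset"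
    using that by (induction \<sigma>) auto
  show ?case
  proof (cases "\<forall>r\<in>#\<tau>. r = 1")
    case True
    then have "\<tau> = replicate_mset (size \<tau>) 1" by (metis set_mset_subset_singletonD singletonI subsetI)
    then have "\<tau> = replicate_mset n 1" using less.prems by (metis mult.right_neutral partition_of_def sum_mset_replicate_mset of_nat_id)
    moreover have "cycle_type n id = replicate_mset n 1" by (rule cycle_type_id)
    ultimately show ?thesis using permutes_id by metis
  next
    case False
    then obtain m where m: "m \<in># \<tau>" "m \<noteq> 1" by blast
    have m2: "2 \<le> m" using m less.prems by (cases m) (auto simp: partition_of_def)
    define \<gamma> where "\<gamma> = \<tau> - {#m#}"
    have \<tau>: "\<tau> = add_mset m \<gamma>" using m by (simp add: \<gamma>_def)
    define \<sigma> where "\<sigma> = add_mset (m - 1) (add_mset 1 \<gamma>)"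
    have \<sigma>: "partition_of n \<sigma>"
      using less.prems m2 unfolding \<sigma>_def \<tau> partition_of_def by auto
    have "size \<sigma> \<le> n" using size_le[of \<sigma>] \<sigma> by (simp add: partition_of_def)
    then have "n - size \<sigma> < n - size \<tau>" by (simp add: \<sigma>_def \<tau>)
    then obtain g where g: "g permutes {1..n}" "cycle_type n g = \<sigma>" using less.hyps \<sigma> by blast
    have "m - 1 \<in># cycle_type n g" by (simp add: g \<sigma>_def)
    then obtain i where i: "i \<in> {1..n}" "card (orbit g i) = m - 1" by (rule mem_cycle_typeE)
    have "mset_set (orbit g ` {1..n}) = add_mset (orbit g i) (mset_set (orbit g ` {1..n} - {orbit g i}))"
      using i by (simp add: mset_set.remove)
    then have "add_mset (m - 1) (image_mset card (mset_set (orbit g ` {1..n} - {orbit g i}))) = \<sigma>"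
      using g(2) i(2) by (simp add: cycle_type_def)
    then have "1 \<in># image_mset card (mset_set (orbit g ` {1..n} - {orbit g i}))"
      by (simp add: \<sigma>_def)
    then have "1 \<in> card ` (orbit g ` {1..n} - {orbit g i})" by simp
    then obtain B where B': "1 = card B" "B \<in> orbit g ` {1..n} - {orbit g i}" by (rule imageE)
    then have B: "B \<in> orbit g ` {1..n}" "B \<noteq> orbit g i" "card B = 1" by (blast, blast, simp only:)
    then obtain j where j: "j \<in> {1..n}" "B = orbit g j" by blast
    have "j \<notin> orbit g i" using permutes_orbit_eq[OF g(1), of j i] B j by auto
    then have "cycle_type n (g \<circ> transpose i j) = \<sigma> - {#m - 1, 1#} + {#m - 1 + 1#}"
      using cycle_type_merge[OF g(1) i(1) j(1)] i j B g by simp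
    also have "\<dots> = \<tau>" using m2 by (simp add: \<sigma>_def \<tau>)
    finally have "cycle_type n (g \<circ> transpose i j) = \<tau>" .
    moreover have "g \<circ> transpose i j permutes {1..n}"
      using g(1) i(1) j(1) by (intro permutes_compose permutes_swap_id)
    ultimately show ?thesis by blast
  qed
qed

section \<open>Characters of symmetric groups of 2-defect zero\<close>

lemma sym_group_pow: "g [^]\<^bsub>sym_group n\<^esub> (j::nat) = g ^^ j"
  by (induction j) (simp_all add: sym_group_def nat_pow_def funpow_Suc_right del: funpow.simps)

lemma finite_sym_group: "finite (carrier (sym_group n))"
  by (simp add: sym_group_def finite_permutations)

text \<open>A power prime to the order generates the same cyclic group, hence has the same orbits.\<close>

lemma cycle_type_coprime_power:
  assumes N: "0 < N" "g ^^ N = id" and j: "coprime j N"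
  shows "cycle_type n (g ^^ j) = cycle_type n g"
proof -
  have "orbit (g ^^ j) x = orbit g x" for x
  proof
    obtain k where k: "[j * k = 1] (mod N)" using j cong_solve_coprime_nat by auto
    have "((g ^^ j) ^^ k) y = g y" for y
    proof -
      have "((g ^^ j) ^^ k) y = (g ^^ (j * k)) y" by (simp add: funpow_mult mult.commute)
      also have "\<dots> = (g ^^ ((j * k) mod N)) y" using funpow_mod_eq[of N g y] N(2) by simp
      also have "(j * k) mod N = 1 mod N" using k by (simp add: cong_def)
      also have "(g ^^ (1 mod N)) y = (g ^^ 1) y" using funpow_mod_eq[of N g y 1] N(2) by simp
      finally show ?thesis by simp
    qed
    then have gk: "(g ^^ j) ^^ k = g" by auto
    have "orbit (h ^^ i) x \<subseteq> orbit h x" if self: "x \<in> orbit h x" for h :: "nat \<Rightarrow> nat" and i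
    proof
      fix y assume "y \<in> orbit (h ^^ i) x"
      then show "y \<in> orbit h x"
        by induction (auto intro: funpow_in_orbit self)
    qed
    moreover have "x \<in> orbit h x" if "h = g \<or> h = g ^^ j" for h
    proof -
      have "(g ^^ j) ^^ N = (g ^^ N) ^^ j" by (simp add: funpow_mult mult.commute)
      then have "(h ^^ N) x = x" using that N(2) by auto
      then show ?thesis using N(1) unfolding orbit_altdef by force
    qed
    ultimately show "orbit (g ^^ j) x \<subseteq> orbit g x" "orbit g x \<subseteq> orbit (g ^^ j) x"
      using gk by metis+
  qed
  then show ?thesis by (simp add: cycle_type_def)
qed

context
  fixes n d :: nat and \<rho> :: "(nat \<Rightarrow> nat) \<Rightarrow> complex mat"
  assumes rep: "representation (sym_group n) d \<rho>"
begin

lemma character_cycle_type: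
  assumes "p permutes {1..n}" "q permutes {1..n}" "cycle_type n p = cycle_type n q"
  shows "mat_trace (\<rho> p) = mat_trace (\<rho> q)"
proof -
  obtain s where s: "s permutes {1..n}" "s \<circ> p = q \<circ> s"
    using conjugate_if_same_cycle_type[OF assms] by blast
  note inv = permutes_inv[OF s(1)] and cc = character_conj[OF rep sym_group_is_group, unfolded sym_group_carrier sym_group_mult]
  have "mat_trace (\<rho> (q \<circ> s \<circ> inv' s)) = mat_trace (\<rho> (inv' s \<circ> (q \<circ> s)))"
    using inv s assms by (intro cc permutes_compose) auto
  moreover have "q \<circ> s \<circ> inv' s = q" using permutes_inv_o(1)[OF s(1)] by (simp add: comp_assoc)
  moreover have "inv' s \<circ> (q \<circ> s) = p"
    unfolding s(2)[symmetric] using permutes_inv_o(2)[OF s(1)] by (simp add: comp_assoc[symmetric])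
  ultimately show ?thesis by simp
qed

theorem sym_group_character_int:
  assumes g: "g permutes {1..n}"
  shows "mat_trace (\<rho> g) \<in> \<int>"
proof -
  interpret G: group "sym_group n" by (rule sym_group_is_group)
  define N where "N = Coset.order (sym_group n)"
  have gc: "g \<in> carrier (sym_group n)" using g by (simp add: sym_group_carrier)
  have N: "0 < N" unfolding N_def using finite_sym_group G.order_gt_0_iff_finite by blast
  have gN: "g [^]\<^bsub>sym_group n\<^esub> N = \<one>\<^bsub>sym_group n\<^esub>"
    unfolding N_def using gc by (rule G.pow_order_eq_1)
  show ?thesis
  proof (rule character_int_if_conjugate_powers[OF rep G.is_group gc N gN])
    fix j assume "j \<in> totatives N"
    then have "coprime j N" by (simp add: totatives_def)
    moreover have "g ^^ N = id" using gN by (simp add: sym_group_pow sym_group_one)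
    ultimately have "cycle_type n (g ^^ j) = cycle_type n g" using N by (intro cycle_type_coprime_power)
    then show "mat_trace (\<rho> (g [^]\<^bsub>sym_group n\<^esub> j)) = mat_trace (\<rho> g)"
      unfolding sym_group_pow using g by (intro character_cycle_type permutes_funpow)
  qed
qed

end

text \<open>Writing the group order and the degree as \<open>2 ^ v * q\<close> and \<open>2 ^ v * e\<close>, the convolution scalar
  is \<open>q / e\<close> with \<open>q\<close> odd. A \<open>2 ^ v\<close>-th power is killed by \<open>q\<close>, so all its cycles have odd
  length; a permutation with an even cycle is therefore not such a power.\<close>

theorem defect_zero_two_vanishes:
  assumes irr: "irreducible_representation (sym_group n) d \<rho>"
    and mult: "multiplicity 2 d = multiplicity 2 (Coset.order (sym_group n))"
    and g: "g permutes {1..n}" and r: "r \<in># cycle_type n g" "even r"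
  shows "mat_trace (\<rho> g) = 0"
proof -
  interpret G: group "sym_group n" by (rule sym_group_is_group)
  let ?G = "sym_group n"
  have rep: "representation ?G d \<rho>" and d: "0 < d"
    using irr unfolding irreducible_representation_def by simp_all
  define N where "N = Coset.order ?G"
  have N: "0 < N" unfolding N_def using finite_sym_group G.order_gt_0_iff_finite by blast
  define v where "v = multiplicity 2 N"
  define q where "q = N div 2 ^ v"
  define e where "e = d div 2 ^ v"
  have Nq: "N = 2 ^ v * q" unfolding v_def q_def using multiplicity_dvd[of 2 N] by simp
  have de: "d = 2 ^ v * e" unfolding v_def e_def N_def mult[symmetric] using multiplicity_dvd[of 2 d] by simp
  have q: "\<not> 2 dvd q" unfolding q_def v_def using N multiplicity_decompose[of N 2] by simp
  have e: "0 < e" using d de by (cases e) auto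
  \<comment> \<open>The integer values of the character; the floor only serves to name them.\<close>
  define z where "z h = \<lfloor>Re (mat_trace (\<rho> h))\<rfloor>" for h
  have z: "of_int (z h) = mat_trace (\<rho> h)" if "h \<in> carrier ?G" for h
    using sym_group_character_int[OF rep, of h] that unfolding z_def sym_group_carrier
    by (auto elim!: Ints_cases)
  have "z g = 0"
  proof (rule G.vanishes_off_prime_powers[where z = z and p = 2 and q = q and e = e and a = v])
    show "finite (carrier ?G)" by (rule finite_sym_group)
    show "z (x \<otimes>\<^bsub>?G\<^esub> y) = z (y \<otimes>\<^bsub>?G\<^esub> x)" if "x \<in> carrier ?G" "y \<in> carrier ?G" for x y
      unfolding z_def using character_conj[OF rep G.is_group that] by simp
    show "int e * (\<Sum>h\<in>carrier ?G. z h * z (inv\<^bsub>?G\<^esub> h \<otimes>\<^bsub>?G\<^esub> x)) = int q * z x"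
      if x: "x \<in> carrier ?G" for x
    proof -
      have "of_int (\<Sum>h\<in>carrier ?G. z h * z (inv\<^bsub>?G\<^esub> h \<otimes>\<^bsub>?G\<^esub> x))
          = (\<Sum>h\<in>carrier ?G. mat_trace (\<rho> h) * mat_trace (\<rho> (inv\<^bsub>?G\<^esub> h \<otimes>\<^bsub>?G\<^esub> x)))"
        unfolding of_int_sum of_int_mult using x
        by (intro sum.cong refl) (simp only: z G.m_closed G.inv_closed)
      also have "\<dots> = of_nat N / of_nat d * mat_trace (\<rho> x)"
        unfolding N_def by (rule character_convolution[OF irr G.is_group finite_sym_group x])
      also have "\<dots> = of_nat q / of_nat e * of_int (z x)" using e z[OF x] by (simp add: Nq de)
      finally have "of_int (int e * (\<Sum>h\<in>carrier ?G. z h * z (inv\<^bsub>?G\<^esub> h \<otimes>\<^bsub>?G\<^esub> x)))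
          = (of_int (int q * z x) :: complex)" using e by (simp add: field_simps)
      then show ?thesis by (simp only: of_int_eq_iff)
    qed
    show "g \<in> carrier ?G" using g by (simp add: sym_group_carrier)
    show "x [^]\<^bsub>?G\<^esub> (2 ^ v :: nat) \<noteq> g" if x: "x \<in> carrier ?G" for x
    proof
      assume "x [^]\<^bsub>?G\<^esub> (2 ^ v :: nat) = g"
      then have "g ^^ q = (x ^^ (2 ^ v)) ^^ q" unfolding sym_group_pow by (rule arg_cong[OF sym])
      also have "\<dots> = x ^^ N" by (simp add: funpow_mult Nq mult.commute)
      also have "\<dots> = id" using G.pow_order_eq_1[OF x] by (simp add: sym_group_pow sym_group_one N_def)
      finally have gq: "(g ^^ q) i = i" for i by simp
      obtain i where i: "i \<in> {1..n}" "card (orbit g i) = r" using r(1) by (rule mem_cycle_typeE)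
      have "r dvd q" using card_orbit_dvd_iff[OF permutes_in_orbit[OF g], of q i] gq i by simp
      then show False using q r(2) by (meson dvd_trans)
    qed
  qed (use q e in auto)
  then show ?thesis using z[of g] g by (simp add: sym_group_carrier)
qed

text \<open>\<open>\<Phi>\<close> is the character as a function of the cycle type. The recursion is the
  vanishing of the sum of all transpositions, which have the even cycle length \<open>2\<close>.\<close>

theorem defect_zero_recursion:
  assumes irr: "irreducible_representation (sym_group n) d \<rho>"
    and mult: "multiplicity 2 d = multiplicity 2 (Coset.order (sym_group n))"
  obtains \<Phi> :: "nat multiset \<Rightarrow> complex"
  where "\<And>g. g permutes {1..n} \<Longrightarrow> mat_trace (\<rho> g) = \<Phi> (cycle_type n g)"
    and "\<And>\<tau> r. r \<in># \<tau> \<Longrightarrow> even r \<Longrightarrow> \<Phi> \<tau> = 0"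
    and "\<And>g m \<gamma>. g permutes {1..n} \<Longrightarrow> cycle_type n g = add_mset m \<gamma> \<Longrightarrow> even m \<Longrightarrow>
      (\<Sum>d\<in>{1..<m}. \<Phi> (\<gamma> + {#d, m - d#}))
       + 2 * (\<Sum>r\<in>#\<gamma>. of_nat r * \<Phi> (\<gamma> - {#r#} + {#m + r#})) = 0"
proof -
  interpret G: group "sym_group n" by (rule sym_group_is_group)
  let ?G = "sym_group n"
  have rep: "representation ?G d \<rho>"
    using irr unfolding irreducible_representation_def by simp_all
  note vanish = defect_zero_two_vanishes[OF irr mult]
  define \<Phi> where "\<Phi> \<tau> = (if \<exists>g. g permutes {1..n} \<and> cycle_type n g = \<tau>
    then mat_trace (\<rho> (SOME g. g permutes {1..n} \<and> cycle_type n g = \<tau>)) else 0)" for \<tau>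
  have \<Phi>: "mat_trace (\<rho> g) = \<Phi> (cycle_type n g)" if g: "g permutes {1..n}" for g
  proof -
    define h where "h = (SOME h. h permutes {1..n} \<and> cycle_type n h = cycle_type n g)"
    have "h permutes {1..n} \<and> cycle_type n h = cycle_type n g"
      unfolding h_def by (rule someI[of _ g]) (use g in simp)
    then have "mat_trace (\<rho> g) = mat_trace (\<rho> h)" using g by (intro character_cycle_type[OF rep]) auto
    then show ?thesis using g unfolding \<Phi>_def h_def by auto
  qed
  have even: "\<Phi> \<tau> = 0" if "r \<in># \<tau>" "even r" for \<tau> r
  proof (cases "\<exists>g. g permutes {1..n} \<and> cycle_type n g = \<tau>")
    case True
    then obtain g where "g permutes {1..n}" "cycle_type n g = \<tau>" by blast
    then show ?thesis using \<Phi>[of g] vanish[of g r] that by simp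
  next
    case False
    then show ?thesis unfolding \<Phi>_def by (rule if_not_P)
  qed
  define T where "T = {transpose i j |i j. i \<in> {1..n} \<and> j \<in> {1..n} \<and> i \<noteq> j}"
  \<comment> \<open>Ordered pairs; each transposition in \<open>T\<close> comes from exactly two of them.\<close>
  define P where "P = {(i, j). i \<in> {1..n} \<and> j \<in> {1..n} \<and> i \<noteq> (j::nat)}"
  have finP: "finite P" by (rule finite_subset[of _ "{1..n} \<times> {1..n}"]) (auto simp: P_def)
  have TP: "T = (\<lambda>(i, j). transpose i j) ` P" by (auto simp: T_def P_def)
  have finT: "finite T" unfolding TP using finP by (rule finite_imageI)
  have TG: "T \<subseteq> carrier ?G"
  proof
    fix t assume "t \<in> T"
    then obtain i j where "t = transpose i j" "i \<in> {1..n}" "j \<in> {1..n}" unfolding T_def by blast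
    then show "t \<in> carrier ?G" by (simp only: sym_group_carrier permutes_swap_id)
  qed
  have zT: "mat_trace (\<rho> t) = 0" if tT: "t \<in> T" for t
  proof -
    obtain i j where ij: "t = transpose i j" "i \<in> {1..n}" "j \<in> {1..n}" "i \<noteq> j" using tT unfolding T_def by blast
    have o: "orbit id x = {x}" for x :: nat by (simp add: orbit_eq_singleton_iff)
    have "cycle_type n (id \<circ> transpose i j) = cycle_type n id - {#1, 1#} + {#2#}"
      using cycle_type_merge[OF permutes_id ij(2,3)] ij(4) by (simp add: o)
    then have "2 \<in># cycle_type n t" using ij by simp
    then show ?thesis using vanish[of t 2] ij by (simp add: permutes_swap_id)
  qed
  have sumT: "(\<Sum>t\<in>T. mat_trace (\<rho> (g \<circ> t))) = 0" if g: "g permutes {1..n}" for g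
  proof -
    have "(\<Sum>t\<in>T. mat_trace (\<rho> (g \<otimes>\<^bsub>?G\<^esub> t))) = 0"
    proof (rule class_sum_vanishes[OF irr G.is_group TG finT])
      fix h t assume h: "h \<in> carrier ?G" and "t \<in> T"
      then obtain i j where ij: "t = transpose i j" "i \<in> {1..n}" "j \<in> {1..n}" "i \<noteq> j" by (auto simp: T_def)
      have hp: "h permutes {1..n}" using h by (simp add: sym_group_carrier)
      have bij: "bij h" using hp by (rule permutes_bij)
      have "transpose (h i) (h j) \<circ> h = h \<circ> transpose i j"
        using transpose_comp_eq[OF bij] bij by (simp add: bij_is_inj)
      then have "h \<circ> transpose i j \<circ> inv' h = transpose (h i) (h j)"
        using permutes_inv_o(1)[OF hp] by (metis comp_assoc comp_id)
      moreover have "h i \<in> {1..n}" "h j \<in> {1..n}" "h i \<noteq> h j"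
        using hp ij permutes_in_image[OF hp] bij by (auto simp: bij_def inj_eq simp del: atLeastAtMost_iff)
      ultimately show "h \<otimes>\<^bsub>?G\<^esub> t \<otimes>\<^bsub>?G\<^esub> inv\<^bsub>?G\<^esub> h \<in> T"
        using h ij(1) unfolding T_def by (auto simp: sym_group_mult)
    qed (use zT g in \<open>simp_all add: sym_group_carrier\<close>)
    then show ?thesis by (simp add: sym_group_mult)
  qed
  have "(\<Sum>i\<in>{1..n}. \<Sum>j\<in>{1..n} - {i}. \<Phi> (cycle_type n (g \<circ> transpose i j))) = 0"
    if g: "g permutes {1..n}" for g
  proof -
    have fib: "{x \<in> P. (\<lambda>(i, j). transpose i j) x = transpose a b} = {(a, b), (b, a)}"
      if ab: "a \<in> {1..n}" "b \<in> {1..n}" "a \<noteq> b" for a b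
    proof -
      have "(i = a \<and> j = b) \<or> (i = b \<and> j = a)" if "transpose i j = transpose a b" "i \<noteq> j" for i j
        using that ab(3) by (metis transpose_apply_first transpose_apply_other transpose_apply_second)
      then show ?thesis using ab by (auto simp: P_def transpose_commute)
    qed
    have "(\<Sum>i\<in>{1..n}. \<Sum>j\<in>{1..n} - {i}. \<Phi> (cycle_type n (g \<circ> transpose i j)))
        = (\<Sum>i\<in>{1..n}. \<Sum>j\<in>{1..n} - {i}. mat_trace (\<rho> (g \<circ> transpose i j)))"
      by (intro sum.cong refl \<Phi>[symmetric] permutes_compose permutes_swap_id g) auto
    also have "\<dots> = (\<Sum>(i, j)\<in>P. mat_trace (\<rho> (g \<circ> transpose i j)))"
      by (subst sum.Sigma) (auto intro!: sum.cong simp: P_def)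
    also have "\<dots> = (\<Sum>x\<in>P. mat_trace (\<rho> (g \<circ> (\<lambda>(i, j). transpose i j) x)))"
      by (intro sum.cong) auto
    also have "\<dots> = (\<Sum>t\<in>T. \<Sum>x\<in>{x \<in> P. (\<lambda>(i, j). transpose i j) x = t}.
        mat_trace (\<rho> (g \<circ> (\<lambda>(i, j). transpose i j) x)))"
      unfolding TP by (rule sum.image_gen[OF finP])
    also have "\<dots> = (\<Sum>t\<in>T. 2 * mat_trace (\<rho> (g \<circ> t)))"
    proof (rule sum.cong[OF refl])
      fix t assume "t \<in> T"
      then obtain a b where ab: "t = transpose a b" "a \<in> {1..n}" "b \<in> {1..n}" "a \<noteq> b" by (auto simp: T_def)
      show "(\<Sum>x\<in>{x \<in> P. (\<lambda>(i, j). transpose i j) x = t}.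
        mat_trace (\<rho> (g \<circ> (\<lambda>(i, j). transpose i j) x))) = 2 * mat_trace (\<rho> (g \<circ> t))"
        unfolding ab(1) fib[OF ab(2-4)] using ab(4) by (simp add: transpose_commute[of b a])
    qed
    also have "\<dots> = 0" using sumT[OF g] by (simp add: sum_distrib_left[symmetric])
    finally show ?thesis .
  qed
  note zero = this
  show ?thesis
  proof (rule that)
    show "mat_trace (\<rho> g) = \<Phi> (cycle_type n g)" if "g permutes {1..n}" for g using that by (rule \<Phi>)
    show "\<Phi> \<tau> = 0" if "r \<in># \<tau>" "even r" for \<tau> r using that by (rule even)
    show "(\<Sum>d\<in>{1..<m}. \<Phi> (\<gamma> + {#d, m - d#}))
       + 2 * (\<Sum>r\<in>#\<gamma>. of_nat r * \<Phi> (\<gamma> - {#r#} + {#m + r#})) = 0"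
      if g: "g permutes {1..n}" and ct: "cycle_type n g = add_mset m \<gamma>" and m: "even m" for g m \<gamma>
      using g even zero[OF g] ct m by (rule transposition_sum_cycle_type)
  qed
qed

section \<open>The numerator polynomials\<close>

text \<open>The recursion for \<open>\<phi> = \<psi> / \<psi> 1\<close>, solved for the type with first part \<open>h\<close> and multiplied by
  \<open>\<Prod>j<s. 2 * (x - j)\<close>, where \<open>s\<close> is the sum of the list. With \<open>m = h - 1\<close> the first sum comes from cutting the
  cycle of length \<open>m\<close>, the second from joining it to a cycle of length \<open>l ! i\<close>. A part \<open>1\<close> does not change
  \<open>\<phi>\<close> and contributes its linear factor.\<close>

function character_poly :: "nat list \<Rightarrow> int poly" where
  "character_poly [] = 1"
| "character_poly (h # l) =
    (if h = 1 then [:- 2 * int (sum_list l), 2:] * character_poly l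
     else if even h then 0
     else - (\<Sum>d\<in>{1..<h - 1}. character_poly (d # (h - 1 - d) # l))
          - 2 * (\<Sum>i\<in>{..<length l}. of_nat (l ! i) *
                  character_poly ((h - 1 + l ! i) # take i l @ drop (Suc i) l)))"
  by pat_completeness auto

lemma sum_list_remove_nth:
  "i < length l \<Longrightarrow> l ! i + sum_list (take i l @ drop (Suc i) l) = (sum_list l :: nat)"
  by (subst (3) id_take_nth_drop[of i l]) auto

termination
proof (relation "measure sum_list", goal_cases)
  case (3 h l d)
  then have "0 < h" by (simp add: odd_pos)
  then show ?case using 3 by auto
next
  case (4 h l i)
  then have "0 < h" by (simp add: odd_pos)
  then show ?case using 4 sum_list_remove_nth[of i l] by simp
qed simp_all

declare character_poly.simps(2) [simp del]

lemma degree_character_poly: "degree (character_poly l) \<le> sum_list l"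
proof (induction l rule: character_poly.induct)
  case (2 h l)
  consider "h = 1" | "h \<noteq> 1" "even h" | "h \<noteq> 1" "odd h" by blast
  then show ?case
  proof cases
    case 1
    have "degree ([:- 2 * int (sum_list l), 2:] * character_poly l) \<le> 1 + degree (character_poly l)"
      using degree_mult_le[of "[:- 2 * int (sum_list l), 2:]" "character_poly l"] by simp
    then show ?thesis using 1 2(1) by (simp add: character_poly.simps(2))
  next
    case 2
    then show ?thesis by (simp add: character_poly.simps(2))
  next
    case False: 3
    have "degree (\<Sum>d\<in>{1..<h - 1}. character_poly (d # (h - 1 - d) # l)) \<le> sum_list (h # l)"
    proof (rule degree_sum_le)
      fix d assume d: "d \<in> {1..<h - 1}"
      then show "degree (character_poly (d # (h - 1 - d) # l)) \<le> sum_list (h # l)"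
        using 2(2)[of d] False by auto
    qed simp
    moreover have "degree (\<Sum>i\<in>{..<length l}. of_nat (l ! i) *
        character_poly ((h - 1 + l ! i) # take i l @ drop (Suc i) l)) \<le> sum_list (h # l)"
    proof (rule degree_sum_le)
      fix i assume i: "i \<in> {..<length l}"
      have "degree (of_nat (l ! i) * character_poly ((h - 1 + l ! i) # take i l @ drop (Suc i) l))
        \<le> degree (character_poly ((h - 1 + l ! i) # take i l @ drop (Suc i) l))"
        by (simp add: of_nat_poly)
      also have "\<dots> \<le> sum_list ((h - 1 + l ! i) # take i l @ drop (Suc i) l)"
        using 2(3)[of i] False i by auto
      also have "\<dots> \<le> sum_list (h # l)" using sum_list_remove_nth[of i l] i by auto
      finally show "degree (of_nat (l ! i) * character_poly ((h - 1 + l ! i) # take i l @ drop (Suc i) l))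
        \<le> sum_list (h # l)" .
    qed simp
    ultimately have "degree (- (\<Sum>d\<in>{1..<h - 1}. character_poly (d # (h - 1 - d) # l))
       - ((\<Sum>i\<in>{..<length l}. of_nat (l ! i) * character_poly ((h - 1 + l ! i) # take i l @ drop (Suc i) l))
        + (\<Sum>i\<in>{..<length l}. of_nat (l ! i) * character_poly ((h - 1 + l ! i) # take i l @ drop (Suc i) l))))
       \<le> sum_list (h # l)"
      by (intro degree_diff_le degree_add_le) (simp_all only: degree_minus)
    then show ?thesis using False by (subst character_poly.simps(2)) (simp only: mult_2 if_False)
  qed
qed simp

lemma poly_of_nat_eval: "poly (of_nat k :: 'a::comm_semiring_1 poly) x = of_nat k"
  by (simp add: of_nat_poly)

lemma sum_list_nth_eq_sum_mset: "(\<Sum>i\<in>{..<length l}. F (l ! i)) = (\<Sum>r\<in>#mset l. (F r :: 'a::comm_monoid_add))"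
proof -
  have "(\<Sum>i\<in>{..<length l}. F (l ! i)) = sum_list (map F l)"
    by (simp add: sum_list_sum_nth atLeast0LessThan)
  also have "\<dots> = sum_mset (image_mset F (mset l))" by (induction l) simp_all
  finally show ?thesis .
qed

text \<open>Lists stand for types with
  \<open>n - sum_list l\<close> further fixed points. In the odd case the parts \<open>1\<close> of \<open>\<gamma>\<close> that are
  fixed points contribute \<open>n - s\<close> equal terms, which is the factor \<open>2 * (n - s)\<close> by which consecutive
  denominators differ.\<close>

theorem character_poly_value:
  fixes \<Phi> :: "nat multiset \<Rightarrow> complex"
  assumes even: "\<And>\<tau> r. r \<in># \<tau> \<Longrightarrow> even r \<Longrightarrow> \<Phi> \<tau> = 0"
    and recur: "\<And>m \<gamma>. partition_of n (add_mset m \<gamma>) \<Longrightarrow> even m \<Longrightarrow>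
      (\<Sum>d\<in>{1..<m}. \<Phi> (\<gamma> + {#d, m - d#}))
       + 2 * (\<Sum>r\<in>#\<gamma>. of_nat r * \<Phi> (\<gamma> - {#r#} + {#m + r#})) = 0"
    and l: "0 \<notin> set l" "sum_list l \<le> n"
  shows "of_int (poly (character_poly l) (int n)) * \<Phi> (replicate_mset n 1)
       = (\<Prod>j<sum_list l. 2 * (of_nat n - of_nat j)) * \<Phi> (mset l + replicate_mset (n - sum_list l) 1)"
  using l
proof (induction l rule: character_poly.induct)
  case (2 h l)
  define ff :: "nat \<Rightarrow> complex" where "ff s = (\<Prod>j<s. 2 * (of_nat n - of_nat j))" for s
  define Q where "Q l = of_int (poly (character_poly l) (int n)) * \<Phi> (replicate_mset n 1)" for l
  have Suc_ff: "ff (Suc s) = ff s * (2 * (of_nat n - of_nat s))" for s by (simp add: ff_def)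
  have h0: "h \<noteq> 0" using 2 by auto
  consider "h = 1" | "h \<noteq> 1" "even h" | "h \<noteq> 1" "odd h" by blast
  then have "Q (h # l) = ff (sum_list (h # l)) * \<Phi> (mset (h # l) + replicate_mset (n - sum_list (h # l)) 1)"
  proof cases
    case 1
    have "Suc (n - sum_list (h # l)) = n - sum_list l" using 2 1 by simp
    then have ms: "mset (h # l) + replicate_mset (n - sum_list (h # l)) 1 = mset l + replicate_mset (n - sum_list l) 1"
      using 1 by (metis mset.simps(2) replicate_mset_Suc union_mset_add_mset_left union_mset_add_mset_right)
    have "Q (h # l) = 2 * (of_nat n - of_nat (sum_list l)) * Q l"
      using 1 by (simp add: Q_def character_poly.simps(2) algebra_simps)
    also have "Q l = ff (sum_list l) * \<Phi> (mset l + replicate_mset (n - sum_list l) 1)"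
      using 2 1 by (simp add: Q_def ff_def)
    finally show ?thesis unfolding ms using 1 by (simp add: Suc_ff)
  next
    case 2
    then have "\<Phi> (mset (h # l) + replicate_mset (n - sum_list (h # l)) 1) = 0" by (intro even[of h]) auto
    then show ?thesis using 2 by (simp add: Q_def character_poly.simps(2))
  next
    case 3
    define m where "m = h - 1"
    define s where "s = m + sum_list l"
    have h: "h = Suc m" and m: "even m" "2 \<le> m" using 3 h0 by (auto simp: m_def elim: oddE)
    have s: "sum_list (h # l) = Suc s" "s < n" using 2 by (simp_all add: h s_def)
    \<comment> \<open>The other parts when \<open>h\<close> is shortened to the even length \<open>m\<close> and one more point is fixed.\<close>
    define \<gamma> where "\<gamma> = mset l + replicate_mset (n - s) 1"
    have ns: "n - s = Suc (n - Suc s)" using s by simp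
    have part: "partition_of n (add_mset m \<gamma>)"
      using 2 s m by (auto simp: partition_of_def \<gamma>_def s_def sum_mset_sum_list)
    have IH1: "Q (d # (m - d) # l) = ff s * \<Phi> (\<gamma> + {#d, m - d#})" if d: "d \<in> {1..<m}" for d
    proof -
      have "sum_list (d # (h - 1 - d) # l) = s" using d by (auto simp: h s_def)
      moreover have "0 \<notin> set (d # (h - 1 - d) # l)" using d 2 by (auto simp: h)
      ultimately have "Q (d # (m - d) # l) = ff s * \<Phi> (mset (d # (m - d) # l) + replicate_mset (n - s) 1)"
        using "2.IH"(2)[of d] 3 d s unfolding Q_def ff_def m_def by simp
      then show ?thesis by (simp add: \<gamma>_def)
    qed
    have IH2: "Q ((m + l ! i) # take i l @ drop (Suc i) l) = ff s * \<Phi> (\<gamma> - {#l ! i#} + {#m + l ! i#})"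
      if i: "i \<in> {..<length l}" for i
    proof -
      let ?l = "(h - 1 + l ! i) # take i l @ drop (Suc i) l"
      have il: "i < length l" using i by simp
      have "sum_list ?l = s" using sum_list_remove_nth[OF il] by (simp add: h s_def)
      moreover have "0 \<notin> set ?l"
        using 2 m by (auto simp: h dest: in_set_takeD in_set_dropD)
      ultimately have "Q ?l = ff s * \<Phi> (mset ?l + replicate_mset (n - s) 1)"
        using "2.IH"(3)[of i] 3 i s unfolding Q_def ff_def by simp
      moreover have "mset l = add_mset (l ! i) (mset (take i l @ drop (Suc i) l))"
        by (subst id_take_nth_drop[OF il]) simp
      ultimately show ?thesis by (simp add: \<gamma>_def m_def)
    qed
    have "Q (h # l) = - (\<Sum>d\<in>{1..<m}. Q (d # (m - d) # l))
        - 2 * (\<Sum>i\<in>{..<length l}. of_nat (l ! i) * Q ((m + l ! i) # take i l @ drop (Suc i) l))"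
    proof -
      have "character_poly (h # l) = - (\<Sum>d\<in>{1..<m}. character_poly (d # (m - d) # l))
        - 2 * (\<Sum>i\<in>{..<length l}. of_nat (l ! i) * character_poly ((m + l ! i) # take i l @ drop (Suc i) l))"
        using 3 by (subst character_poly.simps(2)) (simp only: m_def if_False)
      then show ?thesis
        unfolding Q_def
        by (simp add: poly_sum poly_of_nat_eval left_diff_distrib sum_distrib_right mult.assoc)
    qed
    also have "\<dots> = - (\<Sum>d\<in>{1..<m}. ff s * \<Phi> (\<gamma> + {#d, m - d#}))
        - 2 * (\<Sum>i\<in>{..<length l}. of_nat (l ! i) * (ff s * \<Phi> (\<gamma> - {#l ! i#} + {#m + l ! i#})))"
      using IH1 IH2 by simp
    also have "\<dots> = - ff s * ((\<Sum>d\<in>{1..<m}. \<Phi> (\<gamma> + {#d, m - d#}))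
        + 2 * (\<Sum>r\<in>#mset l. of_nat r * \<Phi> (\<gamma> - {#r#} + {#m + r#})))"
    proof -
      have E1: "(\<Sum>i\<in>{..<length l}. of_nat (l ! i) * (ff s * \<Phi> (\<gamma> - {#l ! i#} + {#m + l ! i#})))
        = ff s * (\<Sum>i\<in>{..<length l}. of_nat (l ! i) * \<Phi> (\<gamma> - {#l ! i#} + {#m + l ! i#}))"
        unfolding sum_distrib_left by (intro sum.cong refl mult.left_commute)
      have E2: "- (c * a) - 2 * (c * b) = - c * (a + 2 * b)" for a b c :: complex
        by (simp add: algebra_simps)
      show ?thesis
        unfolding E1 sum_distrib_left[symmetric]
          sum_list_nth_eq_sum_mset[of "\<lambda>r. of_nat r * \<Phi> (\<gamma> - {#r#} + {#m + r#})" l] by (rule E2)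
    qed
    also have "\<dots> = ff s * (2 * (of_nat (n - s) * \<Phi> (add_mset h (mset l + replicate_mset (n - Suc s) 1))))"
    proof -
      have one: "\<gamma> - {#1#} + {#m + 1#} = add_mset h (mset l + replicate_mset (n - Suc s) 1)"
        unfolding \<gamma>_def ns by (simp add: h)
      have "(\<Sum>r\<in>#replicate_mset k 1. of_nat r * \<Phi> (\<gamma> - {#r#} + {#m + r#})) = of_nat k * \<Phi> (\<gamma> - {#1#} + {#m + 1#})" for k
        by (induction k) (simp_all add: algebra_simps)
      moreover have split: "(\<Sum>r\<in>#\<gamma>. G r) = (\<Sum>r\<in>#mset l. G r) + (\<Sum>r\<in>#replicate_mset (n - s) 1. G r)"
        for G :: "nat \<Rightarrow> complex" by (simp add: \<gamma>_def)
      ultimately have "(\<Sum>r\<in>#\<gamma>. of_nat r * \<Phi> (\<gamma> - {#r#} + {#m + r#}))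
          = (\<Sum>r\<in>#mset l. of_nat r * \<Phi> (\<gamma> - {#r#} + {#m + r#}))
          + of_nat (n - s) * \<Phi> (add_mset h (mset l + replicate_mset (n - Suc s) 1))"
        unfolding one[symmetric] split[of "\<lambda>r. of_nat r * \<Phi> (\<gamma> - {#r#} + {#m + r#})"] by (simp only:)
      then have "(\<Sum>d\<in>{1..<m}. \<Phi> (\<gamma> + {#d, m - d#})) + 2 * (\<Sum>r\<in>#mset l. of_nat r * \<Phi> (\<gamma> - {#r#} + {#m + r#}))
          = - (2 * (of_nat (n - s) * \<Phi> (add_mset h (mset l + replicate_mset (n - Suc s) 1))))"
        using recur[OF part m(1)] by (simp add: algebra_simps eq_neg_iff_add_eq_0)
      then show ?thesis by simp
    qed
    also have "\<dots> = ff (sum_list (h # l)) * \<Phi> (mset (h # l) + replicate_mset (n - sum_list (h # l)) 1)"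
      unfolding s(1) Suc_ff using s(2) by (simp add: of_nat_diff)
    finally show ?thesis .
  qed
  then show ?case by (simp only: Q_def ff_def)
qed simp

section \<open>Computable functions\<close>

text \<open>Membership in the inductive class \<open>recursive\<close> is a property of a function on lists of all lengths.
  Relaxing it to agreement on lists of the relevant length gives closure properties without side
  conditions.\<close>

definition rec_fn :: "nat \<Rightarrow> (nat list \<Rightarrow> nat) \<Rightarrow> bool" where
  "rec_fn n h \<longleftrightarrow> (\<exists>f. recursive n f \<and> (\<forall>xs. length xs = n \<longrightarrow> f xs = h xs))"

lemma rec_fnI: "recursive n f \<Longrightarrow> (\<And>xs. length xs = n \<Longrightarrow> f xs = h xs) \<Longrightarrow> rec_fn n h"
  by (auto simp: rec_fn_def)

lemma computable_iff_rec_fn: "computable h \<longleftrightarrow> rec_fn 1 (\<lambda>xs. h (xs ! 0))"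
  unfolding computable_def rec_fn_def by (auto simp: length_Suc_conv)

lemma rec_fn_proj: "i < n \<Longrightarrow> rec_fn n (\<lambda>xs. xs ! i)"
  by (rule rec_fnI, rule recursive.proj) auto

lemma rec_fn_zero: "rec_fn n (\<lambda>xs. 0)"
  by (rule rec_fnI, rule recursive.zero) auto

lemma rec_fn_comp1:
  assumes "rec_fn 1 f" "rec_fn n g"
  shows "rec_fn n (\<lambda>xs. f [g xs])"
proof -
  obtain f' g' where f': "recursive 1 f'" "\<And>xs. length xs = 1 \<Longrightarrow> f' xs = f xs"
    and g': "recursive n g'" "\<And>xs. length xs = n \<Longrightarrow> g' xs = g xs"
    using assms by (auto simp: rec_fn_def)
  show ?thesis
  proof (rule rec_fnI)
    show "recursive n (\<lambda>xs. f' (map (\<lambda>g. g xs) [g']))"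
      using f'(1) g'(1) by (intro recursive.comp) auto
  qed (simp add: f' g')
qed

lemma rec_fn_comp2:
  assumes "rec_fn 2 f" "rec_fn n g" "rec_fn n h"
  shows "rec_fn n (\<lambda>xs. f [g xs, h xs])"
proof -
  obtain f' g' h' where f': "recursive 2 f'" "\<And>xs. length xs = 2 \<Longrightarrow> f' xs = f xs"
    and g': "recursive n g'" "\<And>xs. length xs = n \<Longrightarrow> g' xs = g xs"
    and h': "recursive n h'" "\<And>xs. length xs = n \<Longrightarrow> h' xs = h xs"
    using assms by (auto simp: rec_fn_def)
  show ?thesis
  proof (rule rec_fnI)
    show "recursive n (\<lambda>xs. f' (map (\<lambda>g. g xs) [g', h']))"
      using f'(1) g'(1) h'(1) by (intro recursive.comp) (auto simp: numeral_2_eq_2)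
  qed (simp add: f' g' h')
qed

lemma rec_fn_Suc: "rec_fn n f \<Longrightarrow> rec_fn n (\<lambda>xs. Suc (f xs))"
  using rec_fn_comp1[of "\<lambda>xs. Suc (xs ! 0)" n f] recursive.succ rec_fnI[of 1] by fastforce

lemma rec_fn_const: "rec_fn n (\<lambda>xs. c)"
  by (induction c) (auto intro: rec_fn_zero rec_fn_Suc)

text \<open>Primitive recursion whose bound is an arbitrary function of the parameters. The Kleene scheme takes the bound as an
  additional first argument, which is then substituted.\<close>

lemma rec_fn_prim_rec:
  assumes f: "rec_fn (Suc n) f" and g: "rec_fn (Suc (Suc (Suc n))) g" and h: "rec_fn (Suc n) h"
  shows "rec_fn (Suc n) (\<lambda>xs. rec_nat (f xs) (\<lambda>y r. g (y # r # xs)) (h xs))"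
proof -
  obtain f' g' h' where f': "recursive (Suc n) f'" "\<And>xs. length xs = Suc n \<Longrightarrow> f' xs = f xs"
    and g': "recursive (Suc (Suc (Suc n))) g'" "\<And>xs. length xs = Suc (Suc (Suc n)) \<Longrightarrow> g' xs = g xs"
    and h': "recursive (Suc n) h'" "\<And>xs. length xs = Suc n \<Longrightarrow> h' xs = h xs"
    using assms by (auto simp: rec_fn_def)
  define p where "p xs = rec_nat (f' (tl xs)) (\<lambda>y r. g' (y # r # tl xs)) (hd xs)" for xs
  have p: "recursive (Suc (Suc n)) p"
    unfolding p_def by (rule recursive.prim_rec[OF f'(1) g'(1)])
  define gs where "gs = h' # map (\<lambda>i xs. xs ! i) [0..<Suc n]"
  have "length gs = Suc (Suc n)" by (simp add: gs_def)
  then have "recursive (length gs) p" using p by (simp only:)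
  moreover have "\<forall>g\<in>set gs. recursive (Suc n) g"
    using h' unfolding gs_def by (auto intro: recursive.proj)
  ultimately have "recursive (Suc n) (\<lambda>xs. p (map (\<lambda>g. g xs) gs))"
    by (rule recursive.comp)
  moreover have "p (map (\<lambda>g. g xs) gs) = rec_nat (f xs) (\<lambda>y r. g (y # r # xs)) (h xs)"
    if xs: "length xs = Suc n" for xs
  proof -
    have "map (\<lambda>g. g xs) gs = h xs # map (\<lambda>i. xs ! i) [0..<Suc n]"
      using h' xs by (simp add: gs_def del: upt_Suc)
    also have "map (\<lambda>i. xs ! i) [0..<Suc n] = xs" using xs map_nth[of xs] by simp
    finally show ?thesis using xs f' g' by (simp add: p_def)
  qed
  ultimately show ?thesis by (rule rec_fnI)
qed

lemma rec_fn_least: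
  assumes f: "rec_fn (Suc n) f" and ex: "\<And>xs. length xs = n \<Longrightarrow> \<exists>y. f (y # xs) = 0"
  shows "rec_fn n (\<lambda>xs. LEAST y. f (y # xs) = 0)"
proof -
  obtain f' where f': "recursive (Suc n) f'" "\<And>xs. length xs = Suc n \<Longrightarrow> f' xs = f xs"
    using f by (auto simp: rec_fn_def)
  show ?thesis
  proof (rule rec_fnI)
    show "recursive n (\<lambda>xs. LEAST y. f' (y # xs) = 0)"
      using ex f'(2) by (intro recursive.minimise[OF f'(1)]) auto
  qed (simp add: f'(2))
qed

lemma rec_fn_cong: "rec_fn n f \<Longrightarrow> (\<And>xs. length xs = n \<Longrightarrow> f xs = g xs) \<Longrightarrow> rec_fn n g"
  by (auto simp: rec_fn_def)

lemma rec_fn_add: "rec_fn n f \<Longrightarrow> rec_fn n g \<Longrightarrow> rec_fn n (\<lambda>xs. f xs + g xs)"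
proof -
  have "rec_fn 2 (\<lambda>xs. rec_nat (xs ! 0) (\<lambda>y r. (\<lambda>zs. Suc (zs ! 1)) (y # r # xs)) (xs ! 1))"
    unfolding numeral_2_eq_2 by (intro rec_fn_prim_rec rec_fn_Suc rec_fn_proj) auto
  moreover have "rec_nat a (\<lambda>y r. Suc r) b = a + b" for a b :: nat by (induction b) auto
  ultimately have "rec_fn 2 (\<lambda>xs. xs ! 0 + xs ! 1)" by simp
  then show "rec_fn n f \<Longrightarrow> rec_fn n g \<Longrightarrow> rec_fn n (\<lambda>xs. f xs + g xs)"
    using rec_fn_comp2[of "\<lambda>xs. xs ! 0 + xs ! 1" n f g] by simp
qed

lemma rec_fn_diff: "rec_fn n f \<Longrightarrow> rec_fn n g \<Longrightarrow> rec_fn n (\<lambda>xs. f xs - g xs)"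
proof -
  have "rec_fn 1 (\<lambda>xs. rec_nat 0 (\<lambda>y r. (\<lambda>zs. zs ! 0) (y # r # xs)) (xs ! 0))"
    unfolding One_nat_def by (intro rec_fn_prim_rec rec_fn_zero rec_fn_proj) auto
  moreover have "rec_nat 0 (\<lambda>y r. y) b = b - 1" for b :: nat by (cases b) auto
  ultimately have pred: "rec_fn 1 (\<lambda>xs. xs ! 0 - 1)" by simp
  have "rec_fn 2 (\<lambda>xs. rec_nat (xs ! 0) (\<lambda>y r. (\<lambda>zs. (\<lambda>us. us ! 0 - 1) [zs ! 1]) (y # r # xs)) (xs ! 1))"
    unfolding numeral_2_eq_2 by (intro rec_fn_prim_rec rec_fn_comp1[OF pred] rec_fn_proj) auto
  moreover have "rec_nat a (\<lambda>y r. r - 1) b = a - b" for a b :: nat by (induction b) auto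
  ultimately have "rec_fn 2 (\<lambda>xs. xs ! 0 - xs ! 1)" by simp
  then show "rec_fn n f \<Longrightarrow> rec_fn n g \<Longrightarrow> rec_fn n (\<lambda>xs. f xs - g xs)"
    using rec_fn_comp2[of "\<lambda>xs. xs ! 0 - xs ! 1" n f g] by simp
qed

lemma rec_fn_mult: "rec_fn n f \<Longrightarrow> rec_fn n g \<Longrightarrow> rec_fn n (\<lambda>xs. f xs * g xs)"
proof -
  have "rec_fn 2 (\<lambda>xs. rec_nat 0 (\<lambda>y r. (\<lambda>zs. zs ! 1 + zs ! 2) (y # r # xs)) (xs ! 1))"
    unfolding numeral_2_eq_2 by (intro rec_fn_prim_rec rec_fn_add rec_fn_zero rec_fn_proj) auto
  moreover have "rec_nat 0 (\<lambda>y r. r + a) b = a * b" for a b :: nat by (induction b) auto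
  ultimately have "rec_fn 2 (\<lambda>xs. xs ! 0 * xs ! 1)" by simp
  then show "rec_fn n f \<Longrightarrow> rec_fn n g \<Longrightarrow> rec_fn n (\<lambda>xs. f xs * g xs)"
    using rec_fn_comp2[of "\<lambda>xs. xs ! 0 * xs ! 1" n f g] by simp
qed

lemma rec_fn_triangle: "rec_fn n f \<Longrightarrow> rec_fn n (\<lambda>xs. triangle (f xs))"
proof -
  have "rec_fn 1 (\<lambda>xs. rec_nat 0 (\<lambda>y r. (\<lambda>zs. zs ! 1 + Suc (zs ! 0)) (y # r # xs)) (xs ! 0))"
    unfolding One_nat_def by (intro rec_fn_prim_rec rec_fn_zero rec_fn_add rec_fn_Suc rec_fn_proj) auto
  moreover have "rec_nat 0 (\<lambda>y r. r + Suc y) b = triangle b" for b :: nat by (induction b) auto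
  ultimately have "rec_fn 1 (\<lambda>xs. triangle (xs ! 0))" by simp
  then show "rec_fn n f \<Longrightarrow> rec_fn n (\<lambda>xs. triangle (f xs))"
    using rec_fn_comp1[of "\<lambda>xs. triangle (xs ! 0)" n f] by simp
qed

definition pfst :: "nat \<Rightarrow> nat" where "pfst z = fst (prod_decode z)"
definition psnd :: "nat \<Rightarrow> nat" where "psnd z = snd (prod_decode z)"

lemma pfst_pair [simp]: "pfst (prod_encode (x, y)) = x"
  and psnd_pair [simp]: "psnd (prod_encode (x, y)) = y"
  by (simp_all add: pfst_def psnd_def)

lemma pair_eta [simp]: "prod_encode (pfst z, psnd z) = z"
  by (simp add: pfst_def psnd_def)

lemma rec_fn_pair: "rec_fn n f \<Longrightarrow> rec_fn n g \<Longrightarrow> rec_fn n (\<lambda>xs. prod_encode (f xs, g xs))"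
  unfolding prod_encode_def by (simp add: rec_fn_add rec_fn_triangle)

text \<open>Both projections are arithmetic functions of the code and of the diagonal on which it lies; minimisation
  finds the diagonal.\<close>

lemma pair_diagonal: "(LEAST s. Suc z - triangle (Suc s) = 0) = pfst z + psnd z"
proof -
  define a b where "a = pfst z" and "b = psnd z"
  have z: "z = triangle (a + b) + a"
    using pair_eta[of z] by (simp add: prod_encode_def a_def b_def)
  have mono: "triangle s \<le> triangle t" if "s \<le> t" for s t
    using that by (induction rule: dec_induct) auto
  show ?thesis unfolding a_def[symmetric] b_def[symmetric]
  proof (rule Least_equality)
    show "Suc z - triangle (Suc (a + b)) = 0" by (simp add: z)
    fix s assume "Suc z - triangle (Suc s) = 0"
    then have "Suc z \<le> triangle (Suc s)" by simp
    then show "a + b \<le> s" using mono[of "Suc s" "a + b"] z by (intro leI notI) linarith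
  qed
qed

lemma rec_fn_pfst: "rec_fn n f \<Longrightarrow> rec_fn n (\<lambda>xs. pfst (f xs))"
  and rec_fn_psnd: "rec_fn n f \<Longrightarrow> rec_fn n (\<lambda>xs. psnd (f xs))"
proof -
  have "rec_fn 1 (\<lambda>xs. LEAST s. (\<lambda>zs. Suc (zs ! 1) - triangle (Suc (zs ! 0))) (s # xs) = 0)"
  proof (intro rec_fn_least rec_fn_diff rec_fn_Suc rec_fn_triangle rec_fn_proj)
    fix xs :: "nat list" assume "length xs = 1"
    have "xs ! 0 < triangle (Suc (xs ! 0))" by simp
    then show "\<exists>y. Suc ((y # xs) ! 1) - triangle (Suc ((y # xs) ! 0)) = 0"
      by (intro exI[of _ "xs ! 0"]) simp
  qed auto
  then have diag: "rec_fn 1 (\<lambda>xs. pfst (xs ! 0) + psnd (xs ! 0))"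
    by (rule rec_fn_cong) (simp add: pair_diagonal[symmetric])
  have eq: "z - triangle (pfst z + psnd z) = pfst z" for z
    using pair_eta[of z] by (simp add: prod_encode_def)
  have "rec_fn 1 (\<lambda>xs. xs ! 0 - triangle (pfst (xs ! 0) + psnd (xs ! 0)))"
    by (intro rec_fn_diff rec_fn_triangle diag rec_fn_proj) auto
  then have f1: "rec_fn 1 (\<lambda>xs. pfst (xs ! 0))" by (simp only: eq)
  have "rec_fn 1 (\<lambda>xs. (pfst (xs ! 0) + psnd (xs ! 0)) - pfst (xs ! 0))"
    by (intro rec_fn_diff diag f1)
  then have f2: "rec_fn 1 (\<lambda>xs. psnd (xs ! 0))" by simp
  show "rec_fn n f \<Longrightarrow> rec_fn n (\<lambda>xs. pfst (f xs))" using rec_fn_comp1[OF f1] by simp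
  show "rec_fn n f \<Longrightarrow> rec_fn n (\<lambda>xs. psnd (f xs))" using rec_fn_comp1[OF f2] by simp
qed

lemma computable_id: "computable (\<lambda>x. x)"
  and computable_const: "computable (\<lambda>x. c)"
  and computable_Suc: "computable f \<Longrightarrow> computable (\<lambda>x. Suc (f x))"
  and computable_add: "computable f \<Longrightarrow> computable g \<Longrightarrow> computable (\<lambda>x. f x + g x)"
  and computable_diff: "computable f \<Longrightarrow> computable g \<Longrightarrow> computable (\<lambda>x. f x - g x)"
  and computable_mult: "computable f \<Longrightarrow> computable g \<Longrightarrow> computable (\<lambda>x. f x * g x)"
  and computable_pair: "computable f \<Longrightarrow> computable g \<Longrightarrow> computable (\<lambda>x. prod_encode (f x, g x))"
  and computable_pfst: "computable f \<Longrightarrow> computable (\<lambda>x. pfst (f x))"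
  and computable_psnd: "computable f \<Longrightarrow> computable (\<lambda>x. psnd (f x))"
  by (simp_all add: computable_iff_rec_fn rec_fn_proj rec_fn_const rec_fn_Suc rec_fn_add rec_fn_diff
      rec_fn_mult rec_fn_pair rec_fn_pfst rec_fn_psnd)

lemma computable_app: "computable f \<Longrightarrow> computable g \<Longrightarrow> computable (\<lambda>x. f (g x))"
  unfolding computable_iff_rec_fn using rec_fn_comp1[of "\<lambda>xs. f (xs ! 0)" 1 "\<lambda>xs. g (xs ! 0)"] by simp

text \<open>Several arguments are packed into one by pairing. The step function is curried in the conclusion
  so that the rule matches an ordinary \<open>rec_nat\<close> term.\<close>

lemma computable_rec_nat:
  assumes f: "computable f" and g: "computable (\<lambda>p. g (pfst p) (pfst (psnd p)) (psnd (psnd p)))"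
    and h: "computable h"
  shows "computable (\<lambda>x. rec_nat (f x) (\<lambda>y r. g y r x) (h x))"
proof -
  let ?G = "\<lambda>p. g (pfst p) (pfst (psnd p)) (psnd (psnd p))"
  have "rec_fn 3 (\<lambda>zs. (\<lambda>us. ?G (us ! 0)) [prod_encode (zs ! 0, prod_encode (zs ! 1, zs ! 2))])"
    using g unfolding computable_iff_rec_fn
    by (intro rec_fn_comp1 rec_fn_pair rec_fn_proj) auto
  then have "rec_fn 3 (\<lambda>zs. g (zs ! 0) (zs ! 1) (zs ! 2))" by simp
  then have "rec_fn (Suc 0) (\<lambda>xs. rec_nat (f (xs ! 0)) (\<lambda>y r. (\<lambda>zs. g (zs ! 0) (zs ! 1) (zs ! 2)) (y # r # xs)) (h (xs ! 0)))"
    using f h unfolding computable_iff_rec_fn One_nat_def numeral_3_eq_3 by (intro rec_fn_prim_rec)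
  then show ?thesis unfolding computable_iff_rec_fn by simp
qed

lemma computable_least:
  assumes f: "computable (\<lambda>p. f (pfst p) (psnd p))" and ex: "\<And>x. \<exists>y. f y x = 0"
  shows "computable (\<lambda>x. LEAST y. f y x = 0)"
proof -
  let ?F = "\<lambda>p. f (pfst p) (psnd p)"
  have "rec_fn 2 (\<lambda>zs. (\<lambda>us. ?F (us ! 0)) [prod_encode (zs ! 0, zs ! 1)])"
    using f unfolding computable_iff_rec_fn
    by (intro rec_fn_comp1 rec_fn_pair rec_fn_proj) auto
  then have "rec_fn 2 (\<lambda>zs. f (zs ! 0) (zs ! 1))" by simp
  then have "rec_fn (Suc 0) (\<lambda>xs. LEAST y. (\<lambda>zs. f (zs ! 0) (zs ! 1)) (y # xs) = 0)"
    using ex unfolding numeral_2_eq_2 by (intro rec_fn_least) auto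
  then show ?thesis unfolding computable_iff_rec_fn by simp
qed

definition decidable :: "(nat \<Rightarrow> bool) \<Rightarrow> bool" where
  "decidable P \<longleftrightarrow> computable (\<lambda>x. of_bool (P x))"

lemma computable_if_zero:
  assumes "computable b" "computable f" "computable g"
  shows "computable (\<lambda>x. if b x = 0 then f x else g x)"
proof -
  have "computable (\<lambda>x. rec_nat (f x) (\<lambda>y r. g x) (b x))"
    using assms by (intro computable_rec_nat computable_app[OF assms(3)] computable_psnd computable_id)
  moreover have "rec_nat (f x) (\<lambda>y r. g x) (b x) = (if b x = 0 then f x else g x)" for x
    by (cases "b x") auto
  ultimately show ?thesis by simp
qed

lemma computable_if:
  assumes "decidable P" "computable f" "computable g"
  shows "computable (\<lambda>x. if P x then f x else g x)"
proof -
  have "computable (\<lambda>x. if (of_bool (P x) :: nat) = 0 then g x else f x)"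
    using computable_if_zero[OF assms(1)[unfolded decidable_def] assms(3,2)] .
  moreover have "(if (of_bool (P x) :: nat) = 0 then g x else f x) = (if P x then f x else g x)" for x
    by simp
  ultimately show ?thesis by simp
qed

lemma decidable_le: "computable f \<Longrightarrow> computable g \<Longrightarrow> decidable (\<lambda>x. f x \<le> g x)"
proof -
  assume "computable f" "computable g"
  then have "computable (\<lambda>x. if f x - g x = 0 then 1 else 0)"
    by (intro computable_if_zero computable_diff computable_const)
  then show ?thesis unfolding decidable_def by (simp add: of_bool_def)
qed

lemma decidable_conj:
  assumes "decidable P" "decidable Q" shows "decidable (\<lambda>x. P x \<and> Q x)"
proof -
  have "computable (\<lambda>x. of_bool (P x) * of_bool (Q x))"
    using assms unfolding decidable_def by (rule computable_mult)
  then show ?thesis unfolding decidable_def by (simp add: of_bool_conj)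
qed

lemma decidable_eq: "computable f \<Longrightarrow> computable g \<Longrightarrow> decidable (\<lambda>x. f x = g x)"
  using decidable_conj[OF decidable_le[of f g] decidable_le[of g f]] by (simp add: eq_iff)

lemma decidable_even: assumes "computable f" shows "decidable (\<lambda>x. even (f x))"
proof -
  have "computable (\<lambda>x. rec_nat 1 (\<lambda>y r. 1 - r) (f x))"
    using assms by (intro computable_rec_nat computable_diff computable_pfst computable_psnd
        computable_const computable_id)
  moreover have "rec_nat 1 (\<lambda>y r. 1 - r) n = (of_bool (even n) :: nat)" for n by (induction n) auto
  ultimately show ?thesis by (simp add: decidable_def)
qed

named_theorems computable_intros

lemmas [computable_intros] = computable_id computable_const computable_Suc computable_add computable_diff
  computable_mult computable_pair computable_pfst computable_psnd computable_if
  decidable_le decidable_eq decidable_conj decidable_even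

definition lcons :: "nat \<Rightarrow> nat \<Rightarrow> nat" where "lcons x c = Suc (prod_encode (x, c))"
definition lhd :: "nat \<Rightarrow> nat" where "lhd c = pfst (c - 1)"
definition ltl :: "nat \<Rightarrow> nat" where "ltl c = psnd (c - 1)"

lemma list_encode_Cons: "list_encode (x # xs) = lcons x (list_encode xs)"
  by (simp add: lcons_def)

lemma list_decode_lcons [simp]: "list_decode (lcons x c) = x # list_decode c"
  by (simp add: lcons_def)

lemma lcons_nonzero [simp]: "lcons x c \<noteq> 0" and lhd_lcons [simp]: "lhd (lcons x c) = x"
  and ltl_lcons [simp]: "ltl (lcons x c) = c"
  by (simp_all add: lcons_def lhd_def ltl_def)

lemma list_code_cases: obtains "c = 0" | x d where "c = lcons x d"
proof (cases c)
  case (Suc m)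
  then have "c = lcons (pfst m) (psnd m)" by (simp add: lcons_def)
  then show ?thesis using that by blast
qed (use that in auto)

lemma length_le_list_encode: "length xs \<le> list_encode xs"
proof (induction xs)
  case (Cons x xs)
  have "list_encode xs \<le> prod_encode (x, list_encode xs)" by (rule le_prod_encode_2)
  then show ?case using Cons by simp
qed simp

lemma computable_lcons [computable_intros]:
    "computable f \<Longrightarrow> computable g \<Longrightarrow> computable (\<lambda>x. lcons (f x) (g x))"
  and computable_lhd [computable_intros]: "computable f \<Longrightarrow> computable (\<lambda>x. lhd (f x))"
  and computable_ltl [computable_intros]: "computable f \<Longrightarrow> computable (\<lambda>x. ltl (f x))"
  unfolding lcons_def lhd_def ltl_def by (intro computable_intros; assumption)+

text \<open>The state is a pair of accumulator and remaining list. Since the length of a list is at most its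
  code, iterating as often as the code says consumes the whole list.\<close>

lemma computable_fold:
  assumes a: "computable a" and c: "computable c"
    and s: "computable (\<lambda>p. s (pfst p) (pfst (psnd p)) (psnd (psnd p)))"
  shows "computable (\<lambda>x. fold (\<lambda>e r. s e r x) (list_decode (c x)) (a x))"
proof -
  define step where "step x q =
    (if psnd q = 0 then q else prod_encode (s (lhd (psnd q)) (pfst q) x, ltl (psnd q)))" for x q
  have run: "rec_nat (prod_encode (r, list_encode xs)) (\<lambda>_. step x) k
      = prod_encode (fold (\<lambda>e r. s e r x) (take k xs) r, list_encode (drop k xs))" for x r xs k
  proof (induction k)
    case (Suc k)
    show ?case
    proof (cases "k < length xs")
      case True
      then have "drop k xs = xs ! k # drop (Suc k) xs" "take (Suc k) xs = take k xs @ [xs ! k]"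
        by (simp_all add: Cons_nth_drop_Suc take_Suc_conv_app_nth)
      then show ?thesis using Suc by (simp add: step_def list_encode_Cons del: list_encode.simps)
    qed (use Suc in \<open>simp add: step_def\<close>)
  qed simp
  have "computable (\<lambda>p. s (pfst (f p)) (pfst (psnd (f p))) (psnd (psnd (f p))))" if "computable f" for f
    using computable_app[OF s that] .
  from this[of "\<lambda>q. prod_encode (lhd (psnd (pfst (psnd q))), prod_encode (pfst (pfst (psnd q)), psnd (psnd q)))"]
  have s': "computable (\<lambda>q. s (lhd (psnd (pfst (psnd q)))) (pfst (pfst (psnd q))) (psnd (psnd q)))"
    by (simp add: computable_intros)
  have "computable (\<lambda>x. pfst (rec_nat (prod_encode (a x, c x)) (\<lambda>_ q. step x q) (c x)))"
    unfolding step_def using a c s'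
    by (intro computable_intros computable_rec_nat[where g = "\<lambda>_ q x. if psnd q = 0 then q else prod_encode (s (lhd (psnd q)) (pfst q) x, ltl (psnd q))"])
  moreover have "pfst (rec_nat (prod_encode (a x, c x)) (\<lambda>_ q. step x q) (c x))
      = fold (\<lambda>e r. s e r x) (list_decode (c x)) (a x)" for x
    using run[of "a x" "list_decode (c x)" x "c x"] length_le_list_encode[of "list_decode (c x)"]
    by (simp add: list_decode_inverse)
  ultimately show ?thesis by simp
qed

text \<open>The two calls may change the argument in any way, so this is not primitive recursion. The evaluation
  keeps an accumulator and a stack of pairs \<open>(w, x)\<close>, and the invariant is that the accumulator plus the sum of
  all \<open>w * F x\<close> is the result. Popping \<open>(w, x)\<close> adds \<open>w * b x\<close> and pushes the two calls with
  their weights; calls with weight zero are dropped, so only the others have to descend along \<open>R\<close>. Minimisation finds the time at which the stack is empty.\<close>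

theorem computable_tree_recursion:
  assumes comp [computable_intros]: "computable b" "computable w1" "computable w2" "computable k1" "computable k2"
    and wf: "wf R" and R: "\<And>x. w1 x \<noteq> 0 \<Longrightarrow> (k1 x, x) \<in> R" "\<And>x. w2 x \<noteq> 0 \<Longrightarrow> (k2 x, x) \<in> R"
    and F: "\<And>x. F x = b x + w1 x * F (k1 x) + w2 x * F (k2 x)"
  shows "computable F"
proof -
  note ca = computable_app[OF comp(1)] computable_app[OF comp(2)] computable_app[OF comp(3)]
    computable_app[OF comp(4)] computable_app[OF comp(5)]
  define push where "push w x c = (if w = 0 then c else lcons (prod_encode (w, x)) c)" for w x c
  define step where "step q = (if psnd q = 0 then q else
    prod_encode (pfst q + pfst (lhd (psnd q)) * b (psnd (lhd (psnd q))),
      push (pfst (lhd (psnd q)) * w1 (psnd (lhd (psnd q)))) (k1 (psnd (lhd (psnd q))))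
        (push (pfst (lhd (psnd q)) * w2 (psnd (lhd (psnd q)))) (k2 (psnd (lhd (psnd q)))) (ltl (psnd q)))))" for q
  define run where "run t q = rec_nat q (\<lambda>_. step) t" for t q
  have run_Suc: "run (Suc t) q = run t (step q)" for t q
    by (induction t) (simp_all add: run_def)
  have run_add: "run (s + t) q = run s (run t q)" for s t q
    by (induction s) (simp_all add: run_def)
  have push_run: "\<exists>t. \<forall>acc c. run t (prod_encode (acc, push w x c)) = prod_encode (acc + w * F x, c)"
    if "w \<noteq> 0 \<Longrightarrow> \<exists>t. \<forall>acc c. run t (prod_encode (acc, lcons (prod_encode (w, x)) c)) = prod_encode (acc + w * F x, c)"
    for w x
    using that by (cases "w = 0") (auto simp: push_def run_def intro: exI[of _ 0])
  \<comment> \<open>The number of steps depends neither on the accumulator nor on the rest of the stack,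
    so the steps for the two calls can be concatenated.\<close>
  have pop: "\<exists>t. \<forall>acc c. run t (prod_encode (acc, lcons (prod_encode (w, x)) c)) = prod_encode (acc + w * F x, c)"
    for w x
    using wf
  proof (induction x arbitrary: w rule: wf_induct_rule)
    case (less x)
    obtain t1 where t1: "\<And>acc c. run t1 (prod_encode (acc, push (w * w1 x) (k1 x) c)) = prod_encode (acc + w * w1 x * F (k1 x), c)"
      using push_run[of "w * w1 x" "k1 x"] less.IH[OF R(1)] by auto
    obtain t2 where t2: "\<And>acc c. run t2 (prod_encode (acc, push (w * w2 x) (k2 x) c)) = prod_encode (acc + w * w2 x * F (k2 x), c)"
      using push_run[of "w * w2 x" "k2 x"] less.IH[OF R(2)] by auto
    have "run (Suc (t2 + t1)) (prod_encode (acc, lcons (prod_encode (w, x)) c)) = prod_encode (acc + w * F x, c)" for acc c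
    proof -
      have "run (Suc (t2 + t1)) (prod_encode (acc, lcons (prod_encode (w, x)) c))
        = prod_encode (acc + w * b x + w * w1 x * F (k1 x) + w * w2 x * F (k2 x), c)"
        unfolding run_Suc run_add by (simp add: step_def t1 t2)
      also have "acc + w * b x + w * w1 x * F (k1 x) + w * w2 x * F (k2 x) = acc + w * F x"
        by (subst (2) F) (simp add: algebra_simps)
      finally show ?thesis .
    qed
    then show ?case by blast
  qed
  define start where "start x = prod_encode (0, lcons (prod_encode (1, x)) 0)" for x
  have ex: "\<exists>t. run t (start x) = prod_encode (F x, 0)" for x
  proof -
    obtain t where t: "\<forall>acc c. run t (prod_encode (acc, lcons (prod_encode (1, x)) c)) = prod_encode (acc + 1 * F x, c)"
      using pop[of 1 x] by blast
    from t[rule_format, of 0 0] show ?thesis by (intro exI[of _ t]) (simp add: start_def)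
  qed
  define T where "T x = (LEAST t. psnd (run t (start x)) = 0)" for x
  have result: "pfst (run (T x) (start x)) = F x" for x
  proof -
    obtain t where t: "run t (start x) = prod_encode (F x, 0)" using ex by blast
    have T0: "psnd (run (T x) (start x)) = 0" unfolding T_def by (rule LeastI[of _ t]) (simp add: t)
    have le: "T x \<le> t" unfolding T_def by (rule Least_le) (simp add: t)
    have "run s (run (T x) (start x)) = run (T x) (start x)" for s
      by (induction s) (simp_all add: run_def step_def T0[unfolded run_def])
    from this[of "t - T x"] have "run t (start x) = run (T x) (start x)"
      using le by (simp add: run_add[symmetric])
    then show ?thesis using t by (metis pfst_pair)
  qed
  have cpush: "computable (\<lambda>x. push (f x) (g x) (h x))" if "computable f" "computable g" "computable h" for f g h
    unfolding push_def using that by (intro computable_intros)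
  have cstep: "computable (\<lambda>x. step (f x))" if "computable f" for f
    unfolding step_def using that by (intro computable_intros cpush ca)
  have cstart: "computable (\<lambda>x. start (f x))" if "computable f" for f
    unfolding start_def using that by (intro computable_intros)
  have crun: "computable (\<lambda>x. run (f x) (start (g x)))" if "computable f" "computable g" for f g
    unfolding run_def using that
    by (intro computable_rec_nat[where g = "\<lambda>_ r _. step r"] cstep cstart computable_intros)
  have "computable T"
    unfolding T_def
  proof (rule computable_least[where f = "\<lambda>t x. psnd (run t (start x))"])
    show "computable (\<lambda>p. psnd (run (pfst p) (start (psnd p))))" by (intro computable_intros crun)
    show "\<exists>t. psnd (run t (start x)) = 0" for x using ex[of x] by (metis psnd_pair)
  qed
  then have "computable (\<lambda>x. pfst (run (T x) (start x)))" by (intro computable_intros crun)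
  then show ?thesis by (simp add: result)
qed

section \<open>Computing the coefficients\<close>

text \<open>The recursion of \<open>character_poly\<close> for single coefficients and in natural numbers. The argument \<open>k\<close> is the
  exponent still to be used up by linear factors, and \<open>b\<close> is the parity of the number of minus
  signs still expected: \<open>leaf_count 0 k l\<close> and \<open>leaf_count 1 k l\<close> count the terms with positive and with
  negative sign. The two sums of the odd case are unrolled into \<open>split_count\<close>, which lowers the size \<open>d\<close> of the piece
  cut off, and \<open>merge_count\<close>, which moves the parts already treated from \<open>l\<close> to \<open>p\<close>. In this form
  every value is a combination of at most two others.\<close>

function (sequential) leaf_count :: "nat \<Rightarrow> nat \<Rightarrow> nat list \<Rightarrow> nat"
  and split_count :: "nat \<Rightarrow> nat \<Rightarrow> nat \<Rightarrow> nat list \<Rightarrow> nat \<Rightarrow> nat"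
  and merge_count :: "nat \<Rightarrow> nat \<Rightarrow> nat \<Rightarrow> nat list \<Rightarrow> nat list \<Rightarrow> nat" where
  "leaf_count b k [] = of_bool (k = 0 \<and> b = 0)"
| "leaf_count b k (h # l) =
    (if h = 1 then (if k = 0 then 0 else 2 * leaf_count b (k - 1) l)
       + 2 * sum_list l * leaf_count (1 - b) k l
     else if even h then 0
     else split_count (1 - b) k (h - 1) l (h - 2) + 2 * merge_count (1 - b) k (h - 1) l [])"
| "split_count b k c l 0 = 0"
| "split_count b k c l (Suc d) = leaf_count b k (Suc d # (c - Suc d) # l) + split_count b k c l d"
| "merge_count b k c [] p = 0"
| "merge_count b k c (r # l) p =
     r * leaf_count b k ((c + r) # rev p @ l) + merge_count b k c l (r # p)"
  by pat_completeness auto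

termination
  \<comment> \<open>Splitting and merging are weighted slightly above the lists that they produce, hence the
    factor \<open>2\<close> and the summand \<open>1\<close>. The maximum covers
    arguments with \<open>d > c\<close>, where the subtraction \<open>c - d\<close> is truncated.\<close>
  by (relation "measures
    [\<lambda>x. case x of Inl (b, k, l) \<Rightarrow> 2 * sum_list l
       | Inr (Inl (b, k, c, l, d)) \<Rightarrow> 2 * (max c d + sum_list l) + 1
       | Inr (Inr (b, k, c, l, p)) \<Rightarrow> 2 * (c + sum_list l + sum_list p) + 1,
     \<lambda>x. case x of Inl (b, k, l) \<Rightarrow> 0
       | Inr (Inl (b, k, c, l, d)) \<Rightarrow> d
       | Inr (Inr (b, k, c, l, p)) \<Rightarrow> length l]")
    (auto simp: max_def odd_pos elim!: oddE)

declare leaf_count.simps(2) [simp del]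

lemma split_count_eq: "split_count b k c l d = (\<Sum>e\<in>{1..<Suc d}. leaf_count b k (e # (c - e) # l))"
  by (induction d) simp_all

lemma merge_count_eq:
  "merge_count b k c l p
     = (\<Sum>i\<in>{..<length l}. l ! i * leaf_count b k ((c + l ! i) # rev p @ take i l @ drop (Suc i) l))"
proof (induction l arbitrary: p)
  case (Cons r l)
  show ?case by (simp add: Cons sum.lessThan_Suc_shift del: sum.lessThan_Suc)
qed simp

text \<open>Each level of the recursion that carries a minus sign exchanges \<open>b\<close> and \<open>1 - b\<close>.\<close>

lemma coeff_character_poly:
  assumes "b \<le> 1"
  shows "int (leaf_count b k l) - int (leaf_count (1 - b) k l)
    = (if b = 0 then 1 else - 1) * Polynomial.coeff (character_poly l) k"
  using assms
proof (induction l arbitrary: b k rule: character_poly.induct)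
  case 1
  then show ?case by (cases "k = 0"; cases "b = 0") auto
next
  case (2 h l)
  define s :: int where "s = (if b = 0 then 1 else - 1)"
  have b: "1 - (1 - b) = b" "(if 1 - b = 0 then 1 else - 1) = - s" "1 - b \<le> 1"
    using 2 by (auto simp: s_def)
  consider "h = 1" | "h \<noteq> 1" "even h" | "h \<noteq> 1" "odd h" by blast
  then have "int (leaf_count b k (h # l)) - int (leaf_count (1 - b) k (h # l)) = s * Polynomial.coeff (character_poly (h # l)) k"
  proof cases
    case 1
    define T where "T k = int (leaf_count b k l) - int (leaf_count (1 - b) k l)" for k
    have T: "T k = s * Polynomial.coeff (character_poly l) k" for k
      using "2.IH"(1)[OF 1 \<open>b \<le> 1\<close>, of k] by (simp add: T_def s_def)
    have "int (leaf_count b k (h # l)) - int (leaf_count (1 - b) k (h # l))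
        = (if k = 0 then 0 else 2 * T (k - 1)) - 2 * int (sum_list l) * T k"
      using 1 b(1) by (simp add: leaf_count.simps(2) T_def algebra_simps)
    also have "\<dots> = s * Polynomial.coeff (character_poly (h # l)) k"
      using 1 unfolding T by (cases k) (simp_all add: character_poly.simps(2) algebra_simps)
    finally show ?thesis .
  next
    case 2
    then show ?thesis by (simp add: leaf_count.simps(2) character_poly.simps(2))
  next
    case 3
    have h: "h - 1 = Suc (h - 2)" using 3 by (cases h) auto
    define T where "T l = int (leaf_count b k l) - int (leaf_count (1 - b) k l)" for l
    have T1: "T (d # (h - 1 - d) # l) = s * Polynomial.coeff (character_poly (d # (h - 1 - d) # l)) k"
      if "d \<in> {1..<h - 1}" for d
      using "2.IH"(2)[OF 3 that \<open>b \<le> 1\<close>, of k] by (simp add: T_def s_def)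
    have T2: "T ((h - 1 + l ! i) # take i l @ drop (Suc i) l)
        = s * Polynomial.coeff (character_poly ((h - 1 + l ! i) # take i l @ drop (Suc i) l)) k"
      if "i \<in> {..<length l}" for i
      using "2.IH"(3)[OF 3 that \<open>b \<le> 1\<close>, of k] by (simp add: T_def s_def)
    have L: "leaf_count c k (h # l) = (\<Sum>d\<in>{1..<h - 1}. leaf_count (1 - c) k (d # (h - 1 - d) # l))
       + 2 * (\<Sum>i\<in>{..<length l}. l ! i * leaf_count (1 - c) k ((h - 1 + l ! i) # take i l @ drop (Suc i) l))" for c
      using 3 by (subst leaf_count.simps(2)) (simp only: split_count_eq merge_count_eq h[symmetric] if_False rev.simps append_Nil)
    have "int (leaf_count b k (h # l)) - int (leaf_count (1 - b) k (h # l))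
        = - (\<Sum>d\<in>{1..<h - 1}. T (d # (h - 1 - d) # l))
          - 2 * (\<Sum>i\<in>{..<length l}. int (l ! i) * T ((h - 1 + l ! i) # take i l @ drop (Suc i) l))"
      unfolding L[of b] L[of "1 - b", unfolded b(1)] T_def
      by (simp add: sum_subtractf right_diff_distrib)
    also have "\<dots> = - (\<Sum>d\<in>{1..<h - 1}. s * Polynomial.coeff (character_poly (d # (h - 1 - d) # l)) k)
          - 2 * (\<Sum>i\<in>{..<length l}. int (l ! i) * (s * Polynomial.coeff (character_poly ((h - 1 + l ! i) # take i l @ drop (Suc i) l)) k))"
      using T1 T2 by simp
    also have "\<dots> = s * (- (\<Sum>d\<in>{1..<h - 1}. Polynomial.coeff (character_poly (d # (h - 1 - d) # l)) k)
          - 2 * (\<Sum>i\<in>{..<length l}. int (l ! i) * Polynomial.coeff (character_poly ((h - 1 + l ! i) # take i l @ drop (Suc i) l)) k))"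
      unfolding right_diff_distrib sum_distrib_left mult_minus_right
      by (simp add: mult.left_commute)
    also have "\<dots> = s * Polynomial.coeff (character_poly (h # l)) k"
    proof -
      have e: "Polynomial.coeff (of_nat a * p) k = int a * Polynomial.coeff p k" for a and p :: "int poly"
        by (simp add: of_nat_poly)
      have e2: "Polynomial.coeff (2 * p) k = 2 * Polynomial.coeff p k" for p :: "int poly"
        by (simp only: mult_2 coeff_add)
      show ?thesis
        using 3 by (subst character_poly.simps(2)) (simp only: if_False coeff_diff coeff_minus coeff_sum e e2)
    qed
    finally show ?thesis .
  qed
  then show ?case by (simp only: s_def)
qed

definition list_sum :: "nat \<Rightarrow> nat" where
  "list_sum c = fold (\<lambda>e r. e + r) (list_decode c) 0"

lemma list_sum_eq: "list_sum c = sum_list (list_decode c)"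
proof -
  have "fold (\<lambda>e r. e + r) xs a = sum_list xs + a" for xs and a :: nat
    by (induction xs arbitrary: a) auto
  then show ?thesis by (simp add: list_sum_def)
qed

definition rev_append :: "nat \<Rightarrow> nat \<Rightarrow> nat" where
  "rev_append p c = fold lcons (list_decode p) c"

lemma list_decode_rev_append: "list_decode (rev_append p c) = rev (list_decode p) @ list_decode c"
proof -
  have "list_decode (fold lcons xs c) = rev xs @ list_decode c" for xs
    by (induction xs arbitrary: c) auto
  then show ?thesis by (simp add: rev_append_def)
qed

lemma computable_list_sum [computable_intros]: "computable f \<Longrightarrow> computable (\<lambda>x. list_sum (f x))"
  unfolding list_sum_def by (intro computable_fold[where s = "\<lambda>e r _. e + r"] computable_intros)

lemma computable_rev_append [computable_intros]:
  "computable f \<Longrightarrow> computable g \<Longrightarrow> computable (\<lambda>x. rev_append (f x) (g x))"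
  unfolding rev_append_def by (intro computable_fold[where s = "\<lambda>e r _. lcons e r"] computable_intros)

text \<open>The arguments of the three functions in one number: the tag \<open>t\<close> selects the function, \<open>l\<close> is the code
  of a list, and \<open>p\<close> is \<open>d\<close> for \<open>split_count\<close> and the code of a list for \<open>merge_count\<close>.\<close>

definition node :: "nat \<Rightarrow> nat \<Rightarrow> nat \<Rightarrow> nat \<Rightarrow> nat \<Rightarrow> nat \<Rightarrow> nat" where
  "node t b k c l p = prod_encode (t, prod_encode (b, prod_encode (k, prod_encode (c, prod_encode (l, p)))))"

definition "node_t x = pfst x"
definition "node_b x = pfst (psnd x)"
definition "node_k x = pfst (psnd (psnd x))"
definition "node_c x = pfst (psnd (psnd (psnd x)))"
definition "node_l x = pfst (psnd (psnd (psnd (psnd x))))"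
definition "node_p x = psnd (psnd (psnd (psnd (psnd x))))"

lemmas node_sel_defs = node_t_def node_b_def node_k_def node_c_def node_l_def node_p_def

lemma node_sels [simp]:
  "node_t (node t b k c l p) = t" "node_b (node t b k c l p) = b" "node_k (node t b k c l p) = k"
  "node_c (node t b k c l p) = c" "node_l (node t b k c l p) = l" "node_p (node t b k c l p) = p"
  by (simp_all add: node_def node_sel_defs)

lemma computable_node [computable_intros]:
  "computable t \<Longrightarrow> computable b \<Longrightarrow> computable k \<Longrightarrow> computable c \<Longrightarrow> computable l \<Longrightarrow> computable p \<Longrightarrow>
    computable (\<lambda>x. node (t x) (b x) (k x) (c x) (l x) (p x))"
  unfolding node_def by (intro computable_intros)

lemma computable_node_sels [computable_intros]:
  "computable f \<Longrightarrow> computable (\<lambda>x. node_t (f x))" "computable f \<Longrightarrow> computable (\<lambda>x. node_b (f x))"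
  "computable f \<Longrightarrow> computable (\<lambda>x. node_k (f x))" "computable f \<Longrightarrow> computable (\<lambda>x. node_c (f x))"
  "computable f \<Longrightarrow> computable (\<lambda>x. node_l (f x))" "computable f \<Longrightarrow> computable (\<lambda>x. node_p (f x))"
  unfolding node_sel_defs by (intro computable_intros; assumption)+

definition node_count :: "nat \<Rightarrow> nat" where
  "node_count x = (if node_t x = 0 then leaf_count (node_b x) (node_k x) (list_decode (node_l x))
     else if node_t x = 1 then split_count (node_b x) (node_k x) (node_c x) (list_decode (node_l x)) (node_p x)
     else merge_count (node_b x) (node_k x) (node_c x) (list_decode (node_l x)) (list_decode (node_p x)))"

definition node_base :: "nat \<Rightarrow> nat" where
  "node_base x = (if node_t x = 0 \<and> node_l x = 0 \<and> node_k x = 0 \<and> node_b x = 0 then 1 else 0)"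

definition node_weight1 :: "nat \<Rightarrow> nat" where
  "node_weight1 x =
    (if node_t x = 0 then
       if node_l x = 0 then 0
       else if lhd (node_l x) = 1 then if node_k x = 0 then 0 else 2
       else if even (lhd (node_l x)) then 0 else 1
     else if node_t x = 1 then if node_p x = 0 then 0 else 1
     else if node_l x = 0 then 0 else lhd (node_l x))"

definition node_child1 :: "nat \<Rightarrow> nat" where
  "node_child1 x =
    (if node_t x = 0 then
       if lhd (node_l x) = 1 then node 0 (node_b x) (node_k x - 1) 0 (ltl (node_l x)) 0
       else node 1 (1 - node_b x) (node_k x) (lhd (node_l x) - 1) (ltl (node_l x)) (lhd (node_l x) - 2)
     else if node_t x = 1 then
       node 0 (node_b x) (node_k x) 0 (lcons (node_p x) (lcons (node_c x - node_p x) (node_l x))) 0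
     else node 0 (node_b x) (node_k x) 0
       (lcons (node_c x + lhd (node_l x)) (rev_append (node_p x) (ltl (node_l x)))) 0)"

definition node_weight2 :: "nat \<Rightarrow> nat" where
  "node_weight2 x =
    (if node_t x = 0 then
       if node_l x = 0 then 0
       else if lhd (node_l x) = 1 then 2 * list_sum (ltl (node_l x))
       else if even (lhd (node_l x)) then 0 else 2
     else if node_t x = 1 then if node_p x = 0 then 0 else 1
     else if node_l x = 0 then 0 else 1)"

definition node_child2 :: "nat \<Rightarrow> nat" where
  "node_child2 x =
    (if node_t x = 0 then
       if lhd (node_l x) = 1 then node 0 (1 - node_b x) (node_k x) 0 (ltl (node_l x)) 0
       else node 2 (1 - node_b x) (node_k x) (lhd (node_l x) - 1) (ltl (node_l x)) 0
     else if node_t x = 1 then node 1 (node_b x) (node_k x) (node_c x) (node_l x) (node_p x - 1)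
     else node 2 (node_b x) (node_k x) (node_c x) (ltl (node_l x)) (lcons (lhd (node_l x)) (node_p x)))"

text \<open>The termination measure of the three functions on codes; \<open>node_rank\<close> is compared first.\<close>

definition node_rank :: "nat \<Rightarrow> nat" where
  "node_rank x = (if node_t x = 0 then 2 * sum_list (list_decode (node_l x))
     else if node_t x = 1 then 2 * (max (node_c x) (node_p x) + sum_list (list_decode (node_l x))) + 1
     else 2 * (node_c x + sum_list (list_decode (node_l x)) + sum_list (list_decode (node_p x))) + 1)"

definition node_rank_within :: "nat \<Rightarrow> nat" where
  "node_rank_within x = (if node_t x = 0 then 0 else if node_t x = 1 then node_p x
     else length (list_decode (node_l x)))"

theorem computable_node_count: "computable node_count"
proof (rule computable_tree_recursion)
  show "computable node_base" "computable node_weight1" "computable node_weight2"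
    "computable node_child1" "computable node_child2"
    unfolding node_base_def node_weight1_def node_weight2_def node_child1_def node_child2_def
    by (intro computable_intros)+
  show "wf (measures [node_rank, node_rank_within])" by simp
  show "(node_child1 x, x) \<in> measures [node_rank, node_rank_within]" if "node_weight1 x \<noteq> 0" for x
    using that
    by (cases "node_l x" rule: list_code_cases)
      (auto simp: node_weight1_def node_child1_def node_rank_def node_rank_within_def
        list_decode_rev_append max_def odd_pos split: if_splits elim!: oddE)
  show "(node_child2 x, x) \<in> measures [node_rank, node_rank_within]" if "node_weight2 x \<noteq> 0" for x
    using that
    by (cases "node_l x" rule: list_code_cases)
      (auto simp: node_weight2_def node_child2_def node_rank_def node_rank_within_def list_sum_eq
        max_def odd_pos split: if_splits elim!: oddE)
  show "node_count x = node_base x + node_weight1 x * node_count (node_child1 x) + node_weight2 x * node_count (node_child2 x)" for x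
  proof -
    consider "node_t x = 0" | "node_t x = 1" | "node_t x \<noteq> 0" "node_t x \<noteq> 1" by blast
    then show ?thesis
    proof cases
      case 1
      then show ?thesis
        by (cases "node_l x" rule: list_code_cases)
          (simp_all add: node_count_def node_base_def node_weight1_def node_weight2_def
            node_child1_def node_child2_def list_sum_eq leaf_count.simps(2))
    next
      case 2
      then show ?thesis
        by (cases "node_p x")
          (simp_all add: node_count_def node_base_def node_weight1_def node_weight2_def
            node_child1_def node_child2_def)
    next
      case 3
      then show ?thesis
        by (cases "node_l x" rule: list_code_cases)
          (simp_all add: node_count_def node_base_def node_weight1_def node_weight2_def
            node_child1_def node_child2_def list_decode_rev_append)
    qed
  qed
qed

text \<open>The code \<open>int_encode\<close> of a difference of two natural numbers.\<close>

definition coeff_code :: "nat \<Rightarrow> nat \<Rightarrow> nat" where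
  "coeff_code c k =
    (if node_count (node 0 1 k 0 c 0) \<le> node_count (node 0 0 k 0 c 0)
     then 2 * (node_count (node 0 0 k 0 c 0) - node_count (node 0 1 k 0 c 0))
     else Suc (2 * (node_count (node 0 1 k 0 c 0) - node_count (node 0 0 k 0 c 0) - 1)))"

lemma coeff_code_eq: "coeff_code c k = int_encode (Polynomial.coeff (character_poly (list_decode c)) k)"
proof -
  have "Polynomial.coeff (character_poly (list_decode c)) k = int (node_count (node 0 0 k 0 c 0)) - int (node_count (node 0 1 k 0 c 0))"
    using coeff_character_poly[of 0 k "list_decode c"] by (simp add: node_count_def)
  then show ?thesis
    by (auto simp: coeff_code_def int_encode_def sum_encode_def nat_diff_distrib')
qed

text \<open>The list is built from its last entry, so the counter \<open>y\<close> produces the coefficient at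
  \<open>list_sum c - y\<close>.\<close>

definition poly_code :: "nat \<Rightarrow> nat" where
  "poly_code c = rec_nat 0 (\<lambda>y r. lcons (coeff_code c (list_sum c - y)) r) (Suc (list_sum c))"

lemma poly_code_eq:
  assumes "sum_list l = s"
  shows "poly_code (list_encode l)
    = list_encode (map int_encode (map (Polynomial.coeff (character_poly l)) [0..<Suc s]))"
proof -
  have "rec_nat 0 (\<lambda>y r. lcons (f (s - y)) r) j = list_encode (map f [Suc s - j..<Suc s])" if "j \<le> Suc s" for f j
    using that
  proof (induction j)
    case (Suc j)
    then have "[Suc s - Suc j..<Suc s] = (s - j) # [Suc s - j..<Suc s]"
      using upt_conv_Cons[of "s - j" "Suc s"] by (simp add: Suc_diff_le del: upt_Suc)
    then show ?case using Suc by (simp add: list_encode_Cons del: list_encode.simps upt_Suc)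
  qed simp
  from this[of "Suc s" "\<lambda>k. int_encode (Polynomial.coeff (character_poly l) k)"] show ?thesis
    using assms by (simp add: poly_code_def coeff_code_eq list_sum_eq comp_def del: upt_Suc)
qed

definition ones_code :: "nat \<Rightarrow> nat" where
  "ones_code s = rec_nat 0 (\<lambda>_ r. lcons 1 r) s"

lemma ones_code_eq: "ones_code s = list_encode (replicate s 1)"
  by (induction s) (simp_all add: ones_code_def list_encode_Cons del: list_encode.simps(2))

text \<open>Numerator and denominator are computed by the same procedure, as the denominator belongs to the
  partition with all parts \<open>1\<close>.\<close>

definition ratfun_algorithm :: "nat \<Rightarrow> nat" where
  "ratfun_algorithm c = prod_encode (poly_code c, poly_code (ones_code (list_sum c)))"

theorem computable_ratfun_algorithm: "computable ratfun_algorithm"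
proof -
  note cc = computable_app[OF computable_node_count]
  have coeff: "computable (\<lambda>x. coeff_code (f x) (g x))" if "computable f" "computable g" for f g
    unfolding coeff_code_def using that by (intro computable_intros cc)
  have pc: "computable (\<lambda>x. poly_code (f x))" if "computable f" for f
    unfolding poly_code_def
    by (rule computable_app[OF _ that, where f = poly_code, unfolded poly_code_def])
      (intro computable_rec_nat[where g = "\<lambda>y r c. lcons (coeff_code c (list_sum c - y)) r"] coeff computable_intros)
  have oc: "computable (\<lambda>x. ones_code (f x))" if "computable f" for f
    unfolding ones_code_def using that
    by (intro computable_rec_nat[where g = "\<lambda>_ r _. lcons 1 r"] computable_intros)
  show ?thesis unfolding ratfun_algorithm_def by (intro computable_intros pc oc)
qed

section \<open>The rational functions\<close>

text \<open>Evaluation refers to the reduced fraction. Its numerator and denominator have no common root, so a root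
  of the reduced denominator is a root of every denominator.\<close>

lemma ratfun_eval_Fract:
  assumes q: "poly q x \<noteq> 0"
  shows "ratfun_defined_at (Fract p q) x" and "ratfun_eval (Fract p q) x = poly p x / poly q x"
proof -
  define p' q' where "p' = fst (quot_of_fract (Fract p q))" and "q' = snd (quot_of_fract (Fract p q))"
  have q0: "q \<noteq> 0" using q by auto
  have q'0: "q' \<noteq> 0" unfolding q'_def by (rule snd_quot_of_fract_nonzero)
  have "Fract p' q' = Fract p q" unfolding p'_def q'_def by (rule Fract_quot_of_fract)
  then have eq: "p' * q = p * q'" using q0 q'0 by (simp add: eq_fract)
  then have eqx: "poly p' x * poly q x = poly p x * poly q' x" by (metis poly_mult)
  have cop: "coprime p' q'" unfolding p'_def q'_def by (rule coprime_quot_of_fract)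
  have "poly q' x \<noteq> 0"
  proof
    assume z: "poly q' x = 0"
    then have "poly p' x = 0" using eqx q by simp
    then have "[:- x, 1:] dvd p'" "[:- x, 1:] dvd q'" using z by (simp_all add: poly_eq_0_iff_dvd)
    then have "is_unit [:- x, 1:]" using cop by (metis coprime_common_divisor)
    then show False by (simp add: is_unit_pCons_iff)
  qed
  then show "ratfun_defined_at (Fract p q) x" "ratfun_eval (Fract p q) x = poly p x / poly q x"
    using q eqx unfolding ratfun_defined_at_def ratfun_eval_def p'_def[symmetric] q'_def[symmetric]
    by (simp_all add: field_simps)
qed

text \<open>Built from the coefficient list in the same way as a decoded polynomial. The list is complete by
  \<open>degree_character_poly\<close>.\<close>

definition rat_poly :: "nat list \<Rightarrow> rat poly" where
  "rat_poly l = Poly (map rat_of_int (map (Polynomial.coeff (character_poly l)) [0..<Suc (sum_list l)]))"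

lemma rat_poly_eval: "poly (rat_poly l) (of_nat n) = of_int (poly (character_poly l) (int n))"
proof -
  have "rat_poly l = map_poly of_int (character_poly l)"
  proof (rule poly_eqI)
    fix k
    show "Polynomial.coeff (rat_poly l) k = Polynomial.coeff (map_poly of_int (character_poly l)) k"
      using coeff_eq_0[of "character_poly l" k] degree_character_poly[of l]
      by (auto simp: rat_poly_def coeff_map_poly nth_default_def simp del: upt_Suc)
  qed
  moreover have "poly (map_poly rat_of_int p) (of_int y) = of_int (poly p y)" for p y
    by (induction p) (simp_all add: map_poly_pCons)
  from this[of _ "int n"] have "poly (map_poly rat_of_int p) (of_nat n) = of_int (poly p (int n))" for p by simp
  ultimately show ?thesis by simp
qed

lemma character_poly_ones: "poly (character_poly (replicate s 1)) x = (\<Prod>j<s. 2 * (x - int j))"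
  by (induction s) (simp_all add: character_poly.simps(2) sum_list_replicate algebra_simps)

definition ratfun :: "nat multiset \<Rightarrow> rat poly fract" where
  "ratfun \<alpha> = Fract (rat_poly (sorted_list_of_multiset \<alpha>)) (rat_poly (replicate (sum_mset \<alpha>) 1))"

lemma rat_poly_ones_nonzero:
  assumes "s \<le> n" shows "poly (rat_poly (replicate s 1)) (of_nat n) \<noteq> 0"
  unfolding rat_poly_eval character_poly_ones using assms by (auto simp: of_nat_diff)

text \<open>Degree and character value are \<open>\<Phi>\<close> at the types of \<open>id\<close> and \<open>g\<close>, so their quotient is given by
  \<open>character_poly_value\<close>.\<close>

theorem ratfun_value:
  assumes irr: "irreducible_character (sym_group n) \<psi>" and dz: "defect_zero 2 (sym_group n) \<psi>"
    and \<alpha>: "partition_of m \<alpha>" "m \<le> n"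
    and g: "g permutes {1..n}" "cycle_type n g = \<alpha> + replicate_mset (n - m) 1"
  shows "(of_rat (ratfun_eval (ratfun \<alpha>) (rat_of_nat n)) :: complex) = \<psi> g / \<psi> id"
proof -
  interpret G: group "sym_group n" by (rule sym_group_is_group)
  obtain d \<rho> where rho: "irreducible_representation (sym_group n) d \<rho>"
    and \<psi>: "\<And>g. g permutes {1..n} \<Longrightarrow> \<psi> g = mat_trace (\<rho> g)"
    using irr unfolding irreducible_character_def sym_group_carrier Ball_def by blast
  have rep: "representation (sym_group n) d \<rho>" and d: "0 < d"
    using rho unfolding irreducible_representation_def by simp_all
  have "\<rho> id = 1\<^sub>m d" using representationD(3)[OF rep G.is_group] by (simp add: sym_group_one)
  then have \<psi>id: "\<psi> id = of_nat d" using \<psi>[OF permutes_id] by (simp add: mat_trace_def)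
  then have mult: "multiplicity 2 d = multiplicity 2 (Coset.order (sym_group n))"
    using dz unfolding defect_zero_def sym_group_one by auto
  obtain \<Phi> where \<Phi>: "\<And>g. g permutes {1..n} \<Longrightarrow> mat_trace (\<rho> g) = \<Phi> (cycle_type n g)"
    and even: "\<And>\<tau> r. r \<in># \<tau> \<Longrightarrow> even r \<Longrightarrow> \<Phi> \<tau> = 0"
    and rec: "\<And>g m \<gamma>. g permutes {1..n} \<Longrightarrow> cycle_type n g = add_mset m \<gamma> \<Longrightarrow> even m \<Longrightarrow>
      (\<Sum>d\<in>{1..<m}. \<Phi> (\<gamma> + {#d, m - d#}))
       + 2 * (\<Sum>r\<in>#\<gamma>. of_nat r * \<Phi> (\<gamma> - {#r#} + {#m + r#})) = 0"
    using defect_zero_recursion[OF rho mult] by blast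
  have rec': "(\<Sum>d\<in>{1..<m}. \<Phi> (\<gamma> + {#d, m - d#}))
       + 2 * (\<Sum>r\<in>#\<gamma>. of_nat r * \<Phi> (\<gamma> - {#r#} + {#m + r#})) = 0"
    if "partition_of n (add_mset m \<gamma>)" "even m" for m \<gamma>
    using exists_permutation_of_cycle_type[OF that(1)] rec that(2) by blast
  define l where "l = sorted_list_of_multiset \<alpha>"
  have l: "mset l = \<alpha>" "0 \<notin> set l" "sum_list l = m"
    using \<alpha>(1) by (auto simp: l_def partition_of_def sum_mset_sum_list[symmetric])
  have one: "\<Phi> (replicate_mset n 1) = of_nat d"
  proof -
    have "cycle_type n id = replicate_mset n 1" by (rule cycle_type_id)
    then show ?thesis using \<Phi>[OF permutes_id] \<psi>[OF permutes_id] \<psi>id by simp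
  qed
  have val: "of_int (poly (character_poly l) (int n)) * \<Phi> (replicate_mset n 1)
       = (\<Prod>j<m. 2 * (of_nat n - of_nat j)) * \<Phi> (mset l + replicate_mset (n - m) 1)"
    using character_poly_value[of \<Phi> n l, OF even rec'] l \<alpha>(2) by simp
  define D :: complex where "D = (\<Prod>j<m. 2 * (of_nat n - of_nat j))"
  have D: "of_int (poly (character_poly (replicate m 1)) (int n)) = D"
    unfolding character_poly_ones D_def by simp
  have D0: "D \<noteq> 0" unfolding D_def using \<alpha>(2) by (auto simp: of_nat_eq_iff)
  have "\<psi> g = \<Phi> (mset l + replicate_mset (n - m) 1)" using \<psi>[OF g(1)] \<Phi>[OF g(1)] g(2) l by simp
  then have "of_int (poly (character_poly l) (int n)) * \<psi> id = D * \<psi> g"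
    using val unfolding one \<psi>id D_def by simp
  then have "of_int (poly (character_poly l) (int n)) / D = \<psi> g / \<psi> id"
    using D0 \<psi>id d by (simp add: field_simps)
  moreover have "ratfun_eval (ratfun \<alpha>) (rat_of_nat n)
      = of_int (poly (character_poly l) (int n)) / of_int (poly (character_poly (replicate m 1)) (int n))"
    using \<alpha> ratfun_eval_Fract(2)[OF rat_poly_ones_nonzero[OF \<alpha>(2)], of "rat_poly l"]
    by (simp add: ratfun_def l_def rat_poly_eval partition_of_def)
  ultimately show ?thesis by (simp only: of_rat_divide of_rat_of_int_eq D)
qed

theorem theoremC:
  shows "\<exists>R :: nat multiset \<Rightarrow> rat poly fract.
    (\<forall>m \<alpha>. 0 < m \<and> partition_of m \<alpha> \<longrightarrow>
      (\<forall>k n \<psi>. 0 < k \<and> n = k * (k + 1) div 2 \<and> m \<le> n \<and>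
          irreducible_character (sym_group n) \<psi> \<and> defect_zero 2 (sym_group n) \<psi> \<longrightarrow>
        ratfun_defined_at (R \<alpha>) (rat_of_nat n) \<and>
        (\<forall>g. g \<in> carrier (sym_group n) \<and> cycle_type n g = \<alpha> + replicate_mset (n - m) 1 \<longrightarrow>
          (of_rat (ratfun_eval (R \<alpha>) (rat_of_nat n)) :: complex) = \<psi> g / \<psi> id))) \<and>
    (\<exists>a. computable a \<and>
      (\<forall>m \<alpha>. 0 < m \<and> partition_of m \<alpha> \<longrightarrow>
        encodes_ratfun (a (partition_code \<alpha>)) (R \<alpha>)))"
proof (intro exI[of _ ratfun] conjI allI impI)
  fix m \<alpha> k n \<psi>
  assume \<alpha>: "0 < m \<and> partition_of m \<alpha>"
    and a: "0 < k \<and> n = k * (k + 1) div 2 \<and> m \<le> n \<and>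
          irreducible_character (sym_group n) \<psi> \<and> defect_zero 2 (sym_group n) \<psi>"
  show "ratfun_defined_at (ratfun \<alpha>) (rat_of_nat n)"
    unfolding ratfun_def using \<alpha> a
    by (intro ratfun_eval_Fract rat_poly_ones_nonzero) (auto simp: partition_of_def)
  fix g assume "g \<in> carrier (sym_group n) \<and> cycle_type n g = \<alpha> + replicate_mset (n - m) 1"
  then show "(of_rat (ratfun_eval (ratfun \<alpha>) (rat_of_nat n)) :: complex) = \<psi> g / \<psi> id"
    using \<alpha> a by (intro ratfun_value) (auto simp: sym_group_carrier)
next
  show "\<exists>a. computable a \<and>
      (\<forall>m \<alpha>. 0 < m \<and> partition_of m \<alpha> \<longrightarrow> encodes_ratfun (a (partition_code \<alpha>)) (ratfun \<alpha>))"
  proof (intro exI[of _ ratfun_algorithm] conjI allI impI computable_ratfun_algorithm)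
    fix m \<alpha> assume "0 < m \<and> partition_of m \<alpha>"
    define l where "l = sorted_list_of_multiset \<alpha>"
    define s where "s = sum_mset \<alpha>"
    have s: "sum_list l = s" by (simp add: l_def s_def sum_mset_sum_list[symmetric])
    have s1: "sum_list (replicate s (1::nat)) = s" by (simp add: sum_list_replicate)
    define ps where "ps = map (Polynomial.coeff (character_poly l)) [0..<Suc s]"
    define qs where "qs = map (Polynomial.coeff (character_poly (replicate s 1))) [0..<Suc s]"
    have "list_sum (list_encode l) = s" by (simp add: list_sum_eq s)
    then have "ratfun_algorithm (partition_code \<alpha>) = ratfun_code ps qs"
      unfolding ratfun_algorithm_def partition_code_def l_def[symmetric] ratfun_code_def ps_def qs_def
      using poly_code_eq[OF s] poly_code_eq[OF s1] by (simp only: ones_code_eq)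
    moreover have "rat_poly (replicate s 1) \<noteq> 0" using rat_poly_ones_nonzero[of s s] by auto
    moreover have "Poly (map rat_of_int qs) = rat_poly (replicate s 1)"
      unfolding qs_def rat_poly_def s1 ..
    moreover have "Poly (map rat_of_int ps) = rat_poly l" unfolding ps_def rat_poly_def s ..
    ultimately show "encodes_ratfun (ratfun_algorithm (partition_code \<alpha>)) (ratfun \<alpha>)"
      unfolding encodes_ratfun_def ratfun_def l_def[symmetric] s_def[symmetric] by metis
  qed
qed

end
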